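(* (1) Let $W$ be the Weyl group of type $A_n$ and $\sigma$ an automorphism of order 2 with $\sigma(I)=I$. Then for any $\alpha=(\alpha_1, \dots, \alpha_l)$ with $\alpha_1 \ge \alpha_2 \ge \cdots \ge \alpha_l \ge 1$ and $\sum_{1 \le i \le l} (2 \alpha_i-1)=n+1$, the element $$w_{\alpha}=s_{[n+1-\alpha_1, 1]}\, s_{[n+2-\alpha_1-\alpha_2,\, \alpha_1+1]} \cdots s_{[n+l-\sum_{1 \le i \le l} \alpha_i,\ \sum_{1 \le i \le l-1} \alpha_i+1]}$$ satisfies $$\underline w_{\alpha} \sigma(\underline w_{\alpha}) \cdots \sigma^{2d-1}(\underline w_{\alpha})=\underline w_{I_1}^{e_1} \underline w_{I_2}^{e_2-e_1} \cdots \underline w_{I_l}^{e_l-e_{l-1}}\quad\text{in } B^+,$$ where $d$ is the least common multiple of the $2 \alpha_i-1$, $e_i=2d/(2 \alpha_i-1)$ and $I_i=\{\sum_{1 \le k \le i-1} \alpha_k-i+2,\ \sum_{1 \le k \le i-1} \alpha_k-i+3, \dots, n-\sum_{1 \le k \le i-1} \alpha_k\}$. (2) Let $W$ be the Weyl group of type $B_n$. Then for any partition $\alpha=(\alpha_1, \dots, \alpha_l)$ of $n$ (with $\alpha_1\ge\cdots\ge\alpha_l\ge1$), the element $$w_{\alpha}=(s_{[n-1, \alpha_1]}^{-1} s_{[n, 1]}) (s_{[n-1, \alpha_1+\alpha_2]}^{-1} s_{[n, \alpha_1+1]}) \cdots (s_{[n,\ \sum_{1 \le i \le l-1} \alpha_i+1]})$$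 satisfies $$(\underline w_{\alpha})^{d}=\underline w_{I_1}^{e_1} \underline w_{I_2}^{e_2-e_1} \cdots \underline w_{I_l}^{e_l-e_{l-1}}\quad\text{in } B^+,$$ where $d$ is the least common multiple of the $\alpha_i$, $e_i=d/\alpha_i$ and $I_i=\{\sum_{1 \le k \le i-1} \alpha_k+1,\ \sum_{1 \le k \le i-1} \alpha_k+2, \dots, n\}$. (3) Let $W$ be the Weyl group of type $D_n$. Let $\sigma_0=\mathrm{id}$ and let $\sigma_1$ be the automorphism of order 2 of $W$ with $\sigma_1(I)=I$ (exchanging $s_{n-1}$ and $s_n$ and fixing the other simple reflections). Let $\epsilon\in\{0,1\}$. Then for any partition $\alpha=(\alpha_1, \dots, \alpha_l)$ of $n$ (with $\alpha_1\ge\cdots\ge\alpha_l\ge1$) with $l-\epsilon$ even, the element $$w'_{\alpha}=w_{0, \alpha_1} w_{\alpha_1, \alpha_1+\alpha_2} \cdots w_{\sum_{1 \le i \le l-1} \alpha_i,\ \sum_{1 \le i \le l} \alpha_i}$$ satisfies $$\underline w'_{\alpha} \sigma_\epsilon(\underline w'_{\alpha}) \cdots \sigma_\epsilon^{2d-1}(\underline w'_{\alpha})=\underline w_{I_1}^{e_1} \underline w_{I_2}^{e_2-e_1} \cdots \underline w_{I_l}^{e_l-e_{l-1}}\quad\text{in } B^+,$$ where $d$ is the least common multiple of the $\alpha_i$, $e_i=2 d/\alpha_i$, and $I_i=\{\sum_{1 \le k \le i-1} \alpha_k+1,\ \sum_{1 \le k \le i-1} \alpha_k+2, \dots, n\}$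 if $\sum_{1 \le k \le i-1} \alpha_k \le n-2$ and $I_i=\varnothing$ otherwise.
   Context: Simple reflections $s_1,\dots,s_n$, $I=\{1,\dots,n\}$, are labelled as in Bourbaki: in type $A_n$ the diagram is the chain $1-2-\cdots-n$; in type $B_n$ it is the same chain with the double bond between $n-1$ and $n$; in type $D_n$ it is the chain $1-2-\cdots-(n-2)$ with both $n-1$ and $n$ joined to $n-2$ (and $n-1$, $n$ not joined to each other). Set $s_{[a,b]}=s_as_{a-1}\cdots s_b$ if $a\ge b$, and $s_{[a,b]}=1$ otherwise. In type $D_n$, for $0\le a<b\le n$, set $w_{a,b}=s_{[n-2,b]}^{-1}s_{[n,a+1]}$ if $b\le n-1$, and $w_{a,n}=s_{[n-1,a+1]}$. For $K\subset I$, $w_K$ is the longest element of the standard parabolic subgroup $W_K$ ($w_\varnothing=1$). $B^+$ is the braid monoid associated with $(W,I)$; for $w\in W$, $\underline w\in B^+$ is its canonical lift: $w\mapsto\underline w$ sends each simple reflection to the corresponding generator of $B^+$ and satisfies $\underline{w_1w_2}=\underline{w_1}\,\underline{w_2}$ whenever $l(w_1w_2)=l(w_1)+l(w_2)$; $\underline w_K$ denotes the lift of $w_K$. A diagram automorphism $\sigma$ of $W$ extends to an automorphism of $B^+$, denoted by the same symbol. *)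

theory Defs
  imports "HOL-Algebra.Generated_Groups"
begin

section \<open>Monoids given by generators and relations\<close>

inductive word_eq :: "'a set \<Rightarrow> ('a list \<times> 'a list) set \<Rightarrow> 'a list \<Rightarrow> 'a list \<Rightarrow> bool"
  for X :: "'a set" and R :: "('a list \<times> 'a list) set" where
  refl: "u \<in> lists X \<Longrightarrow> word_eq X R u u"
| sym: "word_eq X R u v \<Longrightarrow> word_eq X R v u"
| trans: "word_eq X R u v \<Longrightarrow> word_eq X R v w \<Longrightarrow> word_eq X R u w"
| rel: "(u, v) \<in> R \<Longrightarrow> a \<in> lists X \<Longrightarrow> u \<in> lists X \<Longrightarrow> v \<in> lists X \<Longrightarrow> b \<in> lists X
    \<Longrightarrow> word_eq X R (a @ u @ b) (a @ v @ b)"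

definition word_class :: "'a set \<Rightarrow> ('a list \<times> 'a list) set \<Rightarrow> 'a list \<Rightarrow> 'a list set" where
  "word_class X R u = {v. word_eq X R u v}"

definition presented_monoid :: "'a set \<Rightarrow> ('a list \<times> 'a list) set \<Rightarrow> 'a list set monoid" where
  "presented_monoid X R =
    \<lparr>carrier = word_class X R ` lists X,
     mult = (\<lambda>A B. \<Union>u\<in>A. \<Union>v\<in>B. word_class X R (u @ v)),
     one = word_class X R []\<rparr>"

definition list_prod :: "('a, 'b) monoid_scheme \<Rightarrow> 'a list \<Rightarrow> 'a" where
  "list_prod G xs = foldr (mult G) xs \<one>\<^bsub>G\<^esub>"


section \<open>Weyl groups of classical type and their braid monoids\<close>

datatype dynkin = TypeA nat | TypeB nat | TypeD nat

fun rank :: "dynkin \<Rightarrow> nat" where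
  "rank (TypeA n) = n"
| "rank (TypeB n) = n"
| "rank (TypeD n) = n"

definition nodes :: "dynkin \<Rightarrow> nat set" where
  "nodes t = {1..rank t}"

text \<open>The Coxeter matrix for the Bourbaki labelling; only the entries with indices in
  \<open>nodes t\<close> matter.\<close>

fun coxeter_entry :: "dynkin \<Rightarrow> nat \<Rightarrow> nat \<Rightarrow> nat" where
  "coxeter_entry (TypeA n) i j =
    (if i = j then 1 else if Suc i = j \<or> Suc j = i then 3 else 2)"
| "coxeter_entry (TypeB n) i j =
    (if i = j then 1
     else if Suc i = j \<or> Suc j = i then (if i = n \<or> j = n then 4 else 3)
     else 2)"
| "coxeter_entry (TypeD n) i j =
    (if i = j then 1
     else if {i, j} = {n - 1, n} then 2
     else if {i, j} = {n - 2, n} then 3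
     else if Suc i = j \<or> Suc j = i then 3
     else 2)"

fun alternating :: "nat \<Rightarrow> nat \<Rightarrow> nat \<Rightarrow> nat list" where
  "alternating 0 i j = []"
| "alternating (Suc k) i j = i # alternating k j i"

text \<open>The Coxeter relations \<open>(s\<^sub>i s\<^sub>j)\<^bsup>m(i,j)\<^esup> = 1\<close>, including \<open>s\<^sub>i s\<^sub>i = 1\<close> for \<open>i = j\<close>. Because of
  the latter, the monoid with this presentation is the Coxeter group.\<close>

definition coxeter_relations :: "dynkin \<Rightarrow> (nat list \<times> nat list) set" where
  "coxeter_relations t =
    {(concat (replicate (coxeter_entry t i j) [i, j]), []) | i j. i \<in> nodes t \<and> j \<in> nodes t}"

definition braid_relations :: "dynkin \<Rightarrow> (nat list \<times> nat list) set" where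
  "braid_relations t =
    {(alternating (coxeter_entry t i j) i j, alternating (coxeter_entry t i j) j i) | i j.
      i \<in> nodes t \<and> j \<in> nodes t \<and> i \<noteq> j}"

definition weyl_group :: "dynkin \<Rightarrow> nat list set monoid" where
  "weyl_group t = presented_monoid (nodes t) (coxeter_relations t)"

definition simple_refl :: "dynkin \<Rightarrow> nat \<Rightarrow> nat list set" where
  "simple_refl t i = word_class (nodes t) (coxeter_relations t) [i]"

definition braid_monoid :: "dynkin \<Rightarrow> nat list set monoid" where
  "braid_monoid t = presented_monoid (nodes t) (braid_relations t)"

definition braid_gen :: "dynkin \<Rightarrow> nat \<Rightarrow> nat list set" where
  "braid_gen t i = word_class (nodes t) (braid_relations t) [i]"

definition weyl_length :: "dynkin \<Rightarrow> nat list set \<Rightarrow> nat" where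
  "weyl_length t w =
    (LEAST k. \<exists>u \<in> lists (nodes t). length u = k \<and>
       list_prod (weyl_group t) (map (simple_refl t) u) = w)"

definition parabolic :: "dynkin \<Rightarrow> nat set \<Rightarrow> nat list set set" where
  "parabolic t K = generate (weyl_group t) (simple_refl t ` K)"

definition longest_element :: "dynkin \<Rightarrow> nat set \<Rightarrow> nat list set" where
  "longest_element t K =
    (THE w. w \<in> parabolic t K \<and> (\<forall>v \<in> parabolic t K. weyl_length t v \<le> weyl_length t w))"

text \<open>The canonical lift is determined by the following conditions (on the carrier of the
  group); that such a map exists is Matsumoto's theorem.\<close>

definition canonical_lift :: "dynkin \<Rightarrow> nat list set \<Rightarrow> nat list set" where
  "canonical_lift t =
    (THE L. L \<in> carrier (weyl_group t) \<rightarrow>\<^sub>E carrier (braid_monoid t) \<and>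
       (\<forall>i \<in> nodes t. L (simple_refl t i) = braid_gen t i) \<and>
       (\<forall>v \<in> carrier (weyl_group t). \<forall>w \<in> carrier (weyl_group t).
          weyl_length t (v \<otimes>\<^bsub>weyl_group t\<^esub> w) = weyl_length t v + weyl_length t w \<longrightarrow>
          L (v \<otimes>\<^bsub>weyl_group t\<^esub> w) = L v \<otimes>\<^bsub>braid_monoid t\<^esub> L w))"


section \<open>Diagram automorphisms\<close>

definition diagram_aut :: "dynkin \<Rightarrow> (nat list set \<Rightarrow> nat list set) \<Rightarrow> bool" where
  "diagram_aut t \<sigma> \<longleftrightarrow>
    \<sigma> \<in> iso (weyl_group t) (weyl_group t) \<and>
    \<sigma> ` (simple_refl t ` nodes t) = simple_refl t ` nodes t"

definition diagram_aut_order2 :: "dynkin \<Rightarrow> (nat list set \<Rightarrow> nat list set) \<Rightarrow> bool" where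
  "diagram_aut_order2 t \<sigma> \<longleftrightarrow> diagram_aut t \<sigma> \<and>
    (\<forall>w \<in> carrier (weyl_group t). \<sigma> (\<sigma> w) = w) \<and>
    (\<exists>w \<in> carrier (weyl_group t). \<sigma> w \<noteq> w)"

text \<open>The automorphism of the braid monoid that permutes the generators as \<open>\<sigma>\<close> permutes the
  simple reflections.\<close>

definition braid_aut :: "dynkin \<Rightarrow> (nat list set \<Rightarrow> nat list set) \<Rightarrow> nat list set \<Rightarrow> nat list set" where
  "braid_aut t \<sigma> =
    (THE \<tau>. \<tau> \<in> iso (braid_monoid t) (braid_monoid t) \<and>
       \<tau> \<in> extensional (carrier (braid_monoid t)) \<and>
       (\<forall>i \<in> nodes t. \<forall>j \<in> nodes t.
          \<sigma> (simple_refl t i) = simple_refl t j \<longrightarrow> \<tau> (braid_gen t i) = braid_gen t j))"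

text \<open>\<open>b \<cdot> \<sigma>(b) \<cdots> \<sigma>\<^bsup>k-1\<^esup>(b)\<close>\<close>

definition twisted_power ::
  "dynkin \<Rightarrow> (nat list set \<Rightarrow> nat list set) \<Rightarrow> nat list set \<Rightarrow> nat \<Rightarrow> nat list set" where
  "twisted_power t \<sigma> b k =
    list_prod (braid_monoid t) (map (\<lambda>j. (braid_aut t \<sigma> ^^ j) b) [0..<k])"


section \<open>The elements attached to a sequence\<close>

text \<open>\<open>psum \<alpha> i\<close> is \<open>\<alpha>\<^sub>1 + \<cdots> + \<alpha>\<^sub>i\<close>, where \<open>\<alpha>\<^sub>i\<close> is \<open>\<alpha> ! (i - 1)\<close>.\<close>

definition psum :: "nat list \<Rightarrow> nat \<Rightarrow> nat" where
  "psum \<alpha> i = sum_list (take i \<alpha>)"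

definition weakly_decreasing_pos :: "nat list \<Rightarrow> bool" where
  "weakly_decreasing_pos \<alpha> \<longleftrightarrow> sorted_wrt (\<ge>) \<alpha> \<and> (\<forall>a \<in> set \<alpha>. a \<ge> 1)"

definition is_partition :: "nat list \<Rightarrow> nat \<Rightarrow> bool" where
  "is_partition \<alpha> n \<longleftrightarrow> weakly_decreasing_pos \<alpha> \<and> sum_list \<alpha> = n"

text \<open>\<open>s\<^sub>a s\<^sub>a\<^sub>-\<^sub>1 \<cdots> s\<^sub>b\<close>, an empty product if \<open>a < b\<close>\<close>

definition seg :: "dynkin \<Rightarrow> nat \<Rightarrow> nat \<Rightarrow> nat list set" where
  "seg t a b = list_prod (weyl_group t) (map (simple_refl t) (rev [b..<Suc a]))"

text \<open>Under the hypothesis \<open>(\<Sum>i. 2 * \<alpha>\<^sub>i - 1) = n + 1\<close> the subtraction is never truncated.\<close>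

definition w_A :: "nat \<Rightarrow> nat list \<Rightarrow> nat list set" where
  "w_A n \<alpha> = list_prod (weyl_group (TypeA n))
    (map (\<lambda>i. seg (TypeA n) (n + i - psum \<alpha> i) (psum \<alpha> (i - 1) + 1)) [1..<Suc (length \<alpha>)])"

text \<open>For the last factor, \<open>psum \<alpha> i = n\<close>, so that the inverted segment is empty.\<close>

definition w_B :: "nat \<Rightarrow> nat list \<Rightarrow> nat list set" where
  "w_B n \<alpha> = list_prod (weyl_group (TypeB n))
    (map (\<lambda>i. inv\<^bsub>weyl_group (TypeB n)\<^esub> (seg (TypeB n) (n - 1) (psum \<alpha> i))
              \<otimes>\<^bsub>weyl_group (TypeB n)\<^esub> seg (TypeB n) n (psum \<alpha> (i - 1) + 1))
         [1..<Suc (length \<alpha>)])"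

definition w_D_factor :: "nat \<Rightarrow> nat \<Rightarrow> nat \<Rightarrow> nat list set" where
  "w_D_factor n a b =
    (if b \<le> n - 1
     then inv\<^bsub>weyl_group (TypeD n)\<^esub> (seg (TypeD n) (n - 2) b)
          \<otimes>\<^bsub>weyl_group (TypeD n)\<^esub> seg (TypeD n) n (a + 1)
     else seg (TypeD n) (n - 1) (a + 1))"

definition w_D :: "nat \<Rightarrow> nat list \<Rightarrow> nat list set" where
  "w_D n \<alpha> = list_prod (weyl_group (TypeD n))
    (map (\<lambda>i. w_D_factor n (psum \<alpha> (i - 1)) (psum \<alpha> i)) [1..<Suc (length \<alpha>)])"

text \<open>The product of the \<open>l\<close> factors \<open>w\<^bsub>K(i)\<^esub>\<^bsup>e(i)-e(i-1)\<^esup>\<close> (lifted to the braid monoid) for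
  \<open>i = 1, \<dots>, l\<close>, the first exponent being \<open>e(1)\<close>.\<close>

definition longest_product ::
  "dynkin \<Rightarrow> nat \<Rightarrow> (nat \<Rightarrow> nat set) \<Rightarrow> (nat \<Rightarrow> nat) \<Rightarrow> nat list set" where
  "longest_product t l K e = list_prod (braid_monoid t)
    (map (\<lambda>i. canonical_lift t (longest_element t (K i))
              [^]\<^bsub>braid_monoid t\<^esub> (if i = 1 then e 1 else e i - e (i - 1)))
         [1..<Suc l])"

end

theory Submission
  imports Defs
begin

text \<open>Words are compared in the braid monoid, where type B is pure strand geometry: the loop
  \<open>t\<^sub>b = s\<^sub>b \<cdots> s\<^sub>n \<cdots> s\<^sub>b\<close> commutes with every \<open>s\<^sub>j\<close>, \<open>j > b\<close>, and the block
  \<open>c = t\<^sub>b s\<^sub>b\<^sub>-\<^sub>1 \<cdots> s\<^sub>a\<^sub>+\<^sub>1\<close> satisfies \<open>c\<^bsup>b-a\<^esup> = t\<^sub>a\<^sub>+\<^sub>1 \<cdots> t\<^sub>b\<close>. As the blocks of \<open>w\<^sub>\<alpha>\<close>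
  commute, its power is a product of powers of the commuting elements \<open>t\<^sub>a\<^sub>+\<^sub>1 \<cdots> t\<^sub>b\<close>, and a
  telescoping regroups it, since \<open>t\<^sub>p\<^sub>+\<^sub>1 \<cdots> t\<^sub>n\<close> lifts the longest element of \<open>{p+1..n}\<close>.
  In type D the diagram automorphism plays the role of the generator \<open>s\<^sub>n\<close> of type B.

  In type A the parts \<open>2\<alpha>\<^sub>i - 1\<close> are nested regular polygons of strands. With \<open>c\<close> the first
  segment of \<open>w\<^sub>\<alpha>\<close>, the operator \<open>y = c\<sigma>\<close> flips the inner interval \<open>I\<^sub>2\<close>, where it replaces
  \<open>\<sigma>\<close> in an induction on the number of parts; the step is the identity
  \<open>\<Delta>(I\<^sub>2) y\<^bsup>m\<^esup> = \<Delta>(I\<^sub>1) \<sigma>\<^bsup>m\<^esup>\<close> for \<open>m = 2\<alpha>\<^sub>1 - 1\<close>.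

  The canonical lifts are evaluated through Matsumoto's theorem. The words of the longest
  elements are reduced because each of their letters makes one more positive root negative, and
  the words of the \<open>w\<^sub>\<alpha>\<close> are reduced because they are prefixes of them in the braid monoid.\<close>

section \<open>Presented monoids\<close>

text \<open>Cancellation in the braid monoid is not established, so every identity is one of
  positive words, and a prefactor such as the first segment of \<open>w\<^sub>\<alpha>\<close> is
  carried along. Twisting by \<sigma> becomes ordinary multiplication: letters and automorphisms are
  operators on one set, and a power of \<open>w * S\<close>, evaluated at the identity class (fixed
  by \<open>S\<close>), is the twisted power. The even number 2d of factors gets rid of
  \<open>S\<close>: in type A an even power of a flip commutes with all words of its interval, and
  in type D every loop contributes one \<open>S\<close>, which only an even exponent removes.

  In the polygon identity two factors y enlarge the half twist by two strands and leave a residue;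
  each further factor absorbs one letter of it, alternately on the two sides, and the odd number 2t
  + 1 of remaining factors is exactly the number of its letters.

  Matsumoto's theorem needs the order of \<open>s\<^sub>i s\<^sub>j\<close> to be exactly m(i,j). A
  presentation alone does not exclude a collapse, so this too is read off from counting negative
  roots.\<close>

lemma word_eq_lists:
  assumes "word_eq X R u v"
  shows "u \<in> lists X" "v \<in> lists X"
  using assms by (induction) auto

lemma word_eq_context:
  assumes "word_eq X R u v" "a \<in> lists X" "b \<in> lists X"
  shows "word_eq X R (a @ u @ b) (a @ v @ b)"
  using assms
proof (induction)
  case (refl u)
  then show ?case by (simp add: word_eq.refl)
next
  case (sym u v)
  then show ?case by (blast intro: word_eq.sym)
next
  case (trans u v w)
  then show ?case by (blast intro: word_eq.trans)
next
  case (rel u v a' b')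
  then show ?case using word_eq.rel[of u v R "a @ a'" X "b' @ b"] by auto
qed

lemma word_eq_append:
  assumes "word_eq X R u u'" "word_eq X R v v'"
  shows "word_eq X R (u @ v) (u' @ v')"
proof -
  have "word_eq X R (u @ v) (u' @ v)"
    using word_eq_context[OF assms(1), of "[]" v] word_eq_lists[OF assms(2)] by simp
  moreover have "word_eq X R (u' @ v) (u' @ v')"
    using word_eq_context[OF assms(2), of u' "[]"] word_eq_lists[OF assms(1)] by simp
  ultimately show ?thesis by (rule word_eq.trans)
qed

lemma word_class_eq_iff:
  assumes "u \<in> lists X"
  shows "word_class X R u = word_class X R v \<longleftrightarrow> word_eq X R u v"
proof
  assume "word_class X R u = word_class X R v"
  moreover have "u \<in> word_class X R u" using assms by (simp add: word_class_def word_eq.refl)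
  ultimately show "word_eq X R u v" by (simp add: word_class_def word_eq.sym)
next
  assume "word_eq X R u v"
  then show "word_class X R u = word_class X R v"
    unfolding word_class_def by (blast intro: word_eq.trans word_eq.sym)
qed

lemma presented_carrier: "x \<in> carrier (presented_monoid X R) \<longleftrightarrow> (\<exists>u\<in>lists X. x = word_class X R u)"
  by (auto simp: presented_monoid_def)

lemma word_class_closed [simp]:
  "u \<in> lists X \<Longrightarrow> word_class X R u \<in> carrier (presented_monoid X R)"
  by (auto simp: presented_monoid_def)

lemma presented_one [simp]: "\<one>\<^bsub>presented_monoid X R\<^esub> = word_class X R []"
  by (simp add: presented_monoid_def)

text \<open>The product is a union over all pairs of representatives. By congruence all members of
  this union are the same class, and the union is nonempty because a class contains its own
  word.\<close>

lemma presented_mult [simp]: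
  assumes "u \<in> lists X" "v \<in> lists X"
  shows "word_class X R u \<otimes>\<^bsub>presented_monoid X R\<^esub> word_class X R v = word_class X R (u @ v)"
proof -
  have 1: "word_class X R (u' @ v') = word_class X R (u @ v)"
    if "u' \<in> word_class X R u" "v' \<in> word_class X R v" for u' v'
  proof -
    have "word_eq X R (u @ v) (u' @ v')"
      using that by (intro word_eq_append) (simp_all add: word_class_def)
    then show ?thesis using assms by (intro word_class_eq_iff[THEN iffD2, symmetric]) simp_all
  qed
  have 2: "u \<in> word_class X R u" "v \<in> word_class X R v"
    using assms by (simp_all add: word_class_def word_eq.refl)
  have "(\<Union>u'\<in>word_class X R u. \<Union>v'\<in>word_class X R v. word_class X R (u' @ v'))
      = word_class X R (u @ v)"
  proof -
    have "(\<Union>v'\<in>word_class X R v. word_class X R (u' @ v')) = word_class X R (u @ v)"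
      if "u' \<in> word_class X R u" for u'
      using 1[OF that] 2(2) by auto
    then show ?thesis using 2(1) by auto
  qed
  then show ?thesis by (simp add: presented_monoid_def)
qed

lemma presented_carrierE:
  assumes "x \<in> carrier (presented_monoid X R)"
  obtains u where "u \<in> lists X" "x = word_class X R u"
  using assms by (auto simp: presented_carrier)

lemma monoid_presented: "monoid (presented_monoid X R)"
proof (rule monoidI)
  fix x y assume "x \<in> carrier (presented_monoid X R)" "y \<in> carrier (presented_monoid X R)"
  then show "x \<otimes>\<^bsub>presented_monoid X R\<^esub> y \<in> carrier (presented_monoid X R)"
    by (elim presented_carrierE) simp
next
  fix x y z assume "x \<in> carrier (presented_monoid X R)" "y \<in> carrier (presented_monoid X R)"
    "z \<in> carrier (presented_monoid X R)"
  then show "x \<otimes>\<^bsub>presented_monoid X R\<^esub> y \<otimes>\<^bsub>presented_monoid X R\<^esub> z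
      = x \<otimes>\<^bsub>presented_monoid X R\<^esub> (y \<otimes>\<^bsub>presented_monoid X R\<^esub> z)"
    by (elim presented_carrierE) simp
next
  fix x assume "x \<in> carrier (presented_monoid X R)"
  then obtain u where u: "u \<in> lists X" "x = word_class X R u" by (rule presented_carrierE)
  show "\<one>\<^bsub>presented_monoid X R\<^esub> \<otimes>\<^bsub>presented_monoid X R\<^esub> x = x"
    using presented_mult[of "[]" X u R] u by simp
  show "x \<otimes>\<^bsub>presented_monoid X R\<^esub> \<one>\<^bsub>presented_monoid X R\<^esub> = x"
    using presented_mult[of u X "[]" R] u by simp
qed simp

lemma list_prod_map_word_class:
  assumes "\<And>x. x \<in> set xs \<Longrightarrow> f x \<in> lists X"
  shows "list_prod (presented_monoid X R) (map (\<lambda>x. word_class X R (f x)) xs)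
    = word_class X R (concat (map f xs))"
  using assms
proof (induction xs)
  case (Cons x xs)
  then have "concat (map f xs) \<in> lists X" by fastforce
  then show ?case using Cons by (simp add: list_prod_def)
qed (simp add: list_prod_def)

lemma list_prod_word_class_gens:
  assumes "u \<in> lists X"
  shows "list_prod (presented_monoid X R) (map (\<lambda>i. word_class X R [i]) u) = word_class X R u"
  using list_prod_map_word_class[of u "\<lambda>i. [i]" X R] assms by (simp add: in_lists_conv_set)

lemma presented_pow:
  assumes "u \<in> lists X"
  shows "word_class X R u [^]\<^bsub>presented_monoid X R\<^esub> (k::nat) = word_class X R (concat (replicate k u))"
proof (induction k)
  case (Suc k)
  have "concat (replicate k u) \<in> lists X" using assms by (induction k) auto
  moreover have "concat (replicate k u) @ u = u @ concat (replicate k u)" by (induction k) auto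
  ultimately show ?case using Suc assms by simp
qed (simp add: nat_pow_def)

text \<open>Words are multiplied as operators on the presented monoid, so that computations
  take place in a type of class \<^class>\<open>monoid_mult\<close> without carrier side conditions, and
  automorphisms of the presented monoid live in the same type.\<close>

typedef 'a endo = "UNIV :: ('a \<Rightarrow> 'a) set"
  morphisms app Endo by simp

lemmas app_Endo [simp] = Endo_inverse[OF UNIV_I]

lemma endo_eqI: "(\<And>x. app f x = app g x) \<Longrightarrow> f = g"
  by (metis app_inject ext)

instantiation endo :: (type) monoid_mult
begin
definition one_endo where "1 = Endo (\<lambda>x. x)"
definition times_endo where "f * g = Endo (\<lambda>x. app f (app g x))"
instance by standard (simp_all add: one_endo_def times_endo_def app_inverse)
end

lemma app_one [simp]: "app 1 x = x" by (simp add: one_endo_def)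
lemma app_times [simp]: "app (f * g) x = app f (app g x)" by (simp add: times_endo_def)

definition ev :: "('a \<Rightarrow> 'm::monoid_mult) \<Rightarrow> 'a list \<Rightarrow> 'm" where
  "ev s u = prod_list (map s u)"

lemma ev_simps [simp]:
  "ev s [] = 1" "ev s (i # u) = s i * ev s u" "ev s (u @ v) = ev s u * ev s v"
  by (simp_all add: ev_def)

text \<open>One induction serves commutation (\<open>f\<close> the identity), index shifts
  (\<open>f = Suc\<close>) and flips of an interval.\<close>

lemma ev_intertwine:
  assumes "\<And>i. i \<in> set u \<Longrightarrow> x * s i = s (f i) * x"
  shows "x * ev s u = ev s (map f u) * x"
  using assms
proof (induction u)
  case (Cons i u)
  have "x * ev s (i # u) = (x * s i) * ev s u" by (simp add: mult.assoc)
  also have "\<dots> = s (f i) * (x * ev s u)" using Cons.prems by (simp add: mult.assoc)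
  also have "x * ev s u = ev s (map f u) * x" using Cons by simp
  finally show ?case by (simp add: mult.assoc)
qed simp

lemma ev_commute:
  assumes "\<And>i. i \<in> set u \<Longrightarrow> x * s i = s i * x"
  shows "x * ev s u = ev s u * x"
  using ev_intertwine[of u x s "\<lambda>i. i"] assms by simp

lemma ev_commute_ev:
  assumes "\<And>i j. i \<in> set u \<Longrightarrow> j \<in> set v \<Longrightarrow> s i * s j = s j * s i"
  shows "ev s u * ev s v = ev s v * ev s u"
proof (rule ev_commute)
  fix j assume "j \<in> set v"
  then have "s j * ev s u = ev s u * s j" using assms by (intro ev_commute) metis
  then show "ev s u * s j = s j * ev s u" by simp
qed

lemma ev_concat_replicate: "ev s (concat (replicate k u)) = ev s u ^ k"
  by (induction k) auto

text \<open>Being the identity off the carrier, the operator of a word is determined by its effect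
  on classes, so that equality of operators is equality in the presented monoid.\<close>

definition lmul :: "'a set \<Rightarrow> ('a list \<times> 'a list) set \<Rightarrow> 'a \<Rightarrow> 'a list set endo" where
  "lmul X R i = Endo (\<lambda>x. if x \<in> carrier (presented_monoid X R)
      then word_class X R [i] \<otimes>\<^bsub>presented_monoid X R\<^esub> x else x)"

lemma app_ev_lmul:
  assumes "u \<in> lists X" "v \<in> lists X"
  shows "app (ev (lmul X R) u) (word_class X R v) = word_class X R (u @ v)"
  using assms(1)
proof (induction u)
  case (Cons i u)
  then show ?case using assms(2) by (simp add: lmul_def)
qed simp

lemma app_ev_lmul_outside:
  "x \<notin> carrier (presented_monoid X R) \<Longrightarrow> app (ev (lmul X R) u) x = x"
  by (induction u) (auto simp: lmul_def)

text \<open>The regular representation is faithful: evaluate both operators at the class of the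
  empty word.\<close>

lemma ev_lmul_eq_iff:
  assumes "u \<in> lists X" "v \<in> lists X"
  shows "ev (lmul X R) u = ev (lmul X R) v \<longleftrightarrow> word_eq X R u v"
proof
  assume "ev (lmul X R) u = ev (lmul X R) v"
  then have "app (ev (lmul X R) u) (word_class X R []) = app (ev (lmul X R) v) (word_class X R [])"
    by simp
  then show "word_eq X R u v" using assms by (simp add: app_ev_lmul word_class_eq_iff)
next
  assume *: "word_eq X R u v"
  show "ev (lmul X R) u = ev (lmul X R) v"
  proof (rule endo_eqI)
    fix x show "app (ev (lmul X R) u) x = app (ev (lmul X R) v) x"
    proof (cases "x \<in> carrier (presented_monoid X R)")
      case True
      then obtain w where w: "w \<in> lists X" "x = word_class X R w" by (auto simp: presented_carrier)
      then have "word_eq X R (u @ w) (v @ w)"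
        using * by (intro word_eq_append word_eq.refl)
      then show ?thesis using w assms by (simp add: app_ev_lmul word_class_eq_iff)
    qed (simp add: app_ev_lmul_outside)
  qed
qed

section \<open>Half twists\<close>

text \<open>The positive half twist (Garside element) of the strands a, ..., b + 1, one descending
  row for each added strand. The value \<open>[0]\<close> at \<open>a = b = 0\<close> is the half
  twist of the strands 0 and 1.\<close>

fun half_twist :: "nat \<Rightarrow> nat \<Rightarrow> nat list" where
  "half_twist a 0 = (if a = 0 then [0] else [])"
| "half_twist a (Suc b) = (if a \<le> Suc b then half_twist a b @ rev [a..<Suc (Suc b)] else [])"

lemma half_twist_empty [simp]: "b < a \<Longrightarrow> half_twist a b = []"
  by (cases b) auto

lemma half_twist_rec: "1 \<le> a \<Longrightarrow> a \<le> b \<Longrightarrow> half_twist a b = half_twist a (b - 1) @ rev [a..<Suc b]"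
  by (cases b) auto

lemma set_half_twist: "1 \<le> a \<Longrightarrow> set (half_twist a b) \<subseteq> {a..b}"
  by (induction a b rule: half_twist.induct) fastforce+

text \<open>The letters are elements of an arbitrary monoid, so that the same lemmas apply to the
  generators of type A, to the simple chain inside type B, and to the modified letters used for type
  D.\<close>

locale braid_seq =
  fixes s :: "nat \<Rightarrow> 'm::monoid_mult" and X :: "nat set"
  assumes far: "i \<in> X \<Longrightarrow> j \<in> X \<Longrightarrow> Suc i < j \<Longrightarrow> s i * s j = s j * s i"
    and braid: "i \<in> X \<Longrightarrow> Suc i \<in> X \<Longrightarrow> s i * s (Suc i) * s i = s (Suc i) * s i * s (Suc i)"
begin

lemma far': "i \<in> X \<Longrightarrow> j \<in> X \<Longrightarrow> Suc i < j \<or> Suc j < i \<Longrightarrow> s i * s j = s j * s i"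
  using far by metis

lemma far_words:
  assumes "set u \<subseteq> X" "set v \<subseteq> X"
    "\<And>i j. i \<in> set u \<Longrightarrow> j \<in> set v \<Longrightarrow> Suc i < j \<or> Suc j < i"
  shows "ev s u * ev s v = ev s v * ev s u"
  using assms by (intro ev_commute_ev far') auto

text \<open>The letters below j commute with \<open>s (Suc j)\<close>, one braid relation turns
  \<open>s (Suc j) * s j * s (Suc j)\<close> around, and the resulting \<open>s j\<close> commutes
  with the letters above \<open>Suc j\<close>. Geometrically one strand crosses all others, which
  are thereby renumbered by one.\<close>

lemma desc_shift:
  assumes "{a..b} \<subseteq> X" "a \<le> j" "j < b"
  shows "ev s (rev [a..<Suc b]) * s (Suc j) = s j * ev s (rev [a..<Suc b])"
proof -
  have "[a..<Suc b] = [a..<j] @ [j..<Suc b]" using assms by (metis le_add_diff_inverse less_imp_le_nat upt_add_eq_append le_SucI)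
  also have "[j..<Suc b] = j # Suc j # [Suc (Suc j)..<Suc b]" using assms by (simp add: upt_conv_Cons del: upt_Suc)
  finally have *: "rev [a..<Suc b] = rev [Suc (Suc j)..<Suc b] @ [Suc j, j] @ rev [a..<j]" by simp
  have sub: "j \<in> X" "Suc j \<in> X" "{a..<j} \<subseteq> X" "{Suc (Suc j)..<Suc b} \<subseteq> X" using assms by auto
  have 1: "ev s (rev [a..<j]) * s (Suc j) = s (Suc j) * ev s (rev [a..<j])"
    using far_words[of "rev [a..<j]" "[Suc j]"] sub by force
  have 2: "ev s (rev [Suc (Suc j)..<Suc b]) * s j = s j * ev s (rev [Suc (Suc j)..<Suc b])"
    using far_words[of "rev [Suc (Suc j)..<Suc b]" "[j]"] sub by (force simp del: upt_Suc)
  have "ev s (rev [a..<Suc b]) * s (Suc j)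
      = ev s (rev [Suc (Suc j)..<Suc b]) * (s (Suc j) * s j * s (Suc j)) * ev s (rev [a..<j])"
    unfolding * by (simp add: mult.assoc 1 del: upt_Suc)
  also have "\<dots> = (ev s (rev [Suc (Suc j)..<Suc b]) * s j) * s (Suc j) * s j * ev s (rev [a..<j])"
    using braid[of j] sub by (simp add: mult.assoc del: upt_Suc)
  also have "\<dots> = s j * ev s (rev [a..<Suc b])"
    unfolding 2 * by (simp add: mult.assoc del: upt_Suc)
  finally show ?thesis .
qed

lemma asc_shift:
  assumes "{a..b} \<subseteq> X" "a \<le> j" "j < b"
  shows "ev s [a..<Suc b] * s j = s (Suc j) * ev s [a..<Suc b]"
proof -
  have "[a..<Suc b] = [a..<j] @ [j..<Suc b]" using assms by (metis le_add_diff_inverse less_imp_le_nat upt_add_eq_append le_SucI)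
  also have "[j..<Suc b] = j # Suc j # [Suc (Suc j)..<Suc b]" using assms by (simp add: upt_conv_Cons del: upt_Suc)
  finally have *: "[a..<Suc b] = [a..<j] @ [j, Suc j] @ [Suc (Suc j)..<Suc b]" by simp
  have sub: "j \<in> X" "Suc j \<in> X" "{a..<j} \<subseteq> X" "{Suc (Suc j)..<Suc b} \<subseteq> X" using assms by auto
  have 1: "ev s [a..<j] * s (Suc j) = s (Suc j) * ev s [a..<j]"
    using far_words[of "[a..<j]" "[Suc j]"] sub by force
  have 2: "ev s [Suc (Suc j)..<Suc b] * s j = s j * ev s [Suc (Suc j)..<Suc b]"
    using far_words[of "[Suc (Suc j)..<Suc b]" "[j]"] sub by (force simp del: upt_Suc)
  have "ev s [a..<Suc b] * s j
      = ev s [a..<j] * (s j * s (Suc j) * s j) * ev s [Suc (Suc j)..<Suc b]"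
    unfolding * by (simp add: mult.assoc 2 del: upt_Suc)
  also have "\<dots> = (ev s [a..<j] * s (Suc j)) * s j * s (Suc j) * ev s [Suc (Suc j)..<Suc b]"
    using braid[of j] sub by (simp add: mult.assoc del: upt_Suc)
  also have "\<dots> = s (Suc j) * ev s [a..<Suc b]"
    unfolding 1 * by (simp add: mult.assoc del: upt_Suc)
  finally show ?thesis .
qed

lemma desc_shift_word:
  assumes "{a..b} \<subseteq> X" "set u \<subseteq> {a..<b}"
  shows "ev s (rev [a..<Suc b]) * ev s (map Suc u) = ev s u * ev s (rev [a..<Suc b])"
  using assms(2)
proof (induction u)
  case (Cons j u)
  have "ev s (rev [a..<Suc b]) * ev s (map Suc (j # u))
      = (ev s (rev [a..<Suc b]) * s (Suc j)) * ev s (map Suc u)" by (simp add: mult.assoc del: upt_Suc)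
  also have "\<dots> = s j * (ev s (rev [a..<Suc b]) * ev s (map Suc u))"
    using desc_shift[OF assms(1), of j] Cons.prems by (simp add: mult.assoc del: upt_Suc)
  finally show ?case using Cons by (simp add: mult.assoc del: upt_Suc)
qed simp

lemma asc_shift_word:
  assumes "{a..b} \<subseteq> X" "set u \<subseteq> {a..<b}"
  shows "ev s [a..<Suc b] * ev s u = ev s (map Suc u) * ev s [a..<Suc b]"
proof (rule ev_intertwine)
  fix j assume "j \<in> set u"
  then show "ev s [a..<Suc b] * s j = s (Suc j) * ev s [a..<Suc b]"
    using assms(2) by (intro asc_shift[OF assms(1)]) auto
qed

lemma map_Suc_half_twist: "1 \<le> a \<Longrightarrow> map Suc (half_twist a b) = half_twist (Suc a) (Suc b)"
  by (induction a b rule: half_twist.induct) (auto simp: map_Suc_upt rev_map[symmetric] simp del: upt_Suc)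

text \<open>The last row is pulled to the front; passing it raises all letters of the remaining
  twist by one.\<close>

lemma half_twist_desc_left:
  assumes "1 \<le> a" "a \<le> b" "{a..b} \<subseteq> X"
  shows "ev s (half_twist a b) = ev s (rev [a..<Suc b]) * ev s (half_twist (Suc a) b)"
proof -
  obtain b' where b: "b = Suc b'" using assms by (cases b) auto
  have "ev s (half_twist a b) = ev s (half_twist a b') * ev s (rev [a..<Suc b])"
    using assms by (simp add: b del: upt_Suc)
  also have "\<dots> = ev s (rev [a..<Suc b]) * ev s (map Suc (half_twist a b'))"
    using set_half_twist[OF assms(1), of b'] assms by (intro desc_shift_word[symmetric]) (auto simp: b)
  finally show ?thesis using assms by (simp add: map_Suc_half_twist b del: upt_Suc half_twist.simps)
qed

lemma half_twist_asc_right: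
  assumes "1 \<le> a" "a \<le> b" "{a..b} \<subseteq> X"
  shows "ev s (half_twist a b) = ev s (half_twist (Suc a) b) * ev s [a..<Suc b]"
  using assms
proof (induction b)
  case (Suc b)
  show ?case
  proof (cases "a = Suc b")
    case True
    then show ?thesis by simp
  next
    case False
    have sub: "{a..b} \<subseteq> X" using Suc by auto
    have A: "[a..<Suc (Suc b)] = [a..<Suc b] @ [Suc b]" using False Suc by simp
    have B: "rev [a..<Suc (Suc b)] = Suc b # rev [a..<Suc b]" using False Suc by simp
    have C: "rev [Suc a..<Suc (Suc b)] = map Suc (rev [a..<Suc b])" by (simp add: map_Suc_upt rev_map[symmetric] del: upt_Suc)
    have "ev s (half_twist a (Suc b))
       = ev s (half_twist (Suc a) b) * ev s [a..<Suc b] * ev s (rev [a..<Suc (Suc b)])"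
      using Suc False sub by simp
    \<comment> \<open>The letter \<open>Suc b\<close> migrates from the head of the descending row
      to the end of the ascending one, which is then long enough to shift the whole remaining
      row.\<close>
    also have "\<dots> = ev s (half_twist (Suc a) b) * (ev s [a..<Suc (Suc b)] * ev s (rev [a..<Suc b]))"
      unfolding A B by (simp add: mult.assoc del: upt_Suc)
    also have "ev s [a..<Suc (Suc b)] * ev s (rev [a..<Suc b])
        = ev s (rev [Suc a..<Suc (Suc b)]) * ev s [a..<Suc (Suc b)]"
      unfolding C using Suc by (intro asc_shift_word) auto
    finally show ?thesis using False Suc by (simp add: mult.assoc del: upt_Suc)
  qed
qed simp

text \<open>This identifies the half twist with the longest element of its interval: a reduced word
  that can start with every letter is lengthened by none.\<close>

lemma half_twist_left_divisor:
  assumes "1 \<le> a" "{a..b} \<subseteq> X" "j \<in> {a..b}"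
  shows "\<exists>v \<in> lists {a..b}. ev s (half_twist a b) = s j * ev s v"
  using assms
proof (induction b)
  case (Suc b)
  show ?case
  proof (cases "j = Suc b")
    case True
    have "ev s (half_twist a (Suc b)) = s (Suc b) * ev s (rev [a..<Suc b] @ half_twist (Suc a) (Suc b))"
      using half_twist_desc_left[of a "Suc b"] Suc True by (simp add: mult.assoc)
    moreover have "rev [a..<Suc b] @ half_twist (Suc a) (Suc b) \<in> lists {a..Suc b}"
      using set_half_twist[of "Suc a" "Suc b"] by force
    ultimately show ?thesis using True by blast
  next
    case False
    moreover have "{a..b} \<subseteq> X" using Suc.prems by auto
    ultimately obtain v where v: "v \<in> lists {a..b}" "ev s (half_twist a b) = s j * ev s v"
      using Suc by auto
    then have "ev s (half_twist a (Suc b)) = s j * ev s (v @ rev [a..<Suc (Suc b)])"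
      using Suc.prems by (simp add: mult.assoc del: upt_Suc)
    moreover have "v @ rev [a..<Suc (Suc b)] \<in> lists {a..Suc b}" using v Suc.prems by (fastforce simp: in_lists_conv_set simp del: upt_Suc)
    ultimately show ?thesis by blast
  qed
qed simp

end

section \<open>Operators that flip an interval, and the polygon identity\<close>

lemma map_diff_rev_upt:
  "b \<le> c \<Longrightarrow> a \<le> c \<Longrightarrow> map (\<lambda>j. c - j) (rev [a..<Suc b]) = [c - b..<Suc (c - a)]"
  by (rule nth_equalityI) (auto simp: rev_nth simp del: upt_Suc)

lemma map_diff_upt:
  "b \<le> c \<Longrightarrow> a \<le> c \<Longrightarrow> map (\<lambda>j. c - j) [a..<Suc b] = rev [c - b..<Suc (c - a)]"
  using map_diff_rev_upt[of b c a] by (metis rev_map rev_rev_ident)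

lemma rev_upt_split: "a \<le> b \<Longrightarrow> b \<le> c \<Longrightarrow> rev [a..<c] = rev [b..<c] @ rev [a..<b]"
  by (metis le_add_diff_inverse rev_append upt_add_eq_append)

lemma upt_split: "a \<le> b \<Longrightarrow> b \<le> c \<Longrightarrow> [a..<c] = [a..<b] @ [b..<c]"
  by (metis le_add_diff_inverse upt_add_eq_append)

lemma mult_eq_left: "a * b = c * d \<Longrightarrow> a * (b * z) = c * (d * z)" for a :: "'m::monoid_mult"
  by (metis mult.assoc)

text \<open>\<open>S\<close> need not be a braid: it is the diagram automorphism or the product of a
  segment with an earlier flip, and only the intertwining relation is common to both. The interval
  may be empty.\<close>

locale braid_flip = braid_seq s X for s :: "nat \<Rightarrow> 'm::monoid_mult" and X +
  fixes S :: 'm and lo hi :: nat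
  assumes lo: "1 \<le> lo" and interval: "{lo..hi} \<subseteq> X"
    and flip: "j \<in> {lo..hi} \<Longrightarrow> S * s j = s (lo + hi - j) * S"
begin

lemma flip_word:
  assumes "set u \<subseteq> {lo..hi}"
  shows "S * ev s u = ev s (map (\<lambda>j. lo + hi - j) u) * S"
  using assms by (intro ev_intertwine flip) auto

text \<open>A flip turns descending rows into ascending ones. The induction that adds a row at the
  right end \<open>b\<close> therefore becomes the recursion \<open>half_twist_asc_right\<close>,
  which extends the mirror image at its left end.\<close>

lemma flip_half_twist:
  assumes "lo \<le> a" "a \<le> Suc b" "b \<le> hi"
  shows "S * ev s (half_twist a b) = ev s (half_twist (lo + hi - b) (lo + hi - a)) * S"
  using assms(2,3)
proof (induction b)
  case 0
  then show ?case using assms lo by simp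
next
  case (Suc b)
  show ?case
  proof (cases "a = Suc (Suc b)")
    case True
    then have "half_twist (lo + hi - Suc b) (lo + hi - a) = []"
      using Suc assms lo by (intro half_twist_empty) auto
    then show ?thesis using True by simp
  next
    case False
    have le: "a \<le> Suc b" using False Suc.prems by simp
    have *: "Suc (lo + hi - Suc b) = lo + hi - b" using Suc.prems by simp
    have "S * ev s (half_twist a (Suc b)) = (S * ev s (half_twist a b)) * ev s (rev [a..<Suc (Suc b)])"
      using le by (simp add: mult.assoc del: upt_Suc)
    also have "\<dots> = ev s (half_twist (lo + hi - b) (lo + hi - a)) * (S * ev s (rev [a..<Suc (Suc b)]))"
      using Suc le by (simp add: mult.assoc del: upt_Suc)
    also have "S * ev s (rev [a..<Suc (Suc b)]) = ev s [lo + hi - Suc b..<Suc (lo + hi - a)] * S"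
      using assms Suc.prems le by (subst flip_word) (auto simp: map_diff_rev_upt simp del: upt_Suc)
    also have "ev s (half_twist (lo + hi - b) (lo + hi - a)) * (ev s [lo + hi - Suc b..<Suc (lo + hi - a)] * S)
        = ev s (half_twist (lo + hi - Suc b) (lo + hi - a)) * S"
    proof -
      have "1 \<le> lo + hi - Suc b" "lo + hi - Suc b \<le> lo + hi - a" "{lo + hi - Suc b..lo + hi - a} \<subseteq> {lo..hi}"
        using assms(1) Suc.prems le lo by auto
      moreover from this(3) interval have "{lo + hi - Suc b..lo + hi - a} \<subseteq> X" by (rule subset_trans)
      ultimately show ?thesis
        using half_twist_asc_right[of "lo + hi - Suc b" "lo + hi - a"]
        unfolding * by (simp add: mult.assoc del: upt_Suc)
    qed
    finally show ?thesis .
  qed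
qed

lemma flip_half_twist_full: "S * ev s (half_twist lo hi) = ev s (half_twist lo hi) * S"
proof (cases "lo \<le> Suc hi")
  case True
  then show ?thesis using flip_half_twist[of lo hi] by simp
qed simp

lemma flip_square:
  assumes "set u \<subseteq> {lo..hi}"
  shows "S * S * ev s u = ev s u * (S * S)"
proof -
  have "S * S * ev s u = S * (ev s (map (\<lambda>j. lo + hi - j) u) * S)"
    using flip_word[OF assms] by (simp add: mult.assoc)
  also have "\<dots> = ev s (map (\<lambda>j. lo + hi - j) (map (\<lambda>j. lo + hi - j) u)) * S * S"
  proof -
    have "set (map (\<lambda>j. lo + hi - j) u) \<subseteq> {lo..hi}" using assms by fastforce
    then show ?thesis by (subst flip_word[symmetric]) (simp_all add: mult.assoc[symmetric] flip_word)
  qed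
  also have "map (\<lambda>j. lo + hi - j) (map (\<lambda>j. lo + hi - j) u) = u"
    using assms by (auto intro!: map_idI)
  finally show ?thesis by (simp add: mult.assoc)
qed

text \<open>The square of a flip fixes every generator of the interval. In type A this is the reason
  for the even number 2d of factors.\<close>

lemma flip_even_power:
  assumes "set u \<subseteq> {lo..hi}" "even k"
  shows "S ^ k * ev s u = ev s u * S ^ k"
proof -
  obtain l where k: "k = 2 * l" using assms(2) by (elim evenE)
  have "(S * S) ^ l * ev s u = ev s u * (S * S) ^ l"
    using power_commuting_commutes[OF flip_square[OF assms(1)]] by metis
  then show ?thesis by (simp add: k power_mult power2_eq_square)
qed

text \<open>For \<open>b = hi + 1 - a\<close> this is the operator y of a first part a. The index
  shift of the segment turns the mirror \<open>lo + hi - j\<close> of \<open>S\<close> into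
  \<open>lo + hi - 1 - j\<close>, the mirror of the inner interval.\<close>

definition rot :: "nat \<Rightarrow> 'm" where
  "rot b = ev s (rev [lo..<Suc b]) * S"

text \<open>The residual braid that remains after \<open>half_twist\<close> has absorbed two more strands.\<close>

definition residue :: "nat \<Rightarrow> nat \<Rightarrow> nat \<Rightarrow> nat \<Rightarrow> 'm" where
  "residue k b p q = ev s (rev [p..<k]) * ev s [Suc b..<Suc q]"

text \<open>The letters b, ..., k + 1 of the first \<open>rot b\<close> complete the twist at its
  right end. The segment of the second one, taken across \<open>S\<close>, ascends from
  \<open>Suc k\<close> to \<open>hi\<close>; together with the letter k left over from the first it
  supplies k, ..., b and completes the twist at its left end. The residue consists of the letters
  below k and above b.\<close>

lemma rot_two_steps:
  assumes "k + b + 1 = lo + hi" "lo \<le> k" "k \<le> b"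
  shows "ev s (half_twist (Suc k) (b - 1)) * (rot b * rot b)
    = ev s (half_twist k b) * residue k b lo hi * (S * S)"
proof -
  have b: "b < hi" "1 \<le> b" using assms lo by auto
  have split: "rev [lo..<Suc b] = rev [Suc k..<Suc b] @ (k # rev [lo..<k])"
    using rev_upt_split[of lo "Suc k" "Suc b"] assms by (simp del: upt_Suc) simp
  have "ev s (half_twist (Suc k) (b - 1)) * ev s (rev [Suc k..<Suc b]) = ev s (half_twist (Suc k) b)"
  proof (cases "Suc k \<le> b")
    case True
    then show ?thesis using half_twist_rec[of "Suc k" b] by (simp del: upt_Suc)
  next
    case False
    then show ?thesis using assms by simp
  qed
  then have 1: "ev s (half_twist (Suc k) (b - 1)) * rot b
      = ev s (half_twist (Suc k) b) * (s k * ev s (rev [lo..<k])) * S"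
    unfolding rot_def split by (simp add: mult.assoc[symmetric] del: upt_Suc)
  have 2: "S * rot b = ev s [Suc k..<Suc hi] * S * S"
  proof -
    have "S * ev s (rev [lo..<Suc b]) = ev s (map (\<lambda>j. lo + hi - j) (rev [lo..<Suc b])) * S"
      using b by (intro flip_word) auto
    also have "map (\<lambda>j. lo + hi - j) (rev [lo..<Suc b]) = [lo + hi - b..<Suc (lo + hi - lo)]"
      using b by (intro map_diff_rev_upt) auto
    also have "\<dots> = [Suc k..<Suc hi]"
    proof -
      have "lo + hi - b = Suc k" using assms by simp
      then show ?thesis by simp
    qed
    finally show ?thesis unfolding rot_def by (simp add: mult.assoc[symmetric] del: upt_Suc)
  qed
  have 3: "ev s (rev [lo..<k]) * ev s [Suc k..<Suc hi] = ev s [Suc k..<Suc hi] * ev s (rev [lo..<k])"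
    using assms interval b by (intro far_words) auto
  have 4: "ev s (half_twist (Suc k) b) * s k * ev s [Suc k..<Suc hi]
      = ev s (half_twist k b) * ev s [Suc b..<Suc hi]"
  proof -
    have "s k * ev s [Suc k..<Suc hi] = ev s [k..<Suc hi]"
      using assms b by (simp add: upt_conv_Cons[of k "Suc hi"] del: upt_Suc)
    also have "[k..<Suc hi] = [k..<Suc b] @ [Suc b..<Suc hi]"
      using assms b by (intro upt_split) auto
    finally have "s k * ev s [Suc k..<Suc hi] = ev s [k..<Suc b] * ev s [Suc b..<Suc hi]" by (simp only: ev_simps)
    moreover have "ev s (half_twist k b) = ev s (half_twist (Suc k) b) * ev s [k..<Suc b]"
      using assms b lo interval by (intro half_twist_asc_right) auto
    ultimately show ?thesis by (simp only: mult.assoc)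
  qed
  have 5: "ev s (rev [lo..<k]) * ev s [Suc b..<Suc hi] = ev s [Suc b..<Suc hi] * ev s (rev [lo..<k])"
    using assms interval b by (intro far_words) auto
  have "ev s (half_twist (Suc k) (b - 1)) * (rot b * rot b)
      = ev s (half_twist (Suc k) b) * (s k * ev s (rev [lo..<k])) * (S * rot b)"
    using 1 by (simp add: mult.assoc[symmetric])
  also have "\<dots> = ev s (half_twist (Suc k) b) * s k * (ev s (rev [lo..<k]) * ev s [Suc k..<Suc hi]) * (S * S)"
    unfolding 2 by (simp add: mult.assoc del: upt_Suc)
  also have "\<dots> = ev s (half_twist (Suc k) b) * s k * ev s [Suc k..<Suc hi] * ev s (rev [lo..<k]) * (S * S)"
    unfolding 3 by (simp add: mult.assoc del: upt_Suc)
  also have "\<dots> = ev s (half_twist k b) * (ev s [Suc b..<Suc hi] * ev s (rev [lo..<k])) * (S * S)"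
    unfolding 4 by (simp add: mult.assoc del: upt_Suc)
  finally show ?thesis unfolding residue_def 5 .
qed

text \<open>The letter \<open>Suc b\<close> prolongs the segment to that of
  \<open>rot (Suc b)\<close>, the segment raises the descending half by one, and \<open>S\<close>
  exchanges the two halves by the mirror \<open>lo + hi - j\<close>; this produces the new end
  points. In total one letter is lost.\<close>

lemma residue_rot:
  assumes "k + b + 1 = lo + hi" "lo \<le> p" "p \<le> k" "k \<le> b" "Suc b \<le> q" "q \<le> hi"
  shows "residue k b p q * rot b = rot (Suc b) * residue k b (lo + hi - q) (lo + hi - 1 - p)"
proof -
  have k: "1 \<le> k" using assms lo by auto
  have 1: "ev s [Suc b..<Suc q] * ev s (rev [lo..<Suc b])
      = ev s (rev [lo..<Suc (Suc b)]) * ev s [Suc (Suc b)..<Suc q]"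
  proof -
    have "[Suc b..<Suc q] = Suc b # [Suc (Suc b)..<Suc q]" using assms by (simp add: upt_conv_Cons del: upt_Suc)
    moreover have "rev [lo..<Suc (Suc b)] = Suc b # rev [lo..<Suc b]" using assms by simp
    moreover have "ev s [Suc (Suc b)..<Suc q] * ev s (rev [lo..<Suc b])
        = ev s (rev [lo..<Suc b]) * ev s [Suc (Suc b)..<Suc q]"
      using assms interval by (intro far_words) auto
    ultimately show ?thesis by (simp add: mult.assoc del: upt_Suc)
  qed
  have 2: "ev s (rev [p..<k]) * ev s (rev [lo..<Suc (Suc b)])
      = ev s (rev [lo..<Suc (Suc b)]) * ev s (rev [Suc p..<Suc k])"
  proof -
    have "rev [Suc p..<Suc k] = map Suc (rev [p..<k])" by (simp add: map_Suc_upt rev_map[symmetric] del: upt_Suc)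
    then show ?thesis using assms interval by (simp only:, intro desc_shift_word[symmetric]) auto
  qed
  have 3: "ev s (rev [Suc p..<Suc k]) * ev s [Suc (Suc b)..<Suc q] * S
      = S * residue k b (lo + hi - q) (lo + hi - 1 - p)"
  proof -
    let ?u = "[Suc b..<Suc (lo + hi - 1 - p)]" and ?v = "rev [lo + hi - q..<k]"
    have u: "map (\<lambda>j. lo + hi - j) ?u = rev [Suc p..<Suc k]"
    proof -
      have e: "lo + hi - (lo + hi - 1 - p) = Suc p" "lo + hi - Suc b = k" using assms by auto
      show ?thesis using assms by (subst map_diff_upt) (auto simp: e simp del: upt_Suc)
    qed
    have v: "map (\<lambda>j. lo + hi - j) ?v = [Suc (Suc b)..<Suc q]"
    proof -
      have e: "k = Suc (k - 1)" "lo + hi - (k - 1) = Suc (Suc b)" "lo + hi - (lo + hi - q) = q" using assms k by auto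
      have "map (\<lambda>j. lo + hi - j) (rev [lo + hi - q..<Suc (k - 1)]) = [Suc (Suc b)..<Suc q]"
        using assms e(2,3) by (subst map_diff_rev_upt) (auto simp del: upt_Suc)
      then show ?thesis using e(1) by simp
    qed
    have "S * (ev s ?u * ev s ?v) = ev s (map (\<lambda>j. lo + hi - j) (?u @ ?v)) * S"
    proof -
      have "set (?u @ ?v) \<subseteq> {lo..hi}" using assms by (auto simp del: upt_Suc)
      from flip_word[OF this] show ?thesis by (simp only: ev_simps)
    qed
    also have "\<dots> = ev s (rev [Suc p..<Suc k]) * ev s [Suc (Suc b)..<Suc q] * S"
      unfolding map_append u v by simp
    also have "ev s ?u * ev s ?v = ev s ?v * ev s ?u"
    proof (rule far_words)
      show "set ?u \<subseteq> X" by (rule subset_trans[OF _ interval]) (use assms in auto)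
      show "set ?v \<subseteq> X" by (rule subset_trans[OF _ interval]) (use assms in auto)
    qed (use assms in auto)
    finally show ?thesis unfolding residue_def by simp
  qed
  have "residue k b p q * rot b
      = ev s (rev [p..<k]) * (ev s [Suc b..<Suc q] * ev s (rev [lo..<Suc b])) * S"
    unfolding residue_def rot_def by (simp add: mult.assoc del: upt_Suc)
  also have "\<dots> = (ev s (rev [p..<k]) * ev s (rev [lo..<Suc (Suc b)])) * ev s [Suc (Suc b)..<Suc q] * S"
    unfolding 1 by (simp add: mult.assoc del: upt_Suc)
  also have "\<dots> = ev s (rev [lo..<Suc (Suc b)]) * (ev s (rev [Suc p..<Suc k]) * ev s [Suc (Suc b)..<Suc q] * S)"
    unfolding 2 by (simp add: mult.assoc del: upt_Suc)
  finally show ?thesis unfolding 3 rot_def by (simp add: mult.assoc del: upt_Suc)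
qed

text \<open>Two passages exchange the halves twice, and each half ends up one letter
  shorter.\<close>

lemma residue_rot_power:
  assumes "k + b + 1 = lo + hi" "k \<le> b" "lo + j \<le> k"
  shows "residue k b lo hi * rot b ^ (2 * j) = rot (Suc b) ^ (2 * j) * residue k b (lo + j) (hi - j)"
  using assms(3)
proof (induction j)
  case (Suc j)
  have "residue k b lo hi * rot b ^ (2 * Suc j) = residue k b lo hi * rot b ^ (2 * j) * (rot b * rot b)"
  proof -
    have "2 * Suc j = 2 * j + 2" by simp
    then show ?thesis by (simp only: power_add power2_eq_square mult.assoc)
  qed
  also have "\<dots> = rot (Suc b) ^ (2 * j) * (residue k b (lo + j) (hi - j) * rot b) * rot b"
    using Suc by (simp add: mult.assoc)
  also have "residue k b (lo + j) (hi - j) * rot b = rot (Suc b) * residue k b (lo + j) (hi - Suc j)"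
  proof -
    have e: "lo + hi - (hi - j) = lo + j" "lo + hi - 1 - (lo + j) = hi - Suc j" using Suc.prems assms by auto
    have le: "Suc b \<le> hi - j" using Suc.prems assms by linarith
    show ?thesis using residue_rot[of k b "lo + j" "hi - j"] Suc.prems assms le unfolding e by simp
  qed
  also have "rot (Suc b) ^ (2 * j) * (rot (Suc b) * residue k b (lo + j) (hi - Suc j)) * rot b
      = rot (Suc b) ^ (2 * j) * rot (Suc b) * (residue k b (lo + j) (hi - Suc j) * rot b)"
    by (simp add: mult.assoc)
  also have "residue k b (lo + j) (hi - Suc j) * rot b = rot (Suc b) * residue k b (lo + Suc j) (hi - Suc j)"
  proof -
    have e: "lo + hi - (hi - Suc j) = lo + Suc j" "lo + hi - 1 - (lo + j) = hi - Suc j" using Suc.prems assms by auto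
    have le: "Suc b \<le> hi - Suc j" using Suc.prems assms by linarith
    show ?thesis using residue_rot[of k b "lo + j" "hi - Suc j"] Suc.prems assms le unfolding e by simp
  qed
  also have "rot (Suc b) ^ (2 * j) * rot (Suc b) * (rot (Suc b) * residue k b (lo + Suc j) (hi - Suc j))
      = rot (Suc b) ^ (2 * Suc j) * residue k b (lo + Suc j) (hi - Suc j)"
  proof -
    have "2 * Suc j = 2 * j + 2" by simp
    then show ?thesis by (simp only: power_add power2_eq_square mult.assoc)
  qed
  finally show ?case .
qed simp

text \<open>The residue has \<open>(k - lo) + (hi - b) = 2 * (k - lo) + 1\<close> letters and loses
  one at each passage. Before the last passage only the letter \<open>Suc b\<close> is left.\<close>

lemma residue_rot_odd_power:
  assumes "k + b + 1 = lo + hi" "lo \<le> k" "k \<le> b"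
  shows "residue k b lo hi * rot b ^ (2 * (k - lo) + 1) = rot (Suc b) ^ (2 * (k - lo) + 1)"
proof -
  have "residue k b lo hi * rot b ^ (2 * (k - lo) + 1)
      = rot (Suc b) ^ (2 * (k - lo)) * (residue k b k (Suc b) * rot b)"
  proof -
    have e: "lo + (k - lo) = k" "hi - (k - lo) = Suc b" using assms by auto
    show ?thesis using residue_rot_power[OF assms(1,3), of "k - lo"] assms
      unfolding e by (simp only: power_add power_one_right mult.assoc[symmetric])
  qed
  also have "residue k b k (Suc b) * rot b = rot (Suc b)"
  proof -
    have e: "lo + hi - Suc b = k" "lo + hi - 1 - k = b" using assms by auto
    show ?thesis using residue_rot[of k b k "Suc b"] assms unfolding e by (simp add: residue_def)
  qed
  finally show ?thesis by (simp add: power_commutes)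
qed

text \<open>A regular polygon with \<open>2 * t + 1\<close> vertices, half-turned around the strands of the
  inner interval.\<close>

lemma half_twist_rot_power:
  assumes "hi = t + b" "lo + t \<le> Suc b"
  shows "ev s (half_twist (lo + t) (b - 1)) * rot b ^ (2 * t + 1) = ev s (half_twist lo hi) * S ^ (2 * t + 1)"
  using assms
proof (induction t arbitrary: b)
  case 0
  show ?case
  proof (cases "lo \<le> b")
    case True
    then have "half_twist lo b = half_twist lo (b - 1) @ rev [lo..<Suc b]" using lo by (intro half_twist_rec)
    moreover have "hi = b" using 0 by simp
    ultimately show ?thesis by (simp only: rot_def ev_simps mult.assoc) simp
  next
    case False
    then show ?thesis using 0 by (simp add: rot_def)
  qed
next
  case (Suc t)
  let ?k = "lo + t"
  have k: "?k + b + 1 = lo + hi" "lo \<le> ?k" "?k \<le> b" "?k - lo = t" using Suc.prems by auto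
  have "S * S * ev s (rev [lo..<Suc b]) = ev s (rev [lo..<Suc b]) * (S * S)"
    using Suc.prems by (intro flip_square) auto
  then have "S * S * ev s (rev [lo..<Suc b]) * S = ev s (rev [lo..<Suc b]) * (S * S) * S"
    by (rule arg_cong)
  then have "rot b * (S * S) = S * S * rot b"
    unfolding rot_def by (simp only: mult.assoc)
  then have c: "S * S * rot b ^ (2 * t + 1) = rot b ^ (2 * t + 1) * (S * S)"
    by (rule power_commuting_commutes[symmetric])
  have p: "x ^ (2 * Suc t + 1) = x * x * x ^ (2 * t + 1)" "x ^ (2 * Suc t + 1) = x ^ (2 * t + 1) * (x * x)" for x :: 'm
  proof -
    have "2 * Suc t + 1 = 2 + (2 * t + 1)" by simp
    then show "x ^ (2 * Suc t + 1) = x * x * x ^ (2 * t + 1)"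
      by (simp only: power_add power2_eq_square)
    have "2 * Suc t + 1 = (2 * t + 1) + 2" by simp
    then show "x ^ (2 * Suc t + 1) = x ^ (2 * t + 1) * (x * x)"
      by (simp only: power_add power2_eq_square)
  qed
  let ?y = "rot b ^ (2 * t + 1)"
  \<comment> \<open>Two factors enlarge the twist, and the other \<open>2 * t + 1\<close> absorb the
    residue while becoming powers of \<open>rot (Suc b)\<close>. What is left is the claim for
    \<open>t\<close> and \<open>Suc b\<close>, the split-off \<open>S * S\<close> having been moved
    to the right end.\<close>
  have "ev s (half_twist (lo + Suc t) (b - 1)) * rot b ^ (2 * Suc t + 1)
      = ev s (half_twist (Suc ?k) (b - 1)) * (rot b * rot b) * ?y"
    unfolding p(1) by (simp only: mult.assoc add_Suc_right)
  also have "\<dots> = ev s (half_twist ?k b) * residue ?k b lo hi * (S * S * ?y)"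
    unfolding rot_two_steps[OF k(1-3)] by (simp only: mult.assoc)
  also have "\<dots> = ev s (half_twist ?k b) * (residue ?k b lo hi * ?y) * (S * S)"
    unfolding c by (simp only: mult.assoc)
  also have "residue ?k b lo hi * ?y = rot (Suc b) ^ (2 * t + 1)"
    using residue_rot_odd_power[OF k(1-3)] unfolding k(4) .
  also have "ev s (half_twist ?k b) * rot (Suc b) ^ (2 * t + 1) = ev s (half_twist lo hi) * S ^ (2 * t + 1)"
    using Suc.IH[of "Suc b"] Suc.prems by simp
  finally show ?case unfolding p(2) by (simp only: mult.assoc)
qed

end

section \<open>Twisted powers of the words of type A\<close>

lemma power_mult_distrib_commuting:
  fixes x y :: "'m::monoid_mult"
  assumes "x * y = y * x"
  shows "(x * y) ^ k = x ^ k * y ^ k"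
proof (induction k)
  case (Suc k)
  have c: "y * x ^ k = x ^ k * y" using power_commuting_commutes[OF assms] by simp
  have "(x * y) ^ Suc k = x * (y * x ^ k) * y ^ k" by (simp add: Suc mult.assoc)
  then show ?case unfolding c by (simp add: mult.assoc)
qed simp

text \<open>The recursive word is written with the letters of the inner interval
  \<open>{lo + a - 1..hi - a}\<close>. Standing behind the segment they occur raised by one; moving
  them in front of it lowers them onto the interval that the next flip preserves.\<close>

fun word_A :: "nat \<Rightarrow> nat \<Rightarrow> nat list \<Rightarrow> nat list" where
  "word_A lo hi [] = []"
| "word_A lo hi (a # as) = rev [lo..<Suc (hi + 1 - a)] @ map Suc (word_A (lo + a - 1) (hi - a) as)"

text \<open>\<open>e\<close> is the exponent attached to the preceding interval, so that the powers
  are the telescoping differences.\<close>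

fun twists_A :: "nat \<Rightarrow> nat \<Rightarrow> nat \<Rightarrow> nat \<Rightarrow> nat list \<Rightarrow> nat list" where
  "twists_A D lo hi e [] = []"
| "twists_A D lo hi e (a # as) = concat (replicate (D div (2 * a - 1) - e) (half_twist lo hi))
    @ twists_A D (lo + a - 1) (hi - a) (D div (2 * a - 1)) as"

text \<open>The sum condition says that the polygons exhaust the \<open>hi - lo + 2\<close> strands.
  It is passed on only while parts remain: for \<open>a = lo = 1\<close> and \<open>hi = 0\<close>
  the subtraction \<open>hi - a\<close> truncates and the equation would fail for the empty
  rest.\<close>

lemma parts_A_bound:
  assumes "(\<Sum>x\<leftarrow>a # as. 2 * x - 1) + lo = hi + 2" "1 \<le> lo" "1 \<le> (a::nat)"
  shows "a \<le> hi + 1" "lo + (a - 1) \<le> Suc (hi + 1 - a)"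
    "as \<noteq> [] \<Longrightarrow> \<forall>x\<in>set as. 1 \<le> x \<Longrightarrow> (\<Sum>x\<leftarrow>as. 2 * x - 1) + (lo + a - 1) = (hi - a) + 2 \<and> a \<le> hi"
    "as = [] \<Longrightarrow> hi - a < lo + a - 1"
proof -
  have "(2 * a - 1) + (\<Sum>x\<leftarrow>as. 2 * x - 1) + lo = hi + 2" using assms by simp
  then show "a \<le> hi + 1" "lo + (a - 1) \<le> Suc (hi + 1 - a)" "as = [] \<Longrightarrow> hi - a < lo + a - 1"
    using assms by auto
  assume "as \<noteq> []" "\<forall>x\<in>set as. 1 \<le> x"
  then have "1 \<le> (\<Sum>x\<leftarrow>as. 2 * x - 1)" by (cases as) auto
  then show "(\<Sum>x\<leftarrow>as. 2 * x - 1) + (lo + a - 1) = (hi - a) + 2 \<and> a \<le> hi"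
    using assms by auto
qed

lemma set_word_A:
  assumes "(\<Sum>x\<leftarrow>as. 2 * x - 1) + lo = hi + 2" "1 \<le> lo" "\<forall>x\<in>set as. 1 \<le> x"
  shows "set (word_A lo hi as) \<subseteq> {lo..hi}"
  using assms
proof (induction as arbitrary: lo hi)
  case (Cons a as)
  have "1 \<le> a" using Cons.prems by simp
  note b = parts_A_bound[OF Cons.prems(1,2) this]
  have "set (word_A (lo + a - 1) (hi - a) as) \<subseteq> {lo + a - 1..hi - a}"
  proof (cases "as = []")
    case False
    then show ?thesis using b Cons.prems by (intro Cons.IH) auto
  qed simp
  then show ?case using Cons.prems b by (cases "as = []") (fastforce simp del: upt_Suc)+
qed simp

lemma set_twists_A:
  assumes "1 \<le> lo" "\<forall>x\<in>set as. 1 \<le> x"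
  shows "set (twists_A D lo hi e as) \<subseteq> {lo..hi}"
  using assms
proof (induction as arbitrary: lo hi e)
  case (Cons a as)
  have "set (twists_A D (lo + a - 1) (hi - a) (D div (2 * a - 1)) as) \<subseteq> {lo + a - 1..hi - a}"
    using Cons.prems by (intro Cons.IH) auto
  then show ?case using Cons.prems set_half_twist[of lo hi] by fastforce
qed simp

context braid_seq
begin

lemma half_twist_prefix_right:
  assumes "1 \<le> a" "b \<le> b'"
  shows "\<exists>v \<in> lists {a..b'}. half_twist a b' = half_twist a b @ v"
  using assms(2)
proof (induction b' rule: dec_induct)
  case (step b')
  show ?case
  proof (cases "a \<le> Suc b'")
    case True
    obtain v where "v \<in> lists {a..b'}" "half_twist a b' = half_twist a b @ v" using step by blast
    then show ?thesis using True by (intro bexI[of _ "v @ rev [a..<Suc (Suc b')]"]) fastforce+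
  next
    case False
    then show ?thesis using step by (intro bexI[of _ "[]"]) auto
  qed
qed auto

lemma half_twist_prefix_left:
  assumes "1 \<le> a" "a \<le> a'" "{a..b} \<subseteq> X"
  shows "\<exists>v \<in> lists {a..b}. ev s (half_twist a b) = ev s (half_twist a' b @ v)"
  using assms(2)
proof (induction a' rule: dec_induct)
  case (step a')
  then obtain v where v: "v \<in> lists {a..b}" "ev s (half_twist a b) = ev s (half_twist a' b @ v)" by blast
  show ?case
  proof (cases "a' \<le> b")
    case True
    then have "ev s (half_twist a' b) = ev s (half_twist (Suc a') b) * ev s [a'..<Suc b]"
      using assms step by (intro half_twist_asc_right) auto
    then have "ev s (half_twist a b) = ev s (half_twist (Suc a') b @ ([a'..<Suc b] @ v))"
      using v by (simp add: mult.assoc del: upt_Suc)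
    moreover have "[a'..<Suc b] @ v \<in> lists {a..b}" using v step by (fastforce simp del: upt_Suc)
    ultimately show ?thesis by blast
  next
    case False
    then show ?thesis using v by (intro bexI[of _ v]) auto
  qed
qed (auto intro: bexI[of _ "[]"])

text \<open>The inner word divides the inner twist. Raised by one, that twist divides
  \<open>half_twist (Suc lo) (hi + 1 - a)\<close>, which is what remains of
  \<open>half_twist lo (hi + 1 - a)\<close> behind the segment. Reducedness of the word follows from
  that of the half twist.\<close>

lemma word_A_prefix:
  assumes "(\<Sum>x\<leftarrow>as. 2 * x - 1) + lo = hi + 2" "1 \<le> lo" "\<forall>x\<in>set as. 1 \<le> x" "{lo..hi} \<subseteq> X"
  shows "\<exists>v \<in> lists {lo..hi}. ev s (word_A lo hi as @ v) = ev s (half_twist lo hi)"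
  using assms
proof (induction as arbitrary: lo hi)
  case Nil
  then have "hi < lo" by simp
  then show ?case by (intro bexI[of _ "[]"]) auto
next
  case (Cons a as)
  have a: "1 \<le> a" using Cons.prems by simp
  note b = parts_A_bound[OF Cons.prems(1,2) a]
  define w where "w = word_A (lo + a - 1) (hi - a) as"
  define ht where "ht = half_twist (lo + a - 1) (hi - a)"
  have sub: "{lo + a - 1..hi - a} \<subseteq> {lo..<hi + 1 - a}" using a Cons.prems b by auto
  have sub': "{lo..hi + 1 - a} \<subseteq> X" by (rule subset_trans[OF _ Cons.prems(4)]) (use a in auto)
  have "\<exists>v \<in> lists {lo + a - 1..hi - a}. ev s (w @ v) = ev s ht"
  proof (cases "as = []")
    case True
    then show ?thesis using b(4) by (intro bexI[of _ "[]"]) (auto simp: w_def ht_def)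
  next
    case False
    moreover have "{lo + a - 1..hi - a} \<subseteq> X" using sub sub' by fastforce
    ultimately show ?thesis unfolding w_def ht_def using b(3) Cons.prems a by (intro Cons.IH) auto
  qed
  then obtain v where v: "v \<in> lists {lo + a - 1..hi - a}" "ev s (w @ v) = ev s ht" by blast
  have setw: "set (w @ v) \<subseteq> {lo..<hi + 1 - a}"
  proof -
    have "set w \<subseteq> {lo + a - 1..hi - a}"
    proof (cases "as = []")
      case False
      then show ?thesis unfolding w_def using b(3) Cons.prems a by (intro set_word_A) auto
    qed (simp add: w_def)
    then show ?thesis using v sub by auto
  qed
  have setht: "set ht \<subseteq> {lo..<hi + 1 - a}"
    unfolding ht_def using set_half_twist[of "lo + a - 1" "hi - a"] sub a Cons.prems(2) by fastforce
  define c where "c = rev [lo..<Suc (hi + 1 - a)]"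
  \<comment> \<open>Raising letters is an operation on words, not on elements, so the equation for
    \<open>w @ v\<close> cannot simply be shifted. Passing both sides through \<open>c\<close>
    transfers it to the raised words, with \<open>c\<close> remaining in front.\<close>
  have "ev s c * ev s (map Suc (w @ v)) = ev s (w @ v) * ev s c"
    unfolding c_def using desc_shift_word[OF sub' setw] .
  also have "\<dots> = ev s c * ev s (map Suc ht)"
    unfolding v(2) c_def using desc_shift_word[OF sub' setht] by simp
  finally have 1: "ev s c * ev s (map Suc w) * ev s (map Suc v) = ev s c * ev s (map Suc ht)"
    by (simp add: mult.assoc)
  obtain z where z: "z \<in> lists {Suc lo..hi + 1 - a}"
    "ev s (half_twist (Suc lo) (hi + 1 - a)) = ev s (map Suc ht) * ev s z"
  proof (cases "lo + a \<le> hi + 1 - a")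
    case True
    have "map Suc ht = half_twist (lo + a) (hi + 1 - a)"
    proof -
      have "Suc (lo + a - 1) = lo + a" "Suc (hi - a) = hi + 1 - a" using True a by auto
      then show ?thesis unfolding ht_def using map_Suc_half_twist[of "lo + a - 1" "hi - a"] a Cons.prems by simp
    qed
    moreover have "{Suc lo..hi + 1 - a} \<subseteq> X" using sub' by auto
    ultimately show ?thesis
      using half_twist_prefix_left[of "Suc lo" "lo + a" "hi + 1 - a"] a that by auto
  next
    case False
    then have "hi - a < lo + a - 1" using a Cons.prems(2) by arith
    then have "ht = []" unfolding ht_def by (rule half_twist_empty)
    moreover have "half_twist (Suc lo) (hi + 1 - a) \<in> lists {Suc lo..hi + 1 - a}"
      using set_half_twist[of "Suc lo" "hi + 1 - a"] by (simp add: in_lists_conv_set subset_eq)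
    ultimately show ?thesis using that by simp
  qed
  obtain z' where z': "z' \<in> lists {lo..hi}" "half_twist lo hi = half_twist lo (hi + 1 - a) @ z'"
  proof -
    have "hi + 1 - a \<le> hi" using a by arith
    from half_twist_prefix_right[OF Cons.prems(2) this] show ?thesis using that by blast
  qed
  have "ev s (half_twist lo (hi + 1 - a)) = ev s c * ev s (half_twist (Suc lo) (hi + 1 - a))"
  proof (cases "lo \<le> hi + 1 - a")
    case True
    then show ?thesis unfolding c_def using Cons.prems sub' by (intro half_twist_desc_left) auto
  next
    case False
    then show ?thesis by (simp add: c_def)
  qed
  then have "ev s (half_twist lo hi) = ev s c * ev s (map Suc ht) * ev s z * ev s z'"
    unfolding z'(2) by (simp only: ev_simps z(2) mult.assoc)
  then have "ev s (half_twist lo hi) = ev s (word_A lo hi (a # as) @ (map Suc v @ z @ z'))"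
    unfolding 1[symmetric] by (simp only: c_def w_def word_A.simps ev_simps mult.assoc)
  moreover have "map Suc v @ z @ z' \<in> lists {lo..hi}"
  proof -
    have "set (map Suc v) \<subseteq> {lo..hi}"
    proof
      fix j assume "j \<in> set (map Suc v)"
      then obtain i where i: "j = Suc i" "i \<in> set v" by auto
      then have "lo + a - 1 \<le> i" "i \<le> hi - a" using v(1) by (auto simp: in_lists_conv_set)
      then show "j \<in> {lo..hi}" using a Cons.prems(2) i(1) by auto
    qed
    moreover have "set z \<subseteq> {lo..hi}" using z(1) a by (fastforce simp: in_lists_conv_set)
    ultimately show ?thesis using z'(1) by (auto simp: in_lists_conv_set)
  qed
  ultimately show ?case by metis
qed

end

text \<open>Decreasing parts have increasing exponents, so the difference of consecutive exponents
  is not truncated and the power common to both can be taken out. When no part is left, the inner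
  twist must itself be trivial.\<close>

lemma twists_A_first:
  assumes "weakly_decreasing_pos (a # as)" "as = [] \<Longrightarrow> half_twist lo hi = []"
  shows "ev s (twists_A D lo hi 0 as)
    = ev s (half_twist lo hi) ^ (D div (2 * a - 1)) * ev s (twists_A D lo hi (D div (2 * a - 1)) as)"
proof (cases as)
  case (Cons a' as')
  then have "2 * a' - 1 \<le> 2 * a - 1" "2 * a' - 1 > 0" using assms by (auto simp: weakly_decreasing_pos_def)
  then have "D div (2 * a - 1) \<le> D div (2 * a' - 1)" by (rule div_le_mono2[rotated])
  then show ?thesis
    by (simp add: Cons ev_concat_replicate mult.assoc[symmetric] power_add[symmetric])
qed (use assms in simp)

text \<open>The flip is a variable of the induction because the hypothesis is used for y on the
  inner interval. The factor \<open>S ^ D\<close> stays in the statement: for the inner flip it is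
  \<open>y ^ D\<close>, and this power produces the outer half twists.\<close>

lemma twisted_power_A:
  assumes "braid_flip s X S lo hi" "weakly_decreasing_pos as" "even D" "\<forall>a\<in>set as. (2 * a - 1) dvd D"
    "(\<Sum>x\<leftarrow>as. 2 * x - 1) + lo = hi + 2"
  shows "(ev s (word_A lo hi as) * S) ^ D = ev s (twists_A D lo hi 0 as) * S ^ D"
  using assms
proof (induction as arbitrary: lo hi S)
  case (Cons a as)
  interpret braid_flip s X S lo hi by fact
  have a: "1 \<le> a" and dec: "weakly_decreasing_pos as" and pos: "\<forall>x\<in>set as. 1 \<le> x"
    using Cons.prems by (auto simp: weakly_decreasing_pos_def)
  note b = parts_A_bound[OF Cons.prems(5) lo a]
  let ?lo = "lo + a - 1" and ?hi = "hi - a" and ?b = "hi + 1 - a" and ?m = "2 * a - 1"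
  define y where "y = rot ?b"
  define w where "w = word_A ?lo ?hi as"
  have subb: "{lo..?b} \<subseteq> X" by (rule subset_trans[OF _ interval]) (use a in auto)
  interpret inner: braid_flip s X y ?lo ?hi
  proof unfold_locales
    show "1 \<le> ?lo" using lo a by simp
    show "{?lo..?hi} \<subseteq> X" by (rule subset_trans[OF _ interval]) (use a in auto)
    fix j assume j: "j \<in> {?lo..?hi}"
    define i where "i = ?lo + ?hi - j"
    have i: "lo + hi - j = Suc i" "lo \<le> i" "i < ?b" using j a lo by (auto simp: i_def)
    have "y * s j = ev s (rev [lo..<Suc ?b]) * (S * s j)"
      by (simp add: y_def rot_def mult.assoc del: upt_Suc)
    also have "S * s j = s (Suc i) * S" proof -
      have "j \<in> {lo..hi}" using j a by auto
      from flip[OF this] show ?thesis unfolding i(1) .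
    qed
    also have "ev s (rev [lo..<Suc ?b]) * (s (Suc i) * S) = s i * y"
      using desc_shift[OF subb i(2,3)] by (simp add: y_def rot_def mult.assoc[symmetric] del: upt_Suc)
    finally show "y * s j = s (?lo + ?hi - j) * y" by (simp only: i_def)
  qed
  have setw: "set w \<subseteq> {?lo..?hi}"
  proof (cases "as = []")
    case False
    then show ?thesis unfolding w_def using b(3) pos lo a by (intro set_word_A) auto
  qed (simp add: w_def)
  have "(ev s (rev [lo..<Suc ?b]) * ev s (map Suc w)) * S = (ev s w * ev s (rev [lo..<Suc ?b])) * S"
  proof -
    have "set w \<subseteq> {lo..<?b}" by (rule subset_trans[OF setw]) (use a lo in auto)
    from desc_shift_word[OF subb this] show ?thesis by simp
  qed
  then have word: "ev s (word_A lo hi (a # as)) * S = ev s w * y"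
    by (simp add: w_def y_def rot_def mult.assoc del: upt_Suc)
  let ?E = "D div ?m"
  define T where "T = ev s (half_twist ?lo ?hi)"
  define F where "F = ev s (twists_A D ?lo ?hi ?E as)"
  have D: "D = ?m * ?E" using Cons.prems by simp
  have "(ev s w * y) ^ D = ev s (twists_A D ?lo ?hi 0 as) * y ^ D"
  proof (cases "as = []")
    case False
    then show ?thesis unfolding w_def using Cons.prems dec b(3) pos
      by (intro Cons.IH inner.braid_flip_axioms) auto
  qed (simp add: w_def)
  also have "\<dots> = y ^ D * ev s (twists_A D ?lo ?hi 0 as)"
    using inner.flip_even_power[OF set_twists_A Cons.prems(3)] pos lo a by simp
  also have "ev s (twists_A D ?lo ?hi 0 as) = T ^ ?E * F"
    unfolding T_def F_def using Cons.prems(2) b(4) by (intro twists_A_first) auto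
  \<comment> \<open>Since \<open>D = ?m * ?E\<close>, the power of \<open>y\<close> splits into
    \<open>?E\<close> groups of \<open>?m\<close>, each paired with one inner twist, so that the
    polygon identity applies to every pair.\<close>
  also have "y ^ D * (T ^ ?E * F) = (y ^ ?m * T) ^ ?E * F"
  proof -
    have "y ^ ?m * T = T * y ^ ?m"
      using power_commuting_commutes[OF inner.flip_half_twist_full] by (simp add: T_def)
    then have "(y ^ ?m * T) ^ ?E = (y ^ ?m) ^ ?E * T ^ ?E" by (rule power_mult_distrib_commuting)
    then show ?thesis by (subst D) (simp add: power_mult mult.assoc)
  qed
  also have "y ^ ?m * T = ev s (half_twist lo hi) * S ^ ?m"
  proof -
    have e: "2 * (a - 1) + 1 = ?m" "lo + (a - 1) = ?lo" "?b - 1 = ?hi" using a by auto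
    have "T * y ^ ?m = ev s (half_twist lo hi) * S ^ ?m"
      using half_twist_rot_power[of "a - 1" ?b] b(1,2) a unfolding e T_def y_def by simp
    moreover have "y ^ ?m * T = T * y ^ ?m"
      using power_commuting_commutes[OF inner.flip_half_twist_full] by (simp add: T_def)
    ultimately show ?thesis by simp
  qed
  also have "(ev s (half_twist lo hi) * S ^ ?m) ^ ?E = ev s (half_twist lo hi) ^ ?E * S ^ D"
  proof -
    have "S ^ ?m * ev s (half_twist lo hi) = ev s (half_twist lo hi) * S ^ ?m"
      using power_commuting_commutes[OF flip_half_twist_full] .
    from power_mult_distrib_commuting[OF this[symmetric]] show ?thesis
      by (subst (3) D) (simp add: power_mult)
  qed
  also have "ev s (half_twist lo hi) ^ ?E * S ^ D * F = ev s (half_twist lo hi) ^ ?E * F * S ^ D"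
  proof -
    have "set (twists_A D ?lo ?hi ?E as) \<subseteq> {lo..hi}"
      by (rule subset_trans[OF set_twists_A]) (use pos lo a in auto)
    then have "S ^ D * F = F * S ^ D" unfolding F_def using Cons.prems(3) by (rule flip_even_power)
    then show ?thesis by (simp add: mult.assoc)
  qed
  finally show ?case unfolding word by (simp add: ev_concat_replicate F_def)
qed simp

section \<open>Loops around the pole\<close>

definition loop :: "nat \<Rightarrow> nat \<Rightarrow> nat list" where
  "loop n b = [b..<n] @ [n] @ rev [b..<n]"

text \<open>The loop is split off here, whereas the factors of \<open>w_B\<close> read
  \<open>[b..<n] @ rev [Suc a..<Suc n]\<close>; both are the same word.\<close>

definition block :: "nat \<Rightarrow> nat \<Rightarrow> nat \<Rightarrow> nat list" where
  "block n a b = loop n b @ rev [Suc a..<b]"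

definition loops :: "nat \<Rightarrow> nat \<Rightarrow> nat list" where
  "loops n p = concat (map (loop n) [Suc p..<Suc n])"

text \<open>\<open>p\<close> is the sum of the parts already treated. The factor word is a
  parameter, as is the twist word of \<open>twists\<close>, in order that types B and D share the
  recursion.\<close>

fun factors :: "(nat \<Rightarrow> nat \<Rightarrow> nat list) \<Rightarrow> nat \<Rightarrow> nat list \<Rightarrow> nat list" where
  "factors g p [] = []"
| "factors g p (a # as) = g p (p + a) @ factors g (p + a) as"

fun twists :: "(nat \<Rightarrow> nat list) \<Rightarrow> nat \<Rightarrow> nat \<Rightarrow> nat \<Rightarrow> nat list \<Rightarrow> nat list" where
  "twists f D p e [] = []"
| "twists f D p e (a # as) = concat (replicate (D div a - e) (f p)) @ twists f D (p + a) (D div a) as"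

lemma loop_rec: "b < n \<Longrightarrow> loop n b = b # loop n (Suc b) @ [b]"
  by (simp add: loop_def upt_conv_Cons)

lemma set_loop: "set (loop n b) \<subseteq> {b..n} \<union> {n}"
  by (auto simp: loop_def)

lemma loops_rec: "p < n \<Longrightarrow> loops n p = loop n (Suc p) @ loops n (Suc p)"
  unfolding loops_def by (subst upt_conv_Cons) (auto simp del: upt_Suc)

lemma loops_self [simp]: "loops n n = []"
  by (simp add: loops_def)

lemma set_loops: "set (loops n p) \<subseteq> {Suc p..n}"
  using set_loop by (fastforce simp: loops_def simp del: upt_Suc)

lemma set_block: "a < b \<Longrightarrow> b \<le> n \<Longrightarrow> set (block n a b) \<subseteq> {Suc a..n}"
  using set_loop[of n b] by (auto simp: block_def)

lemma set_word_B:
  "sum_list as + p = n \<Longrightarrow> \<forall>x\<in>set as. 1 \<le> x \<Longrightarrow> set (factors (block n) p as) \<subseteq> {Suc p..n}"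
proof (induction as arbitrary: p)
  case (Cons a as)
  then have "set (factors (block n) (p + a) as) \<subseteq> {Suc (p + a)..n}" by (intro Cons.IH) auto
  moreover have "set (block n p (p + a)) \<subseteq> {Suc p..n}" using Cons.prems by (intro set_block) auto
  ultimately show ?case by fastforce
qed simp

lemma set_twists_B: "set (twists (loops n) D p e as) \<subseteq> {Suc p..n}"
proof (induction as arbitrary: p e)
  case (Cons a as)
  show ?case using Cons[of "p + a" "D div a"] set_loops[of n p] by fastforce
qed simp

text \<open>Only relations are required of \<open>s n\<close>. In type D this letter will be an
  automorphism rather than a braid.\<close>

locale braid_seq_B = braid_seq s "{1..<n}" for s :: "nat \<Rightarrow> 'm::monoid_mult" and n +
  assumes far_last: "1 \<le> i \<Longrightarrow> Suc i < n \<Longrightarrow> s i * s n = s n * s i"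
    and braid_last: "1 \<le> i \<Longrightarrow> Suc i = n \<Longrightarrow> s i * s n * s i * s n = s n * s i * s n * s i"
begin

lemma far_B:
  assumes "i \<in> {1..n}" "j \<in> {1..n}" "Suc i < j \<or> Suc j < i"
  shows "s i * s j = s j * s i"
  using far'[of i j] far_last[of i] far_last[of j] assms by (cases "i = n"; cases "j = n") auto

text \<open>For \<open>j > Suc b\<close> the outer letters commute with \<open>s j\<close> and the
  induction hypothesis treats the inner loop. For \<open>j = Suc b\<close> two letters are peeled
  off at each end and a braid relation is applied on both sides of the inner loop, through which
  \<open>s b\<close> passes. The relation of length four enters only when
  \<open>Suc b = n\<close>.\<close>

lemma loop_commute_gen:
  assumes "1 \<le> b" "b < j" "j \<le> n"
  shows "ev s (loop n b) * s j = s j * ev s (loop n b)"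
  using assms
proof (induction "n - b" arbitrary: b j)
  case (Suc d)
  have bn: "b < n" using Suc.prems by simp
  note r = loop_rec[OF bn]
  show ?case
  proof (cases "j = Suc b")
    case False
    then have j: "Suc b < j" using Suc.prems by simp
    then have 1: "s b * s j = s j * s b" using Suc.prems by (intro far_B) auto
    have 2: "ev s (loop n (Suc b)) * s j = s j * ev s (loop n (Suc b))"
      using Suc j by (intro Suc.hyps(1)) auto
    have "ev s (loop n b) * s j = s b * ev s (loop n (Suc b)) * (s b * s j)"
      unfolding r by (simp add: mult.assoc)
    also have "\<dots> = s b * (ev s (loop n (Suc b)) * s j) * s b" unfolding 1 by (simp add: mult.assoc)
    also have "\<dots> = (s b * s j) * ev s (loop n (Suc b)) * s b" unfolding 2 by (simp add: mult.assoc)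
    also have "\<dots> = s j * ev s (loop n b)" unfolding 1 r by (simp add: mult.assoc)
    finally show ?thesis .
  next
    case True
    show ?thesis
    proof (cases "Suc b = n")
      case n: True
      have "loop n n = [n]" by (simp add: loop_def)
      then show ?thesis using braid_last[of b] Suc.prems r True n by (simp add: mult.assoc)
    next
      case False
      let ?c = "Suc b" and ?L = "ev s (loop n (Suc (Suc b)))"
      have c: "?c < n" using bn False by simp
      have r2: "loop n b = [b, ?c] @ loop n (Suc ?c) @ [?c, b]"
        unfolding r loop_rec[OF c] by simp
      have br: "s b * s ?c * s b = s ?c * s b * s ?c" using Suc.prems c by (intro braid) auto
      have com: "s b * ?L = ?L * s b"
      proof (rule ev_commute)
        fix i assume "i \<in> set (loop n (Suc (Suc b)))"
        then have "i \<in> {Suc (Suc b)..n}" using set_loop[of n "Suc (Suc b)"] c by auto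
        then show "s b * s i = s i * s b" using Suc.prems bn by (intro far_B) auto
      qed
      have "ev s (loop n b) * s ?c = s b * s ?c * ?L * (s ?c * s b * s ?c)"
        unfolding r2 by (simp add: mult.assoc)
      also have "\<dots> = s b * s ?c * (?L * s b) * s ?c * s b" unfolding br[symmetric] by (simp add: mult.assoc)
      also have "\<dots> = (s b * s ?c * s b) * ?L * s ?c * s b" unfolding com[symmetric] by (simp add: mult.assoc)
      also have "\<dots> = s ?c * ev s (loop n b)" unfolding br r2 by (simp add: mult.assoc)
      finally show ?thesis using True by simp
    qed
  qed
qed simp

lemma loop_commute_word:
  assumes "1 \<le> b" "set u \<subseteq> {Suc b..n}"
  shows "ev s (loop n b) * ev s u = ev s u * ev s (loop n b)"
proof (rule ev_commute)
  fix j assume "j \<in> set u"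
  then show "ev s (loop n b) * s j = s j * ev s (loop n b)"
    using assms by (intro loop_commute_gen) auto
qed

lemma far_word_below:
  assumes "set u \<subseteq> {1..<b}" "set v \<subseteq> {Suc b..n}" "b \<le> n"
  shows "ev s u * ev s v = ev s v * ev s u"
proof (rule ev_commute_ev)
  fix i j assume "i \<in> set u" "j \<in> set v"
  then have "i \<in> {1..<b}" "j \<in> {Suc b..n}" using assms by auto
  then show "s i * s j = s j * s i" using assms(3) by (intro far_B) auto
qed

lemma block_commute_word:
  assumes "a < b" "b \<le> n" "set u \<subseteq> {Suc b..n}"
  shows "ev s (block n a b) * ev s u = ev s u * ev s (block n a b)"
proof -
  have 1: "ev s (rev [Suc a..<b]) * ev s u = ev s u * ev s (rev [Suc a..<b])"
    using assms by (intro far_word_below) auto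
  have 2: "ev s (loop n b) * ev s u = ev s u * ev s (loop n b)"
    using assms by (intro loop_commute_word) auto
  have "ev s (block n a b) * ev s u = ev s (loop n b) * (ev s (rev [Suc a..<b]) * ev s u)"
    by (simp add: block_def mult.assoc)
  also have "\<dots> = (ev s (loop n b) * ev s u) * ev s (rev [Suc a..<b])" unfolding 1 by (simp add: mult.assoc)
  finally show ?thesis unfolding 2 by (simp add: block_def mult.assoc)
qed

lemma block_shift:
  assumes "Suc a < b" "b \<le> n" "Suc a \<le> j" "Suc j < b"
  shows "s j * ev s (block n a b) = ev s (block n a b) * s (Suc j)"
proof -
  have b: "b = Suc (b - 1)" using assms by simp
  have "ev s (rev [Suc a..<b]) * s (Suc j) = s j * ev s (rev [Suc a..<b])"
  proof -
    have "{Suc a..b - 1} \<subseteq> {1..<n}" "j < b - 1" using assms by auto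
    from desc_shift[OF this(1) assms(3) this(2)] show ?thesis using b by simp
  qed
  moreover have "s j * ev s (loop n b) = ev s (loop n b) * s j"
  proof (rule ev_commute)
    fix i assume "i \<in> set (loop n b)"
    then have "i \<in> {b..n}" using set_loop[of n b] assms by auto
    then show "s j * s i = s i * s j" using assms by (intro far_B) auto
  qed
  ultimately show ?thesis unfolding block_def ev_simps by (metis mult.assoc)
qed

text \<open>The longer block is the shorter one times \<open>s (Suc a)\<close>. A letter passing a
  block rightwards is raised by one, so the extra letters of k blocks collect at the right as an
  ascending word.\<close>

lemma block_power_step:
  assumes "Suc a < b" "b \<le> n" "a + k < b"
  shows "ev s (block n a b) ^ k = ev s (block n (Suc a) b) ^ k * ev s [Suc a..<Suc (a + k)]"
  using assms(3)
proof (induction k)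
  case (Suc k)
  let ?c = "ev s (block n a b)" and ?u = "ev s (block n (Suc a) b)"
  have "[Suc a..<b] = Suc a # [Suc (Suc a)..<b]" using assms by (simp add: upt_conv_Cons)
  then have c: "?c = ?u * s (Suc a)" by (simp add: block_def mult.assoc)
  have "ev s [Suc a..<Suc (a + k)] * ?c = ?c * ev s (map Suc [Suc a..<Suc (a + k)])"
  proof -
    have "set u \<subseteq> {Suc a..a + k} \<Longrightarrow> ev s u * ?c = ?c * ev s (map Suc u)" for u
    proof (induction u)
      case (Cons j u)
      then have "ev s (j # u) * ?c = (s j * ?c) * ev s (map Suc u)" by (simp add: mult.assoc)
      also have "s j * ?c = ?c * s (Suc j)" using Cons.prems Suc.prems assms by (intro block_shift) auto
      finally show ?case by (simp add: mult.assoc)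
    qed simp
    from this[of "[Suc a..<Suc (a + k)]"] show ?thesis by (simp add: atLeastLessThanSuc_atLeastAtMost del: upt_Suc)
  qed
  also have "map Suc [Suc a..<Suc (a + k)] = [Suc (Suc a)..<Suc (Suc (a + k))]" by (simp add: map_Suc_upt del: upt_Suc)
  finally have 1: "ev s [Suc a..<Suc (a + k)] * ?c = ?u * (s (Suc a) * ev s [Suc (Suc a)..<Suc (Suc (a + k))])"
    unfolding c by (simp add: mult.assoc del: upt_Suc)
  have 2: "[Suc a..<Suc (a + Suc k)] = Suc a # [Suc (Suc a)..<Suc (Suc (a + k))]"
    by (simp add: upt_conv_Cons del: upt_Suc)
  have "?c ^ Suc k = ?u ^ k * (ev s [Suc a..<Suc (a + k)] * ?c)"
    using Suc by (simp add: power_commutes mult.assoc power_Suc2 del: upt_Suc power_Suc)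
  then show ?case unfolding 1 2 by (simp add: power_Suc2 mult.assoc del: upt_Suc power_Suc)
qed simp

text \<open>After \<open>b - a - 1\<close> blocks the collected letters are exactly those that
  complete one further block to the loop at \<open>Suc a\<close>; the remaining loops come from the
  shorter block by induction.\<close>

lemma block_power:
  assumes "a < b" "b \<le> n"
  shows "ev s (block n a b) ^ (b - a) = ev s (concat (map (loop n) [Suc a..<Suc b]))"
  using assms(1)
proof (induction "b - a" arbitrary: a)
  case (Suc d)
  show ?case
  proof (cases "Suc a = b")
    case True
    then show ?thesis by (auto simp: block_def)
  next
    case False
    then have ab: "Suc a < b" using Suc.prems by simp
    let ?k = "b - Suc a"
    have k: "b - a = Suc ?k" using ab by simp
    have "ev s (block n a b) ^ (b - a) = ev s (block n a b) ^ ?k * ev s (block n a b)"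
      unfolding k by (simp add: power_commutes)
    also have "ev s (block n a b) ^ ?k = ev s (block n (Suc a) b) ^ ?k * ev s [Suc a..<b]"
      using block_power_step[OF ab assms(2), of ?k] ab by (simp del: upt_Suc)
    also have "ev s (block n (Suc a) b) ^ ?k = ev s (concat (map (loop n) [Suc (Suc a)..<Suc b]))"
      using Suc ab by (intro Suc.hyps(1)) auto
    also have "\<dots> * ev s [Suc a..<b] * ev s (block n a b)
       = ev s (concat (map (loop n) [Suc (Suc a)..<Suc b])) * ev s (loop n (Suc a))"
    proof -
      have "loop n (Suc a) = [Suc a..<b] @ block n a b"
      proof -
        have "[Suc a..<n] = [Suc a..<b] @ [b..<n]" using ab assms by (intro upt_split) auto
        then show ?thesis by (simp add: loop_def block_def)
      qed
      then show ?thesis by (simp add: mult.assoc del: upt_Suc)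
    qed
    also have "\<dots> = ev s (loop n (Suc a)) * ev s (concat (map (loop n) [Suc (Suc a)..<Suc b]))"
    proof (rule loop_commute_word[symmetric])
      show "set (concat (map (loop n) [Suc (Suc a)..<Suc b])) \<subseteq> {Suc (Suc a)..n}"
        using set_loop assms(2) by (fastforce simp del: upt_Suc)
    qed simp
    also have "\<dots> = ev s (concat (map (loop n) [Suc a..<Suc b]))"
      using ab by (subst (2) upt_conv_Cons) (auto simp del: upt_Suc)
    finally show ?thesis .
  qed
qed simp

lemma loops_split:
  assumes "p < q" "q \<le> n"
  shows "ev s (loops n p) = ev s (block n p q) ^ (q - p) * ev s (loops n q)"
proof -
  have "[Suc p..<Suc n] = [Suc p..<Suc q] @ [Suc q..<Suc n]" using assms by (intro upt_split) auto
  then show ?thesis using block_power[OF assms] by (simp add: loops_def del: upt_Suc)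
qed

text \<open>The loops commute with one another, so any of them can be brought to the front, and with
  it its first letter j.\<close>

lemma loops_left_divisor:
  assumes "j \<in> {Suc p..n}"
  shows "\<exists>v \<in> lists {Suc p..n}. ev s (loops n p) = ev s (loop n j @ v)"
proof -
  define u where "u = concat (map (loop n) [Suc p..<j])"
  define v where "v = loops n j"
  have l: "loops n p = u @ loop n j @ v"
  proof -
    have "[Suc p..<Suc n] = [Suc p..<j] @ [j..<Suc n]" using assms by (intro upt_split) auto
    also have "[j..<Suc n] = j # [Suc j..<Suc n]" using assms by (simp add: upt_conv_Cons del: upt_Suc)
    finally show ?thesis by (simp add: loops_def u_def v_def del: upt_Suc)
  qed
  have com: "ev s (loop n j) * ev s (loop n i) = ev s (loop n i) * ev s (loop n j)" if "i \<in> {Suc p..<j}" for i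
    using that assms set_loop[of n j] by (intro loop_commute_word[symmetric]) auto
  have "ev s (loop n j) * ev s (concat (map (loop n) is)) = ev s (concat (map (loop n) is)) * ev s (loop n j)"
    if "set is \<subseteq> {Suc p..<j}" for "is"
    using that
  proof (induction "is")
    case (Cons i "is")
    have "ev s (loop n j) * ev s (concat (map (loop n) (i # is)))
      = (ev s (loop n j) * ev s (loop n i)) * ev s (concat (map (loop n) is))" by (simp add: mult.assoc)
    also have "\<dots> = ev s (loop n i) * (ev s (loop n j) * ev s (concat (map (loop n) is)))"
      using com[of i] Cons.prems by (simp add: mult.assoc)
    finally show ?case using Cons by (simp add: mult.assoc)
  qed simp
  then have "ev s (loop n j) * ev s u = ev s u * ev s (loop n j)" unfolding u_def by simp
  then have "ev s (loops n p) = ev s (loop n j @ (u @ v))" unfolding l by (simp add: mult.assoc[symmetric])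
  moreover have "u @ v \<in> lists {Suc p..n}"
    using set_loops[of n p] l by (auto simp: in_lists_conv_set)
  ultimately show ?thesis by blast
qed

text \<open>Of the a blocks making up the outer loops one is kept as a factor of the word; the other
  a - 1 are moved behind the inner loops.\<close>

lemma word_B_prefix:
  assumes "sum_list as + p = n" "\<forall>x\<in>set as. 1 \<le> x"
  shows "\<exists>v \<in> lists {Suc p..n}. ev s (factors (block n) p as @ v) = ev s (loops n p)"
  using assms
proof (induction as arbitrary: p)
  case (Cons a as)
  let ?q = "p + a"
  let ?c = "block n p ?q"
  have q: "p < ?q" "?q \<le> n" using Cons.prems by auto
  obtain v where v: "v \<in> lists {Suc ?q..n}" "ev s (factors (block n) ?q as @ v) = ev s (loops n ?q)"
    using Cons.IH[of ?q] Cons.prems by auto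
  let ?r = "concat (replicate (a - 1) ?c)"
  have r: "ev s ?r * ev s (loops n ?q) = ev s (loops n ?q) * ev s ?r"
  proof -
    have "ev s ?c * ev s (loops n ?q) = ev s (loops n ?q) * ev s ?c"
      using q set_loops by (intro block_commute_word)
    then show ?thesis unfolding ev_concat_replicate by (rule power_commuting_commutes)
  qed
  have "ev s (loops n p) = ev s ?c ^ Suc (a - 1) * ev s (loops n ?q)"
    using loops_split[OF q] Cons.prems by simp
  also have "\<dots> = ev s ?c * (ev s ?r * ev s (loops n ?q))"
    by (simp add: ev_concat_replicate mult.assoc)
  also have "\<dots> = ev s (factors (block n) p (a # as) @ (v @ ?r))"
    unfolding r by (simp add: v(2)[symmetric] mult.assoc)
  finally have "ev s (loops n p) = ev s (factors (block n) p (a # as) @ (v @ ?r))" .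
  moreover have "v @ ?r \<in> lists {Suc p..n}"
  proof -
    have "set v \<subseteq> {Suc p..n}" using v(1) by (auto simp: in_lists_conv_set)
    then show ?thesis using set_block[OF q] by (auto simp: in_lists_conv_set)
  qed
  ultimately show ?case by metis
qed (auto intro!: bexI[of _ "[]"])

lemma power_B:
  assumes "weakly_decreasing_pos as" "\<forall>a\<in>set as. a dvd D" "sum_list as + p = n"
  shows "ev s (factors (block n) p as) ^ D = ev s (twists (loops n) D p 0 as)"
  using assms
proof (induction as arbitrary: p)
  case (Cons a as)
  have dec: "weakly_decreasing_pos as" and pos: "\<forall>x\<in>set as. 1 \<le> x" and a: "1 \<le> a"
    using Cons.prems by (auto simp: weakly_decreasing_pos_def)
  let ?q = "p + a" and ?E = "D div a"
  let ?c = "ev s (block n p ?q)" and ?W = "ev s (loops n ?q)"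
  have q: "p < ?q" "?q \<le> n" using Cons.prems a by auto
  have "set (factors (block n) ?q as) \<subseteq> {Suc ?q..n}" using Cons.prems pos by (intro set_word_B) auto
  then have 1: "?c * ev s (factors (block n) ?q as) = ev s (factors (block n) ?q as) * ?c"
    using q by (intro block_commute_word)
  have D: "D = a * ?E" using Cons.prems by simp
  have "ev s (factors (block n) p (a # as)) ^ D = ?c ^ D * ev s (factors (block n) ?q as) ^ D"
    using power_mult_distrib_commuting[OF 1] by simp
  also have "ev s (factors (block n) ?q as) ^ D = ev s (twists (loops n) D ?q 0 as)"
    using Cons.prems dec by (intro Cons.IH) auto
  \<comment> \<open>Decreasing parts make \<open>?E\<close> at most the next exponent, so the power
    \<open>?W ^ ?E\<close> can be taken out. If no part is left, \<open>?W\<close> is the empty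
    product.\<close>
  also have "\<dots> = ?W ^ ?E * ev s (twists (loops n) D ?q ?E as)"
  proof (cases as)
    case Nil
    then show ?thesis using Cons.prems by (simp add: add.commute[of p])
  next
    case (Cons a' as')
    then have "a' \<le> a" "a' > 0" using Cons.prems(1) by (auto simp: weakly_decreasing_pos_def)
    then have "D div a \<le> D div a'" by (intro div_le_mono2)
    then show ?thesis
      by (simp add: Cons ev_concat_replicate mult.assoc[symmetric] power_add[symmetric])
  qed
  also have "?c ^ D * (?W ^ ?E * ev s (twists (loops n) D ?q ?E as))
      = (?c ^ a * ?W) ^ ?E * ev s (twists (loops n) D ?q ?E as)"
  proof -
    have "?c * ?W = ?W * ?c" using q set_loops by (intro block_commute_word)
    then have "?c ^ a * ?W = ?W * ?c ^ a" by (rule power_commuting_commutes)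
    then have "(?c ^ a * ?W) ^ ?E = (?c ^ a) ^ ?E * ?W ^ ?E" by (rule power_mult_distrib_commuting)
    then show ?thesis by (subst (1) D) (simp add: power_mult mult.assoc)
  qed
  also have "?c ^ a * ?W = ev s (loops n p)" using loops_split[OF q] by simp
  finally show ?case by (simp add: ev_concat_replicate)
qed simp

end

section \<open>Coxeter groups: exchange condition and Matsumoto's theorem\<close>

locale coxeter =
  fixes X :: "nat set" and m :: "nat \<Rightarrow> nat \<Rightarrow> nat"
  assumes m_diag: "m i i = 1" and m_sym: "m i j = m j i" and m_pos: "0 < m i j"
begin

definition cox_rels :: "(nat list \<times> nat list) set" where
  "cox_rels = {(concat (replicate (m i j) [i, j]), []) | i j. i \<in> X \<and> j \<in> X}"

definition artin_rels :: "(nat list \<times> nat list) set" where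
  "artin_rels = {(alternating (m i j) i j, alternating (m i j) j i) | i j. i \<in> X \<and> j \<in> X \<and> i \<noteq> j}"

abbreviation weq (infix "\<sim>" 50) where "u \<sim> v \<equiv> word_eq X cox_rels u v"
abbreviation beq (infix "\<approx>" 50) where "u \<approx> v \<equiv> word_eq X artin_rels u v"

definition r :: "nat \<Rightarrow> nat list set endo" where "r = lmul X cox_rels"

lemma ev_r_eq_iff: "u \<in> lists X \<Longrightarrow> v \<in> lists X \<Longrightarrow> ev r u = ev r v \<longleftrightarrow> u \<sim> v"
  unfolding r_def by (rule ev_lmul_eq_iff)

lemma ev_r_rel: "i \<in> X \<Longrightarrow> j \<in> X \<Longrightarrow> (r i * r j) ^ m i j = 1"
proof -
  assume ij: "i \<in> X" "j \<in> X"
  let ?u = "concat (replicate (m i j) [i, j])"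
  have u: "?u \<in> lists X" using ij by (auto simp: in_lists_conv_set)
  have "(?u, []) \<in> cox_rels" using ij unfolding cox_rels_def by blast
  from word_eq.rel[OF this, of "[]" X "[]"] have "?u \<sim> []" using u by simp
  then have "ev r ?u = ev r []" using u by (subst ev_r_eq_iff) auto
  then show ?thesis by (simp add: ev_concat_replicate)
qed

lemma r_square [simp]: "i \<in> X \<Longrightarrow> r i * r i = 1"
  using ev_r_rel[of i i] by (simp add: m_diag)

lemma r_square' [simp]: "i \<in> X \<Longrightarrow> r i * (r i * x) = x"
  by (simp add: mult.assoc[symmetric])

lemma ev_rev: "u \<in> lists X \<Longrightarrow> ev r u * ev r (rev u) = 1" "u \<in> lists X \<Longrightarrow> ev r (rev u) * ev r u = 1"
proof -
  have "set u \<subseteq> X \<Longrightarrow> ev r u * ev r (rev u) = 1" for u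
    by (induction u) (simp_all add: mult.assoc[symmetric], simp add: mult.assoc)
  from this[of u] this[of "rev u"] show "u \<in> lists X \<Longrightarrow> ev r u * ev r (rev u) = 1"
    "u \<in> lists X \<Longrightarrow> ev r (rev u) * ev r u = 1"
    by (auto simp: in_lists_conv_set)
qed

text \<open>The parity of the number of times the reflection \<open>t\<close> occurs in the reflection sequence
  of a word (Bourbaki, Lie IV.1.4).\<close>

fun odd_refl :: "nat list \<Rightarrow> nat list set endo \<Rightarrow> bool" where
  "odd_refl [] t = False"
| "odd_refl (i # u) t = ((t = r i) \<noteq> odd_refl u (r i * t * r i))"

text \<open>The cocycle rule: the reflections contributed by \<open>v\<close> are conjugated by
  \<open>u\<close>.\<close>

lemma odd_refl_append:
  assumes "u \<in> lists X"
  shows "odd_refl (u @ v) t = (odd_refl u t \<noteq> odd_refl v (ev r (rev u) * t * ev r u))"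
  using assms by (induction u arbitrary: t) (auto simp: mult.assoc)

lemma conj_eq_iff: "i \<in> X \<Longrightarrow> r i * t * r i = x \<longleftrightarrow> t = r i * x * r i"
proof -
  assume i: "i \<in> X"
  have "r i * (r i * t * r i) * r i = t" using i by (simp add: mult.assoc)
  moreover have "r i * (r i * x * r i) * r i = x" using i by (simp add: mult.assoc)
  ultimately show ?thesis by metis
qed

text \<open>The reflection at position l of the word i j i j ... is
  \<open>(r i * r j) ^ l * r i\<close>. Positions are counted, since different positions may carry
  the same reflection.\<close>

lemma odd_refl_dihedral:
  assumes "i \<in> X" "j \<in> X"
  shows "odd_refl (concat (replicate k [i, j])) t = odd (card {l. l < 2 * k \<and> t = (r i * r j) ^ l * r i})"
proof (induction k arbitrary: t)
  case (Suc k)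
  let ?q = "r i * r j"
  let ?t = "r j * (r i * t * r i) * r j"
  let ?A = "{l. l < 2 * k \<and> ?t = ?q ^ l * r i}"
  have shift: "(?t = ?q ^ l * r i) = (t = ?q ^ (l + 2) * r i)" for l
  proof -
    have "(?t = ?q ^ l * r i) = (t = r i * (r j * (?q ^ l * r i) * r j) * r i)"
      using assms by (simp add: conj_eq_iff)
    also have "r i * (r j * (?q ^ l * r i) * r j) * r i = ?q * (?q ^ l * ?q) * r i"
      by (simp add: mult.assoc)
    also have "?q * (?q ^ l * ?q) = ?q ^ (l + 2)"
      using power_Suc2[of ?q "Suc l"] by (simp add: mult.assoc)
    finally show ?thesis .
  qed
  let ?B = "(\<lambda>l. l + 2) ` ?A"
  let ?C = "(if t = r i then {0} else {}) \<union> (if t = ?q * r i then {1::nat} else {})"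
  have eq: "l \<in> {l. l < 2 * Suc k \<and> t = ?q ^ l * r i} \<longleftrightarrow> l \<in> ?C \<union> ?B" for l
  proof (cases "l < 2")
    case False
    then obtain l' where l': "l = l' + 2" using le_Suc_ex[of 2 l] by (auto simp: add.commute)
    have "l \<in> ?B \<longleftrightarrow> l' \<in> ?A" unfolding l' by (auto simp del: add_2_eq_Suc')
    then show ?thesis using shift[of l'] False unfolding l' by auto
  next
    case True
    then have "l = 0 \<or> l = 1" by auto
    then show ?thesis by auto
  qed
  have "{l. l < 2 * Suc k \<and> t = ?q ^ l * r i} = ?C \<union> ?B" by (rule Set.set_eqI[OF eq])
  moreover have "card (?C \<union> ?B) = card ?C + card ?B"
    by (rule card_Un_disjoint) (auto split: if_splits)
  moreover have "card ?B = card ?A" by (rule card_image) (auto intro: inj_onI)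
  ultimately have c: "card {l. l < 2 * Suc k \<and> t = ?q ^ l * r i} = card ?C + card ?A" by simp
  have "odd_refl (concat (replicate (Suc k) [i, j])) t
     = ((t = r i) \<noteq> ((r i * t * r i = r j) \<noteq> odd (card ?A)))"
    by (simp add: Suc)
  moreover have "(r i * t * r i = r j) = (t = ?q * r i)" using assms by (simp add: conj_eq_iff)
  ultimately show ?case unfolding c by simp
qed simp

text \<open>Because \<open>(r i * r j) ^ m i j = 1\<close>, the sequence of \<open>2 * m i j\<close>
  reflections repeats after \<open>m i j\<close> steps, so each one occurs an even number of
  times.\<close>

lemma odd_refl_relator:
  assumes "i \<in> X" "j \<in> X"
  shows "\<not> odd_refl (concat (replicate (m i j) [i, j])) t"
proof -
  let ?q = "r i * r j" and ?m = "m i j"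
  let ?A = "{l. l < ?m \<and> t = ?q ^ l * r i}"
  have p: "?q ^ (l + ?m) = ?q ^ l" for l using ev_r_rel[OF assms] by (simp add: power_add)
  have eq: "l \<in> {l. l < 2 * ?m \<and> t = ?q ^ l * r i} \<longleftrightarrow> l \<in> ?A \<union> (\<lambda>l. l + ?m) ` ?A" for l
  proof (cases "l < ?m")
    case False
    then obtain l' where l': "l = l' + ?m" using le_Suc_ex[of ?m l] by (auto simp: add.commute)
    have "l \<in> (\<lambda>l. l + ?m) ` ?A \<longleftrightarrow> l' \<in> ?A" unfolding l' by auto
    then show ?thesis using p[of l'] False unfolding l' by auto
  qed auto
  have "{l. l < 2 * ?m \<and> t = ?q ^ l * r i} = ?A \<union> (\<lambda>l. l + ?m) ` ?A" by (rule Set.set_eqI[OF eq])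
  moreover have "card (?A \<union> (\<lambda>l. l + ?m) ` ?A) = card ?A + card ((\<lambda>l. l + ?m) ` ?A)"
    by (rule card_Un_disjoint) auto
  moreover have "card ((\<lambda>l. l + ?m) ` ?A) = card ?A" by (rule card_image) (auto intro: inj_onI)
  ultimately have "card {l. l < 2 * ?m \<and> t = ?q ^ l * r i} = 2 * card ?A" by simp
  then show ?thesis using odd_refl_dihedral[OF assms, of ?m t] by simp
qed

lemma odd_refl_cong: "u \<sim> v \<Longrightarrow> odd_refl u t = odd_refl v t"
proof (induction arbitrary: t rule: word_eq.induct)
  case (rel u v a b)
  then obtain i j where ij: "i \<in> X" "j \<in> X" and u: "u = concat (replicate (m i j) [i, j])" and v: "v = []"
    unfolding cox_rels_def by auto
  have "ev r u = 1" unfolding u using ev_r_rel[OF ij] by (simp add: ev_concat_replicate)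
  moreover from this have "ev r (rev u) = 1" using ev_rev(1)[OF rel(3)] by simp
  ultimately show ?case using rel odd_refl_relator[OF ij]
    by (simp add: odd_refl_append u[symmetric] v)
qed auto

section \<open>Reduced words and the exchange condition\<close>

definition reduced :: "nat list \<Rightarrow> bool" where
  "reduced u \<longleftrightarrow> u \<in> lists X \<and> (\<forall>v. u \<sim> v \<longrightarrow> length u \<le> length v)"

lemma weq_parity: "u \<sim> v \<Longrightarrow> even (length u) = even (length v)"
  by (induction rule: word_eq.induct) (auto simp: cox_rels_def length_concat sum_list_replicate)

lemma weq_Cons_cancel: "i \<in> X \<Longrightarrow> u \<in> lists X \<Longrightarrow> i # i # u \<sim> u"
  by (subst ev_r_eq_iff[symmetric]) auto

lemma weq_Cons: "i \<in> X \<Longrightarrow> u \<sim> v \<Longrightarrow> i # u \<sim> i # v"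
  using word_eq_context[of X cox_rels u v "[i]" "[]"] by simp

lemma weq_append: "u \<sim> v \<Longrightarrow> w \<in> lists X \<Longrightarrow> w @ u \<sim> w @ v" "u \<sim> v \<Longrightarrow> w \<in> lists X \<Longrightarrow> u @ w \<sim> v @ w"
  using word_eq_context[of X cox_rels u v w "[]"] word_eq_context[of X cox_rels u v "[]" w] by simp_all

lemma reduced_le: "reduced u \<Longrightarrow> u \<sim> v \<Longrightarrow> length u \<le> length v"
  by (simp add: reduced_def)

lemma reduced_weq:
  assumes "reduced u" "u \<sim> v" "length v \<le> length u"
  shows "reduced v"
  unfolding reduced_def
proof (intro conjI allI impI)
  show "v \<in> lists X" using word_eq_lists(2)[OF assms(2)] .
  fix w assume "v \<sim> w"
  from reduced_le[OF assms(1) word_eq.trans[OF assms(2) this]] show "length v \<le> length w"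
    using assms(3) by simp
qed

lemma reduced_weq_length: "reduced u \<Longrightarrow> reduced v \<Longrightarrow> u \<sim> v \<Longrightarrow> length u = length v"
  using reduced_le[of u v] reduced_le[of v u] word_eq.sym[of X cox_rels u v] by simp

lemma reduced_exists:
  assumes "u \<in> lists X"
  shows "\<exists>v. reduced v \<and> u \<sim> v"
proof -
  define v where "v = arg_min length (\<lambda>v. u \<sim> v)"
  have v: "u \<sim> v" unfolding v_def using word_eq.refl[OF assms] by (rule arg_min_natI)
  moreover have "length v \<le> length w" if "v \<sim> w" for w
    unfolding v_def using word_eq.trans[OF v that] by (rule arg_min_nat_le)
  ultimately show ?thesis unfolding reduced_def using word_eq_lists(2)[OF v] by auto
qed

lemma reduced_append:
  assumes "reduced (u @ v)"
  shows "reduced u" "reduced v"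
proof -
  have l: "u \<in> lists X" "v \<in> lists X" using assms by (auto simp: reduced_def)
  have "length u \<le> length w" if "u \<sim> w" for w
    using reduced_le[OF assms weq_append(2)[OF that l(2)]] by simp
  moreover have "length v \<le> length w" if "v \<sim> w" for w
    using reduced_le[OF assms weq_append(1)[OF that l(1)]] by simp
  ultimately show "reduced u" "reduced v" using l by (auto simp: reduced_def)
qed

lemma reduced_Cons: "reduced (i # u) \<Longrightarrow> reduced u"
  using reduced_append(2)[of "[i]" u] by simp

lemma odd_refl_index:
  assumes "odd_refl u t" "u \<in> lists X"
  shows "\<exists>k<length u. t = ev r (take k u) * r (u ! k) * ev r (rev (take k u))"
  using assms
proof (induction u arbitrary: t)
  case (Cons i u)
  then have i: "i \<in> X" by simp
  show ?case
  proof (cases "t = r i")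
    case False
    then obtain k where k: "k < length u" "r i * t * r i = ev r (take k u) * r (u ! k) * ev r (rev (take k u))"
      using Cons by auto
    from k(2) have "t = r i * (ev r (take k u) * r (u ! k) * ev r (rev (take k u))) * r i"
      by (rule conj_eq_iff[OF i, THEN iffD1])
    then have "t = ev r (take (Suc k) (i # u)) * r ((i # u) ! Suc k) * ev r (rev (take (Suc k) (i # u)))"
      by (simp add: mult.assoc)
    then show ?thesis using k by (intro exI[of _ "Suc k"]) simp
  qed (auto intro: exI[of _ 0])
qed simp

text \<open>If \<open>r i\<close> is the reflection at position k, then \<open>r i\<close> times the
  prefix of length k equals that prefix times the letter at k. The result is stated for prefixes
  alone, because later it matters whether k lies inside a given prefix.\<close>

lemma odd_refl_delete:
  assumes "odd_refl u (r i)" "u \<in> lists X" "i \<in> X"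
  shows "\<exists>k<length u. i # take k u \<sim> take (Suc k) u"
proof -
  obtain k where k: "k < length u" "r i = ev r (take k u) * r (u ! k) * ev r (rev (take k u))"
    using odd_refl_index assms by blast
  have l: "take k u \<in> lists X" "take (Suc k) u \<in> lists X" using assms(2) by (auto simp: in_lists_conv_set dest: in_set_takeD)
  have "r i * ev r (take k u) = ev r (take k u) * r (u ! k) * (ev r (rev (take k u)) * ev r (take k u))"
    using k(2) by (simp add: mult.assoc)
  also have "\<dots> = ev r (take (Suc k) u)" using k(1) l ev_rev(2) by (simp add: take_Suc_conv_app_nth)
  finally have "ev r (i # take k u) = ev r (take (Suc k) u)" by simp
  then have "i # take k u \<sim> take (Suc k) u" using l assms(3) by (subst (asm) ev_r_eq_iff) auto
  then show ?thesis using k(1) by blast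
qed

text \<open>Prepending i conjugates the set of odd reflections by \<open>r i\<close> and toggles the
  membership of \<open>r i\<close>, which this conjugation fixes.\<close>

lemma card_odd_refl_Cons:
  assumes "i \<in> X" "finite (Collect (odd_refl u))"
  shows "finite (Collect (odd_refl (i # u)))"
    "card (Collect (odd_refl (i # u))) \<le> Suc (card (Collect (odd_refl u)))"
    "\<not> odd_refl u (r i) \<Longrightarrow> card (Collect (odd_refl (i # u))) = Suc (card (Collect (odd_refl u)))"
proof -
  let ?f = "\<lambda>t. r i * t * r i"
  have inj: "inj ?f" using assms(1) by (intro injI) (metis assms(1) conj_eq_iff)
  have "Collect (odd_refl (i # u)) \<subseteq> insert (r i) (?f ` Collect (odd_refl u))"
  proof
    fix t assume "t \<in> Collect (odd_refl (i # u))"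
    moreover have "t = ?f (?f t)" using assms(1) by (simp add: mult.assoc)
    ultimately show "t \<in> insert (r i) (?f ` Collect (odd_refl u))" by auto
  qed
  moreover have fin: "finite (insert (r i) (?f ` Collect (odd_refl u)))" using assms(2) by simp
  ultimately show "finite (Collect (odd_refl (i # u)))"
    "card (Collect (odd_refl (i # u))) \<le> Suc (card (Collect (odd_refl u)))"
  proof -
    assume sub: "Collect (odd_refl (i # u)) \<subseteq> insert (r i) (?f ` Collect (odd_refl u))" (is "?A \<subseteq> ?B")
    show "finite ?A" using finite_subset[OF sub fin] .
    have "card ?A \<le> card ?B" using card_mono[OF fin sub] .
    also have "\<dots> \<le> Suc (card (?f ` Collect (odd_refl u)))" by (rule card_insert_le_m1) simp_all
    also have "card (?f ` Collect (odd_refl u)) \<le> card (Collect (odd_refl u))" using assms(2) by (rule card_image_le)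
    finally show "card ?A \<le> Suc (card (Collect (odd_refl u)))" by simp
  qed
  assume "\<not> odd_refl u (r i)"
  then have "Collect (odd_refl (i # u)) = insert (r i) (?f ` Collect (odd_refl u))" "r i \<notin> ?f ` Collect (odd_refl u)"
  proof -
    assume *: "\<not> odd_refl u (r i)"
    have rr: "?f (r i) = r i" using assms(1) by (simp add: mult.assoc)
    have ff: "?f (?f t) = t" for t using assms(1) by (simp add: mult.assoc)
    have mem: "t \<in> ?f ` Collect (odd_refl u) \<longleftrightarrow> odd_refl u (?f t)" for t
    proof
      assume "t \<in> ?f ` Collect (odd_refl u)"
      then obtain t' where "odd_refl u t'" "t = ?f t'" by auto
      then show "odd_refl u (?f t)" using ff[of t'] by simp
    next
      assume "odd_refl u (?f t)"
      then show "t \<in> ?f ` Collect (odd_refl u)" by (intro image_eqI[of _ _ "?f t"]) (simp_all add: ff)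
    qed
    show "r i \<notin> ?f ` Collect (odd_refl u)" unfolding mem rr by (rule *)
    show "Collect (odd_refl (i # u)) = insert (r i) (?f ` Collect (odd_refl u))"
    proof (rule Set.set_eqI)
      fix t
      show "t \<in> Collect (odd_refl (i # u)) \<longleftrightarrow> t \<in> insert (r i) (?f ` Collect (odd_refl u))"
        using * rr unfolding insert_iff mem by (cases "t = r i") simp_all
    qed
  qed
  then show "card (Collect (odd_refl (i # u))) = Suc (card (Collect (odd_refl u)))"
    using assms(2) inj by (simp add: card_image inj_on_subset[of _ UNIV])
qed

lemma Collect_odd_refl_Nil: "Collect (odd_refl []) = {}"
  by auto

lemma finite_odd_refl: "u \<in> lists X \<Longrightarrow> finite (Collect (odd_refl u))"
proof (induction u)
  case (Cons i u)
  then show ?case by (intro card_odd_refl_Cons(1)) auto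
qed (simp add: Collect_odd_refl_Nil)

lemma card_odd_refl_le: "u \<in> lists X \<Longrightarrow> card (Collect (odd_refl u)) \<le> length u"
proof (induction u)
  case (Cons i u)
  then show ?case using card_odd_refl_Cons(2)[of i u] finite_odd_refl[of u]
    by (simp del: odd_refl.simps)
qed (simp add: Collect_odd_refl_Nil)

lemma card_odd_refl_reduced: "reduced u \<Longrightarrow> card (Collect (odd_refl u)) = length u"
proof (induction u)
  case (Cons i u)
  have l: "i \<in> X" "u \<in> lists X" using Cons.prems by (auto simp: reduced_def)
  have "\<not> odd_refl u (r i)"
  proof
    assume "odd_refl u (r i)"
    then obtain k where k: "k < length u" "i # take k u \<sim> take (Suc k) u" using odd_refl_delete l by blast
    have d: "drop (Suc k) u \<in> lists X" "take k u \<in> lists X" using l by (auto simp: in_lists_conv_set dest: in_set_takeD in_set_dropD)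
    have "i # i # take k u \<sim> i # take (Suc k) u" using weq_Cons[OF l(1) k(2)] .
    from word_eq.trans[OF word_eq.sym[OF this] weq_Cons_cancel[OF l(1) d(2)]]
    have "i # take (Suc k) u \<sim> take k u" .
    then have "(i # take (Suc k) u) @ drop (Suc k) u \<sim> take k u @ drop (Suc k) u" using d by (intro weq_append)
    then have "i # u \<sim> take k u @ drop (Suc k) u" by simp
    with Cons.prems have "length (i # u) \<le> length (take k u @ drop (Suc k) u)" by (rule reduced_le)
    then show False using k(1) by simp
  qed
  then show ?case using card_odd_refl_Cons(3)[of i u] finite_odd_refl l Cons.IH reduced_Cons[OF Cons.prems]
    by (simp del: odd_refl.simps)
qed (simp add: Collect_odd_refl_Nil)

text \<open>If \<open>r i\<close> were not an odd reflection of u, then \<open>i # u\<close> would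
  have \<open>length u + 1\<close> of them. Their number depends only on the group element and is
  bounded by the length of any word for it, so no shorter word could exist.\<close>

lemma exchange:
  assumes "reduced u" "i \<in> X" "\<not> reduced (i # u)"
  shows "\<exists>k<length u. i # take k u \<sim> take (Suc k) u"
proof (rule odd_refl_delete)
  show u: "u \<in> lists X" using assms by (simp add: reduced_def)
  show "odd_refl u (r i)"
  proof (rule ccontr)
    assume "\<not> odd_refl u (r i)"
    then have c: "card (Collect (odd_refl (i # u))) = Suc (length u)"
      using card_odd_refl_Cons(3) finite_odd_refl u assms card_odd_refl_reduced
      by (simp del: odd_refl.simps)
    obtain v where v: "i # u \<sim> v" "length v < length (i # u)"
      using assms u by (auto simp: reduced_def not_le)
    have "Collect (odd_refl (i # u)) = Collect (odd_refl v)" using odd_refl_cong[OF v(1)] by (auto simp del: odd_refl.simps)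
    then show False using c card_odd_refl_le[of v] v word_eq_lists[OF v(1)] by simp
  qed
qed fact

lemma exchange_word:
  assumes "reduced u" "i \<in> X" "\<not> reduced (i # u)"
  shows "\<exists>k<length u. u \<sim> i # take k u @ drop (Suc k) u \<and> i # take k u \<sim> take (Suc k) u"
proof -
  obtain k where k: "k < length u" "i # take k u \<sim> take (Suc k) u" using exchange[OF assms] by blast
  have "drop (Suc k) u \<in> lists X" using assms by (auto simp: reduced_def in_lists_conv_set dest: in_set_dropD)
  from word_eq.sym[OF weq_append(2)[OF k(2) this]] show ?thesis using k by (intro exI[of _ k]) simp
qed

end

lemma length_alternating [simp]: "length (alternating k i j) = k"
  by (induction k arbitrary: i j) auto

lemma set_alternating: "set (alternating k i j) \<subseteq> {i, j}"
  by (induction k arbitrary: i j) auto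

lemma take_alternating: "l \<le> k \<Longrightarrow> take l (alternating k i j) = alternating l i j"
proof (induction k arbitrary: l i j)
  case (Suc k)
  then show ?case by (cases l) auto
qed simp

lemma alternating_double:
  "concat (replicate k [i, j]) = alternating k i j @ rev (alternating k j i)"
proof (induction k arbitrary: i j)
  case (Suc k)
  have "j # concat (replicate k [i, j]) = concat (replicate k [j, i]) @ [j]" by (induction k) auto
  then show ?case using Suc[of j i] by simp
qed simp

context coxeter
begin

lemma alternating_lists: "i \<in> X \<Longrightarrow> j \<in> X \<Longrightarrow> alternating k i j \<in> lists X"
  using set_alternating[of k i j] by (auto simp: in_lists_conv_set)

lemma alternating_beq: "i \<in> X \<Longrightarrow> j \<in> X \<Longrightarrow> i \<noteq> j \<Longrightarrow> alternating (m i j) i j \<approx> alternating (m i j) j i"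
proof -
  assume ij: "i \<in> X" "j \<in> X" "i \<noteq> j"
  then have "(alternating (m i j) i j, alternating (m i j) j i) \<in> artin_rels" unfolding artin_rels_def by auto
  from word_eq.rel[OF this, of "[]" X "[]"] show ?thesis using ij by (simp add: alternating_lists)
qed

lemma alternating_weq: "i \<in> X \<Longrightarrow> j \<in> X \<Longrightarrow> alternating (m i j) i j \<sim> alternating (m i j) j i"
proof -
  assume ij: "i \<in> X" "j \<in> X"
  let ?a = "alternating (m i j) i j" and ?b = "alternating (m i j) j i"
  have "ev r ?a * ev r (rev ?b) = 1"
    using ev_r_rel[OF ij] unfolding ev_simps(3)[symmetric] alternating_double[symmetric]
    by (simp add: ev_concat_replicate)
  then have "ev r ?a * (ev r (rev ?b) * ev r ?b) = ev r ?b" by (simp add: mult.assoc[symmetric])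
  then have "ev r ?a = ev r ?b" using ij by (simp add: ev_rev(2) alternating_lists)
  then show ?thesis using ij by (simp add: ev_r_eq_iff alternating_lists)
qed

lemma beq_imp_weq: "u \<approx> v \<Longrightarrow> u \<sim> v"
proof (induction rule: word_eq.induct)
  case (rel u v a b)
  then obtain i j where "i \<in> X" "j \<in> X" "u = alternating (m i j) i j" "v = alternating (m i j) j i"
    unfolding artin_rels_def by auto
  then have "u \<sim> v" using alternating_weq by simp
  then show ?case using rel by (intro word_eq_context)
qed (auto intro: word_eq.refl word_eq.sym word_eq.trans)

lemma beq_length: "u \<approx> v \<Longrightarrow> length u = length v"
  by (induction rule: word_eq.induct) (auto simp: artin_rels_def)

lemma beq_reduced: "u \<approx> v \<Longrightarrow> reduced u \<Longrightarrow> reduced v"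
  using reduced_weq[OF _ beq_imp_weq] beq_length by simp

lemma not_reduced_transfer:
  assumes "\<not> reduced (i # u)" "i \<in> X" "u \<sim> w" "length w = length u"
  shows "\<not> reduced (i # w)"
proof
  assume "reduced (i # w)"
  then have "reduced (i # u)"
    using reduced_weq[OF _ weq_Cons[OF assms(2) word_eq.sym[OF assms(3)]]] assms(4) by simp
  then show False using assms(1) by simp
qed

lemma not_reduced_CC:
  assumes "i # u \<sim> v" "reduced (i # v)" "length v = Suc (length u)"
  shows False
proof -
  have i: "i \<in> X" "u \<in> lists X" using word_eq_lists(1)[OF assms(1)] by auto
  have "i # v \<sim> u"
    using word_eq.trans[OF weq_Cons[OF i(1) word_eq.sym[OF assms(1)]] weq_Cons_cancel[OF i]] .
  from reduced_le[OF assms(2) this] show False using assms(3) by simp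
qed

text \<open>If the deleted letter lay inside the prefix \<open>v\<close>, then \<open>b # v\<close> would not be reduced.\<close>

lemma exchange_after_prefix:
  assumes "reduced (v @ x)" "b \<in> X" "\<not> reduced (b # v @ x)" "reduced (b # v)"
  shows "\<exists>x'. v @ x \<sim> b # v @ x' \<and> length (b # v @ x') = length (v @ x)"
proof -
  obtain l where l: "l < length (v @ x)"
    "v @ x \<sim> b # take l (v @ x) @ drop (Suc l) (v @ x)"
    "b # take l (v @ x) \<sim> take (Suc l) (v @ x)"
    using exchange_word[OF assms(1-3)] by auto
  show ?thesis
  proof (cases "length v \<le> l")
    case True
    then have "v @ x \<sim> b # v @ (take (l - length v) x @ drop (Suc l) (v @ x))" using l(2) by simp
    then show ?thesis using True l(1) by (intro exI conjI) auto
  next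
    case False
    then have "b # take l v \<sim> take (Suc l) v" using l(3) by simp
    moreover have "reduced (b # take (Suc l) v)"
      using reduced_append(1)[of "b # take (Suc l) v" "drop (Suc l) v"] assms(4) by simp
    ultimately have False using False by (intro not_reduced_CC[of b "take l v" "take (Suc l) v"]) auto
    then show ?thesis ..
  qed
qed

text \<open>The exchange condition only deletes letters, so shortening a word over K stays within K;
  lengths in a parabolic subgroup are attained by its own generators.\<close>

lemma lists_reduced:
  assumes "v \<in> lists K" "K \<subseteq> X"
  shows "\<exists>v'\<in>lists K. reduced v' \<and> v \<sim> v'"
  using assms(1)
proof (induction v)
  case (Cons i v)
  then obtain v' where v': "v' \<in> lists K" "reduced v'" "v \<sim> v'" by auto
  have i: "i \<in> K" "i \<in> X" using Cons.hyps assms(2) by auto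
  have iv: "i # v \<sim> i # v'" using weq_Cons[OF i(2) v'(3)] .
  show ?case
  proof (cases "reduced (i # v')")
    case True
    then show ?thesis using iv v' i by (intro bexI[of _ "i # v'"]) auto
  next
    case False
    obtain l where l: "l < length v'" "v' \<sim> i # take l v' @ drop (Suc l) v'"
      using exchange_word[OF v'(2) i(2) False] by auto
    let ?z = "take l v' @ drop (Suc l) v'"
    have zK: "?z \<in> lists K" using v'(1) by (auto simp: in_lists_conv_set dest: in_set_takeD in_set_dropD)
    have zX: "?z \<in> lists X" using zK assms(2) by (auto simp: in_lists_conv_set)
    have "reduced (i # ?z)" using reduced_weq[OF v'(2) l(2)] l(1) by simp
    then have "reduced ?z" by (rule reduced_Cons)
    moreover have "i # v' \<sim> ?z"
      using word_eq.trans[OF weq_Cons[OF i(2) l(2)] weq_Cons_cancel[OF i(2) zX]] .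
    from word_eq.trans[OF iv this] have "i # v \<sim> ?z" .
    ultimately show ?thesis using zK by (intro bexI[of _ ?z] conjI)
  qed
next
  case Nil
  then show ?case by (intro bexI[of _ "[]"]) (auto simp: reduced_def word_eq.refl)
qed

text \<open>The prefix v is built up from its last letter. Each new letter does not lengthen the
  element, so some letter is exchanged for it, and reducedness of v forces the deleted letter to lie
  in the rest x. Hence w is at least as long as every element over K.\<close>

lemma reduced_prefix_of_longest:
  assumes "reduced w" "\<And>j. j \<in> K \<Longrightarrow> \<not> reduced (j # w)" "K \<subseteq> X" "v \<in> lists K" "reduced v"
  shows "\<exists>x. w \<sim> v @ x \<and> length (v @ x) = length w"
  using assms(4,5)
proof (induction v)
  case (Cons s v)
  obtain x where x: "w \<sim> v @ x" "length (v @ x) = length w"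
    using Cons reduced_Cons by auto
  have s: "s \<in> K" "s \<in> X" using Cons.hyps assms(3) by auto
  have red: "reduced (v @ x)" using reduced_weq[OF assms(1) x(1)] x(2) by simp
  have "\<not> reduced (s # v @ x)" using not_reduced_transfer[OF assms(2)[OF s(1)] s(2) x(1,2)] .
  from exchange_after_prefix[OF red s(2) this Cons.prems] obtain x'
    where x': "v @ x \<sim> s # v @ x'" "length (s # v @ x') = length (v @ x)" by auto
  show ?case using word_eq.trans[OF x(1) x'(1)] x'(2) x(2) by (intro exI[of _ x']) simp
next
  case Nil
  then show ?case using assms(1) by (intro exI[of _ w]) (simp add: reduced_def word_eq.refl)
qed

end

text \<open>The added assumption makes \<open>m i j\<close> the exact order of the product of two
  generators. The reflection representation will supply it.\<close>

locale coxeter_exact = coxeter +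
  assumes alternating_reduced: "i \<in> X \<Longrightarrow> j \<in> X \<Longrightarrow> i \<noteq> j \<Longrightarrow> reduced (alternating (m i j) i j)"
begin

lemma alternating_reduced_le:
  assumes "i \<in> X" "j \<in> X" "i \<noteq> j" "k \<le> m i j"
  shows "reduced (alternating k i j)"
proof -
  have "alternating (m i j) i j = alternating k i j @ drop k (alternating (m i j) i j)"
    using append_take_drop_id[of k "alternating (m i j) i j"] take_alternating[OF assms(4), of i j] by simp
  then show ?thesis using alternating_reduced[OF assms(1-3)] reduced_append(1) by metis
qed

text \<open>The two descents are exchanged to the front alternately. As long as the alternating word
  is reduced, the deleted letter comes from the rest x. The letter in front changes at each step,
  hence the unordered pair.\<close>

lemma alternating_prefix:
  assumes "reduced u" "i \<in> X" "j \<in> X" "i \<noteq> j" "\<not> reduced (i # u)" "\<not> reduced (j # u)" "k \<le> m i j"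
  shows "\<exists>a b x. {a, b} = {i, j} \<and> u \<sim> alternating k a b @ x \<and> length (alternating k a b @ x) = length u"
  using assms(7)
proof (induction k)
  case 0
  have "u \<sim> u" using assms(1) by (simp add: reduced_def word_eq.refl)
  then show ?case by (intro exI[of _ i] exI[of _ j] exI[of _ u]) simp
next
  case (Suc k)
  then obtain a b x where ab: "{a, b} = {i, j}" and w: "u \<sim> alternating k a b @ x"
    "length (alternating k a b @ x) = length u" by auto
  have b: "a \<in> X" "b \<in> X" "a \<noteq> b" "\<not> reduced (b # u)" "m b a = m i j"
    using ab assms by (auto simp: doubleton_eq_iff m_sym)
  have red: "reduced (alternating k a b @ x)" using reduced_weq[OF assms(1) w(1)] w(2) by simp
  have alt: "reduced (b # alternating k a b)"
    using alternating_reduced_le[of b a "Suc k"] b Suc.prems by simp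
  have "\<not> reduced (b # alternating k a b @ x)" using not_reduced_transfer[OF b(4,2) w] .
  from exchange_after_prefix[OF red b(2) this alt] obtain x' where
    x': "alternating k a b @ x \<sim> b # alternating k a b @ x'"
    "length (b # alternating k a b @ x') = length (alternating k a b @ x)" by auto
  have "{b, a} = {i, j}" using ab by auto
  then show ?case using word_eq.trans[OF w(1) x'(1)] x'(2) w(2)
    by (intro exI[of _ b] exI[of _ a] exI[of _ x']) simp
qed

text \<open>Words with the same first letter are handled by induction on the length. If the first
  letters i and j differ, both are descents, so the element has an expression beginning with the
  alternating word of length \<open>m i j\<close>. Its two forms differ by one braid relation; one
  shares its first letter with u, the other with v.\<close>

theorem matsumoto:
  assumes "reduced u" "reduced v" "u \<sim> v"
  shows "u \<approx> v"
  using assms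
proof (induction "length u" arbitrary: u v rule: less_induct)
  case (less u v)
  have len: "length u = length v" using reduced_weq_length less.prems by simp
  have Cons_case: "i # u' \<approx> i # v'"
    if "i # u' \<sim> i # v'" "reduced (i # u')" "reduced (i # v')" "length (i # u') = length u" for i u' v'
  proof -
    have i: "i \<in> X" "u' \<in> lists X" "v' \<in> lists X" using that(2,3) by (auto simp: reduced_def)
    have "i # i # u' \<sim> i # i # v'" using weq_Cons[OF i(1) that(1)] .
    then have "u' \<sim> v'"
      using weq_Cons_cancel[OF i(1,2)] weq_Cons_cancel[OF i(1,3)] word_eq.sym word_eq.trans by metis
    then have "u' \<approx> v'" using less.hyps[of u' v'] that reduced_Cons by simp
    then show ?thesis using word_eq_context[of X artin_rels u' v' "[i]" "[]"] i by simp
  qed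
  show ?case
  proof (cases u)
    case Nil
    then show ?thesis using len by (simp add: word_eq.refl)
  next
    case (Cons i u')
    then obtain j v' where v: "v = j # v'" using len by (cases v) auto
    have X: "i \<in> X" "j \<in> X" "u' \<in> lists X" "v' \<in> lists X"
      using less.prems Cons v by (auto simp: reduced_def)
    show ?thesis
    proof (cases "i = j")
      case True
      then show ?thesis using Cons_case[of i u' v'] less.prems Cons v by simp
    next
      case False
      have "\<not> reduced (i # u)"
        using reduced_le[of "i # u" u'] weq_Cons_cancel[OF X(1,3)] Cons by auto
      moreover have "\<not> reduced (j # u)"
      proof
        assume "reduced (j # u)"
        moreover have "j # u \<sim> v'"
          using word_eq.trans[OF weq_Cons[OF X(2) less.prems(3)[unfolded v]] weq_Cons_cancel[OF X(2,4)]] .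
        ultimately show False using reduced_le[of "j # u" v'] len v by simp
      qed
      ultimately obtain a b x where ab: "{a, b} = {i, j}"
        and w: "u \<sim> alternating (m i j) a b @ x" "length (alternating (m i j) a b @ x) = length u"
        using alternating_prefix[OF less.prems(1) X(1,2) False, of "m i j"] by auto
      let ?p = "alternating (m i j) i j @ x" and ?q = "alternating (m i j) j i @ x"
      have xl: "x \<in> lists X" using word_eq_lists(2)[OF w(1)] by simp
      have pq: "?p \<approx> ?q"
        using word_eq_append[OF alternating_beq[OF X(1,2) False] word_eq.refl[OF xl]] .
      have up: "u \<sim> ?p" "u \<sim> ?q"
        using ab w(1) word_eq.trans[OF w(1)] beq_imp_weq[OF pq] word_eq.sym[OF beq_imp_weq[OF pq]]
        by (auto simp: doubleton_eq_iff)
      have lp: "length ?p = length u" "length ?q = length u" using w(2) by simp_all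
      have red: "reduced ?p" "reduced ?q" using reduced_weq[OF less.prems(1)] up lp by simp_all
      obtain k where k: "m i j = Suc k" using m_pos[of i j] gr0_conv_Suc by auto
      have "u \<approx> ?p"
        using Cons_case[of i u' "alternating k j i @ x"] up lp red less.prems Cons by (simp add: k)
      moreover have "?q \<approx> v"
      proof -
        have "?q \<sim> v" using word_eq.trans[OF word_eq.sym[OF up(2)] less.prems(3)] .
        then show ?thesis
          using Cons_case[of j "alternating k i j @ x" v'] lp red less.prems v by (simp add: k)
      qed
      ultimately show ?thesis using word_eq.trans pq by metis
    qed
  qed
qed

end

lemma group_presented:
  assumes "\<And>u. u \<in> lists X \<Longrightarrow> \<exists>v \<in> lists X. word_eq X R (v @ u) []"
  shows "group (presented_monoid X R)"
proof (rule groupI)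
  interpret monoid "presented_monoid X R" by (rule monoid_presented)
  show "x \<otimes>\<^bsub>presented_monoid X R\<^esub> y \<in> carrier (presented_monoid X R)"
    if "x \<in> carrier (presented_monoid X R)" "y \<in> carrier (presented_monoid X R)" for x y
    using that by (rule m_closed)
  show "\<one>\<^bsub>presented_monoid X R\<^esub> \<in> carrier (presented_monoid X R)" by (rule one_closed)
  show "x \<otimes>\<^bsub>presented_monoid X R\<^esub> y \<otimes>\<^bsub>presented_monoid X R\<^esub> z
      = x \<otimes>\<^bsub>presented_monoid X R\<^esub> (y \<otimes>\<^bsub>presented_monoid X R\<^esub> z)"
    if "x \<in> carrier (presented_monoid X R)" "y \<in> carrier (presented_monoid X R)"
      "z \<in> carrier (presented_monoid X R)" for x y z
    using that by (rule m_assoc)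
  show "\<one>\<^bsub>presented_monoid X R\<^esub> \<otimes>\<^bsub>presented_monoid X R\<^esub> x = x"
    if "x \<in> carrier (presented_monoid X R)" for x
    using that by (rule l_one)
  fix x assume "x \<in> carrier (presented_monoid X R)"
  then obtain u where u: "u \<in> lists X" "x = word_class X R u" by (rule presented_carrierE)
  obtain v where v: "v \<in> lists X" "word_eq X R (v @ u) []" using assms[OF u(1)] by auto
  then have "word_class X R v \<otimes>\<^bsub>presented_monoid X R\<^esub> x = \<one>\<^bsub>presented_monoid X R\<^esub>"
    using u by (simp add: word_class_eq_iff)
  then show "\<exists>y\<in>carrier (presented_monoid X R).
      y \<otimes>\<^bsub>presented_monoid X R\<^esub> x = \<one>\<^bsub>presented_monoid X R\<^esub>"
    using v by (intro bexI[of _ "word_class X R v"]) auto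
qed

section \<open>Lengths, longest elements and lifts in terms of words\<close>

locale dynkin_type = coxeter_exact "nodes t" "coxeter_entry t" for t
begin

notation weq (infix "\<sim>" 50) and beq (infix "\<approx>" 50)

abbreviation W where "W \<equiv> presented_monoid (nodes t) cox_rels"
abbreviation B where "B \<equiv> presented_monoid (nodes t) artin_rels"
abbreviation cW where "cW \<equiv> word_class (nodes t) cox_rels"
abbreviation cB where "cB \<equiv> word_class (nodes t) artin_rels"

lemma relations: "coxeter_relations t = cox_rels" "braid_relations t = artin_rels"
  by (simp_all add: coxeter_relations_def braid_relations_def cox_rels_def artin_rels_def)

lemma weyl_group_eq: "weyl_group t = W" and braid_monoid_eq: "braid_monoid t = B"
  and simple_refl_eq: "simple_refl t = (\<lambda>i. cW [i])" and braid_gen_eq: "braid_gen t = (\<lambda>i. cB [i])"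
  by (simp_all add: weyl_group_def braid_monoid_def simple_refl_def[abs_def] braid_gen_def[abs_def] relations)

lemma group_W: "group W"
proof (rule group_presented)
  fix u assume u: "u \<in> lists (nodes t)"
  then have v: "rev u \<in> lists (nodes t)" by (simp add: in_lists_conv_set)
  have "ev r (rev u @ u) = ev r []" using ev_rev(2)[OF u] by simp
  then show "\<exists>v\<in>lists (nodes t). v @ u \<sim> []"
    using u v by (subst (asm) ev_r_eq_iff) auto
qed

lemma inv_class:
  assumes u: "u \<in> lists (nodes t)"
  shows "inv\<^bsub>W\<^esub> (cW u) = cW (rev u)"
proof -
  interpret group W by (rule group_W)
  have v: "rev u \<in> lists (nodes t)" using u by (simp add: in_lists_conv_set)
  have "ev r (rev u @ u) = ev r []" using ev_rev(2)[OF u] by simp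
  then have "rev u @ u \<sim> []" using u v by (subst (asm) ev_r_eq_iff) auto
  then have "cW (rev u) \<otimes>\<^bsub>W\<^esub> cW u = \<one>\<^bsub>W\<^esub>" using u v by (simp add: word_class_eq_iff)
  then show ?thesis using u v by (intro inv_equality) auto
qed

lemma class_of_gens:
  "u \<in> lists (nodes t) \<Longrightarrow> list_prod (weyl_group t) (map (simple_refl t) u) = cW u"
  unfolding weyl_group_eq simple_refl_eq by (rule list_prod_word_class_gens)

lemma weyl_length_class:
  assumes "reduced u"
  shows "weyl_length t (cW u) = length u"
  unfolding weyl_length_def
proof (rule Least_equality)
  have u: "u \<in> lists (nodes t)" using assms by (simp add: reduced_def)
  then show "\<exists>ua\<in>lists (nodes t). length ua = length u \<and>
      list_prod (weyl_group t) (map (simple_refl t) ua) = cW u"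
    using class_of_gens by (intro bexI[of _ u]) auto
  fix k assume "\<exists>ua\<in>lists (nodes t). length ua = k \<and>
      list_prod (weyl_group t) (map (simple_refl t) ua) = cW u"
  then obtain v where v: "v \<in> lists (nodes t)" "length v = k" "cW v = cW u"
    using class_of_gens by auto
  then have "u \<sim> v" using u word_class_eq_iff by metis
  from reduced_le[OF assms this] show "length u \<le> k" using v(2) by simp
qed

lemma class_reducedE:
  assumes "w \<in> carrier W"
  obtains u where "reduced u" "w = cW u"
proof -
  obtain u where u: "u \<in> lists (nodes t)" "w = cW u" using assms by (rule presented_carrierE)
  obtain v where v: "reduced v" "u \<sim> v" using reduced_exists[OF u(1)] by auto
  then show thesis using that u word_class_eq_iff by metis
qed

text \<open>Braid relations preserve the length, so an idempotent has length 0. This forces the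
  canonical lift and the automorphisms of the braid monoid to preserve the identity.\<close>

lemma idempotent_B:
  assumes "x \<in> carrier B" "x \<otimes>\<^bsub>B\<^esub> x = x"
  shows "x = cB []"
proof -
  obtain u where u: "u \<in> lists (nodes t)" "x = cB u" using assms(1) by (rule presented_carrierE)
  then have "u @ u \<approx> u" using assms(2) by (simp add: word_class_eq_iff)
  from beq_length[OF this] show ?thesis using u by simp
qed

text \<open>The definite description requires existence and uniqueness. For existence a reduced word
  is chosen, and Matsumoto's theorem makes its braid class independent of the choice. For uniqueness
  the first letter of a reduced word is split off, a product along which lengths add.\<close>

lemma canonical_lift_class:
  assumes "reduced u"
  shows "canonical_lift t (cW u) = cB u"
proof -
  let ?P = "\<lambda>L. L \<in> carrier (weyl_group t) \<rightarrow>\<^sub>E carrier (braid_monoid t) \<and>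
       (\<forall>i \<in> nodes t. L (simple_refl t i) = braid_gen t i) \<and>
       (\<forall>v \<in> carrier (weyl_group t). \<forall>w \<in> carrier (weyl_group t).
          weyl_length t (v \<otimes>\<^bsub>weyl_group t\<^esub> w) = weyl_length t v + weyl_length t w \<longrightarrow>
          L (v \<otimes>\<^bsub>weyl_group t\<^esub> w) = L v \<otimes>\<^bsub>braid_monoid t\<^esub> L w)"
  define L where "L = restrict (\<lambda>w. cB (SOME u. reduced u \<and> w = cW u)) (carrier W)"
  have L: "L (cW v) = cB v" if v: "reduced v" for v
  proof -
    define v' where "v' = (SOME u. reduced u \<and> cW v = cW u)"
    have "\<exists>u. reduced u \<and> cW v = cW u" using v by auto
    then have v': "reduced v'" "cW v = cW v'" unfolding v'_def by (rule someI_ex[THEN conjunct1], rule someI_ex[THEN conjunct2])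
    have vl: "v \<in> lists (nodes t)" using v by (simp add: reduced_def)
    then have "v \<approx> v'" using matsumoto[OF v v'(1)] v'(2) by (simp add: word_class_eq_iff)
    then have "cB v = cB v'" using vl by (simp add: word_class_eq_iff)
    then show ?thesis using vl by (simp add: L_def v'_def)
  qed
  \<comment> \<open>All relators have even length, so a word equivalent to a single letter has odd
    length and is not empty.\<close>
  have red1: "reduced [i]" if i: "i \<in> nodes t" for i
  proof -
    obtain v where v: "reduced v" "[i] \<sim> v" using reduced_exists[of "[i]"] i by auto
    have "odd (length v)" using weq_parity[OF v(2)] by simp
    then have "length [i] \<le> length v" by (cases v) auto
    from reduced_weq[OF v(1) word_eq.sym[OF v(2)] this] show ?thesis .
  qed
  have lists_red: "u \<in> lists (nodes t)" if "reduced u" for u using that by (simp add: reduced_def)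
  have PL: "?P L"
    unfolding weyl_group_eq braid_monoid_eq simple_refl_eq braid_gen_eq
  proof (intro conjI ballI impI)
    have "L w \<in> carrier B" if "w \<in> carrier W" for w
      using that by (rule class_reducedE) (simp add: L lists_red)
    moreover have "L \<in> extensional (carrier W)" by (simp add: L_def)
    ultimately show "L \<in> carrier W \<rightarrow>\<^sub>E carrier B" by (auto simp: PiE_iff)
    show "L (cW [i]) = cB [i]" if "i \<in> nodes t" for i using L red1 that by simp
    fix v w assume vw: "v \<in> carrier W" "w \<in> carrier W"
      and add: "weyl_length t (v \<otimes>\<^bsub>W\<^esub> w) = weyl_length t v + weyl_length t w"
    obtain x where x: "reduced x" "v = cW x" using vw(1) by (rule class_reducedE)
    obtain y where y: "reduced y" "w = cW y" using vw(2) by (rule class_reducedE)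
    have xy: "v \<otimes>\<^bsub>W\<^esub> w = cW (x @ y)" using x y lists_red by simp
    obtain z where z: "reduced z" "x @ y \<sim> z" using reduced_exists[of "x @ y"] lists_red x y by auto
    have "cW (x @ y) = cW z" using z(2) lists_red x y by (simp add: word_class_eq_iff)
    then have "length z = length x + length y"
      using add weyl_length_class x y z(1) xy by simp
    then have "reduced (x @ y)" using reduced_weq[OF z(1) word_eq.sym[OF z(2)]] by simp
    then show "L (v \<otimes>\<^bsub>W\<^esub> w) = L v \<otimes>\<^bsub>B\<^esub> L w"
      unfolding xy using L x y lists_red by simp
  qed
  have unique: "M (cW v) = cB v" if M: "?P M" and v: "reduced v" for M v
    using v
  proof (induction v)
    case Nil
    note M' = M[unfolded weyl_group_eq braid_monoid_eq simple_refl_eq braid_gen_eq]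
    have len: "weyl_length t (cW []) = 0" using weyl_length_class[OF Nil] by simp
    have one: "cW [] \<in> carrier W" by simp
    have "weyl_length t (cW [] \<otimes>\<^bsub>W\<^esub> cW []) = weyl_length t (cW []) + weyl_length t (cW [])"
      using len by simp
    then have "M (cW [] \<otimes>\<^bsub>W\<^esub> cW []) = M (cW []) \<otimes>\<^bsub>B\<^esub> M (cW [])"
      using M' one by blast
    then have "M (cW []) \<otimes>\<^bsub>B\<^esub> M (cW []) = M (cW [])" by simp
    moreover have "M (cW []) \<in> carrier B" using M' one by (auto simp: PiE_iff)
    ultimately show ?case by (intro idempotent_B)
  next
    case (Cons i v)
    note M' = M[unfolded weyl_group_eq braid_monoid_eq simple_refl_eq braid_gen_eq]
    have i: "i \<in> nodes t" and vl: "v \<in> lists (nodes t)" using lists_red[OF Cons.prems] by auto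
    have v: "reduced v" using reduced_Cons[OF Cons.prems] .
    have mult: "cW [i] \<otimes>\<^bsub>W\<^esub> cW v = cW (i # v)" using i vl by simp
    have "weyl_length t (cW [i] \<otimes>\<^bsub>W\<^esub> cW v) = weyl_length t (cW [i]) + weyl_length t (cW v)"
      unfolding mult using weyl_length_class[OF v] weyl_length_class[OF Cons.prems]
        weyl_length_class[OF red1[OF i]] by simp
    moreover have "cW [i] \<in> carrier W" "cW v \<in> carrier W" using i vl by auto
    ultimately have "M (cW [i] \<otimes>\<^bsub>W\<^esub> cW v) = M (cW [i]) \<otimes>\<^bsub>B\<^esub> M (cW v)"
      using M' by blast
    moreover have "M (cW [i]) = cB [i]" using M' i by blast
    ultimately show ?case unfolding mult using Cons.IH[OF v] i vl by simp
  qed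
  have "canonical_lift t = L"
    unfolding canonical_lift_def
  proof (rule the_equality)
    show "?P L" by (rule PL)
    fix M assume M: "?P M"
    show "M = L"
    proof (rule extensionalityI)
      show "M \<in> extensional (carrier W)" using M by (auto simp: weyl_group_eq PiE_iff)
      show "L \<in> extensional (carrier W)" by (simp add: L_def)
      fix w assume "w \<in> carrier W"
      then obtain v where v: "reduced v" "w = cW v" by (rule class_reducedE)
      then show "M w = L w" using unique[OF M v(1)] L[OF v(1)] by simp
    qed
  qed
  then show ?thesis using L[OF assms] by simp
qed

lemma parabolic_eq:
  assumes "K \<subseteq> nodes t"
  shows "parabolic t K = cW ` lists K"
proof
  have sub: "u \<in> lists (nodes t)" if "u \<in> lists K" for u using that assms by (auto simp: in_lists_conv_set)
  show "parabolic t K \<subseteq> cW ` lists K"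
  proof
    fix w assume "w \<in> parabolic t K"
    then have "w \<in> generate W (simple_refl t ` K)" by (simp add: parabolic_def weyl_group_eq)
    then show "w \<in> cW ` lists K"
    proof induction
      case one
      then show ?case by (auto intro!: image_eqI[of _ _ "[]"])
    next
      case (incl h)
      then obtain i where "i \<in> K" "h = cW [i]" by (auto simp: simple_refl_eq)
      then show ?case by (auto intro!: image_eqI[of _ _ "[i]"])
    next
      case (inv h)
      then obtain i where i: "i \<in> K" "h = cW [i]" by (auto simp: simple_refl_eq)
      then have "inv\<^bsub>W\<^esub> h = cW [i]" using inv_class[of "[i]"] assms by auto
      then show ?case using i by (auto intro!: image_eqI[of _ _ "[i]"])
    next
      case (eng h1 h2)
      then obtain u v where uv: "u \<in> lists K" "v \<in> lists K" "h1 = cW u" "h2 = cW v" by blast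
      then have "h1 \<otimes>\<^bsub>W\<^esub> h2 = cW (u @ v)" using sub by simp
      then show ?case using uv by (intro image_eqI[of _ _ "u @ v"]) auto
    qed
  qed
  show "cW ` lists K \<subseteq> parabolic t K"
  proof
    fix w assume "w \<in> cW ` lists K"
    then obtain u where "u \<in> lists K" "w = cW u" by auto
    moreover have "cW u \<in> generate W (simple_refl t ` K)" if "u \<in> lists K" for u
      using that
    proof (induction u)
      case Nil
      show ?case using generate.one[of W "simple_refl t ` K"] by simp
    next
      case (Cons i u)
      have "cW [i] \<in> generate W (simple_refl t ` K)"
        using Cons.hyps by (intro generate.incl) (auto simp: simple_refl_eq)
      from generate.eng[OF this Cons.IH] have "cW [i] \<otimes>\<^bsub>W\<^esub> cW u \<in> generate W (simple_refl t ` K)" .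
      moreover have "i \<in> nodes t" "u \<in> lists (nodes t)" using Cons.hyps sub[of u] assms by auto
      then have "cW [i] \<otimes>\<^bsub>W\<^esub> cW u = cW (i # u)" by simp
      ultimately show ?case by simp
    qed
    ultimately show "w \<in> parabolic t K" by (simp add: parabolic_def weyl_group_eq)
  qed
qed

text \<open>The maximum is attained only once: a reduced word over K of the same length as w is a
  prefix of an expression of w with nothing left over.\<close>

lemma longest_element_class:
  assumes "K \<subseteq> nodes t" "reduced w" "w \<in> lists K" "\<And>j. j \<in> K \<Longrightarrow> \<not> reduced (j # w)"
  shows "longest_element t K = cW w"
  unfolding longest_element_def
proof (rule the_equality)
  have max: "\<exists>v'. v = cW v' \<and> reduced v' \<and> length v' \<le> length w \<and> (length v' = length w \<longrightarrow> v = cW w)"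
    if v: "v \<in> parabolic t K" for v
  proof -
    obtain u where u: "u \<in> lists K" "v = cW u" using v parabolic_eq[OF assms(1)] by auto
    obtain v' where v': "v' \<in> lists K" "reduced v'" "u \<sim> v'" using lists_reduced[OF u(1) assms(1)] by auto
    obtain x where x: "w \<sim> v' @ x" "length (v' @ x) = length w"
      using reduced_prefix_of_longest[OF assms(2,4,1) v'(1,2)] by auto
    have c: "v = cW v'" using u v' word_eq_lists(1)[OF v'(3)] by (simp add: word_class_eq_iff)
    moreover have "v = cW w" if "length v' = length w"
    proof -
      have "w \<sim> v'" using x that by simp
      moreover have "w \<in> lists (nodes t)" using assms(2) by (simp add: reduced_def)
      ultimately have "cW w = cW v'" by (simp add: word_class_eq_iff)
      then show ?thesis using c by simp
    qed
    ultimately show ?thesis using v' x by (intro exI[of _ v']) auto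
  qed
  have w: "cW w \<in> parabolic t K" using assms parabolic_eq by auto
  moreover have "weyl_length t v \<le> weyl_length t (cW w)" if "v \<in> parabolic t K" for v
    using max[OF that] weyl_length_class assms(2) by auto
  ultimately show "cW w \<in> parabolic t K \<and> (\<forall>v\<in>parabolic t K. weyl_length t v \<le> weyl_length t (cW w))"
    by blast
  fix v assume v: "v \<in> parabolic t K \<and> (\<forall>u\<in>parabolic t K. weyl_length t u \<le> weyl_length t v)"
  then obtain v' where v': "v = cW v'" "reduced v'" "length v' \<le> length w"
    "length v' = length w \<longrightarrow> v = cW w" using max by blast
  have "length w \<le> length v'" using v w v'(1,2) weyl_length_class assms(2) by metis
  then show "v = cW w" using v' by simp
qed

lemma simple_refl_inj:
  assumes "i \<in> nodes t" "j \<in> nodes t" "simple_refl t i = simple_refl t j" "1 < coxeter_entry t i j"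
  shows "i = j"
proof (rule ccontr)
  assume ij: "i \<noteq> j"
  have "[i] \<sim> [j]" using assms by (simp add: simple_refl_eq word_class_eq_iff)
  then have "[i, i] \<sim> [i, j]" using weq_Cons[OF assms(1)] by simp
  moreover have "[i, i] \<sim> []" using weq_Cons_cancel[of i "[]"] assms by simp
  ultimately have "[i, j] \<sim> []" using word_eq.sym word_eq.trans by metis
  moreover have "reduced [i, j]"
    using alternating_reduced_le[OF assms(1,2) ij, of 2] assms(4) by (simp add: numeral_2_eq_2)
  ultimately show False using reduced_le[of "[i, j]" "[]"] by simp
qed

abbreviation \<beta> where "\<beta> \<equiv> lmul (nodes t) artin_rels"

lemma app_beta: "u \<in> lists (nodes t) \<Longrightarrow> v \<in> lists (nodes t) \<Longrightarrow> app (ev \<beta> u) (cB v) = cB (u @ v)"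
  by (rule app_ev_lmul)

lemma beta_eq_iff:
  "u \<in> lists (nodes t) \<Longrightarrow> v \<in> lists (nodes t) \<Longrightarrow> ev \<beta> u = ev \<beta> v \<longleftrightarrow> u \<approx> v"
  by (rule ev_lmul_eq_iff)

lemma beta_relation:
  assumes "i \<in> nodes t" "j \<in> nodes t" "i \<noteq> j"
  shows "ev \<beta> (alternating (coxeter_entry t i j) i j) = ev \<beta> (alternating (coxeter_entry t i j) j i)"
  using alternating_beq[OF assms] alternating_lists assms by (simp add: beta_eq_iff)

lemma beta_relations:
  assumes "i \<in> nodes t" "j \<in> nodes t" "i \<noteq> j"
  shows "coxeter_entry t i j = 2 \<Longrightarrow> \<beta> i * \<beta> j = \<beta> j * \<beta> i"
    and "coxeter_entry t i j = 3 \<Longrightarrow> \<beta> i * \<beta> j * \<beta> i = \<beta> j * \<beta> i * \<beta> j"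
    and "coxeter_entry t i j = 4 \<Longrightarrow> \<beta> i * \<beta> j * \<beta> i * \<beta> j = \<beta> j * \<beta> i * \<beta> j * \<beta> i"
  using beta_relation[OF assms] by (simp_all add: numeral_eq_Suc mult.assoc)

lemma not_reduced_Cons:
  assumes "w \<approx> j # v"
  shows "\<not> reduced (j # w)"
proof
  assume r: "reduced (j # w)"
  have X: "j \<in> nodes t" "v \<in> lists (nodes t)" using word_eq_lists(2)[OF assms] by auto
  have "j # w \<sim> v"
    using word_eq.trans[OF weq_Cons[OF X(1) beq_imp_weq[OF assms]] weq_Cons_cancel[OF X]] .
  from reduced_le[OF r this] show False using beq_length[OF assms] by simp
qed

lemma lift_longest_element:
  assumes "K \<subseteq> nodes t" "reduced w" "w \<in> lists K" "\<And>j. j \<in> K \<Longrightarrow> \<exists>v. w \<approx> j # v"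
  shows "canonical_lift t (longest_element t K) = cB w"
proof -
  have "longest_element t K = cW w"
  proof (rule longest_element_class[OF assms(1-3)])
    fix j assume "j \<in> K"
    then obtain v where "w \<approx> j # v" using assms(4) by auto
    then show "\<not> reduced (j # w)" by (rule not_reduced_Cons)
  qed
  then show ?thesis using canonical_lift_class[OF assms(2)] by simp
qed

lemma seg_class:
  assumes "1 \<le> b" "a \<le> rank t"
  shows "seg t a b = cW (rev [b..<Suc a])"
proof -
  have "rev [b..<Suc a] \<in> lists (nodes t)" using assms by (auto simp: in_lists_conv_set nodes_def simp del: upt_Suc)
  then show ?thesis unfolding seg_def by (rule class_of_gens)
qed

lemma longest_product_class:
  assumes "\<And>i. i \<in> {1..l} \<Longrightarrow> canonical_lift t (longest_element t (K i)) = cB (f i)"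
    "\<And>i. i \<in> {1..l} \<Longrightarrow> f i \<in> lists (nodes t)"
  shows "longest_product t l K e = cB (concat (map (\<lambda>i.
      concat (replicate (if i = 1 then e 1 else e i - e (i - 1)) (f i))) [1..<Suc l]))"
proof -
  let ?k = "\<lambda>i. if i = 1 then e 1 else e i - e (i - 1)"
  have "map (\<lambda>i. canonical_lift t (longest_element t (K i)) [^]\<^bsub>B\<^esub> ?k i) [1..<Suc l]
      = map (\<lambda>i. cB (concat (replicate (?k i) (f i)))) [1..<Suc l]"
  proof (rule map_cong[OF HOL.refl])
    fix i assume "i \<in> set [1..<Suc l]"
    then have i: "i \<in> {1..l}" by auto
    show "canonical_lift t (longest_element t (K i)) [^]\<^bsub>B\<^esub> ?k i = cB (concat (replicate (?k i) (f i)))"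
      unfolding assms(1)[OF i] by (rule presented_pow[OF assms(2)[OF i]])
  qed
  moreover have "concat (replicate (?k i) (f i)) \<in> lists (nodes t)" if "i \<in> set [1..<Suc l]" for i
    using assms(2)[of i] that by (auto simp: in_lists_conv_set simp del: upt_Suc)
  ultimately show ?thesis
    unfolding longest_product_def braid_monoid_eq
    by (simp only: list_prod_map_word_class)
qed

end

section \<open>The action of a diagram automorphism on the braid monoid\<close>

locale dynkin_aut = dynkin_type +
  fixes p q :: "nat \<Rightarrow> nat" and \<sigma>
  assumes p: "i \<in> nodes t \<Longrightarrow> p i \<in> nodes t \<and> q (p i) = i"
    and q: "i \<in> nodes t \<Longrightarrow> q i \<in> nodes t \<and> p (q i) = i"
    and entry: "i \<in> nodes t \<Longrightarrow> j \<in> nodes t \<Longrightarrow> coxeter_entry t (p i) (p j) = coxeter_entry t i j"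
    and sigma: "i \<in> nodes t \<Longrightarrow> \<sigma> (simple_refl t i) = simple_refl t (p i)"
    and entry_gt: "i \<in> nodes t \<Longrightarrow> j \<in> nodes t \<Longrightarrow> i \<noteq> j \<Longrightarrow> 1 < coxeter_entry t i j"
begin

lemma map_alternating: "map f (alternating k i j) = alternating k (f i) (f j)"
  by (induction k arbitrary: i j) auto

lemma map_lists: "u \<in> lists (nodes t) \<Longrightarrow> map p u \<in> lists (nodes t)"
  "u \<in> lists (nodes t) \<Longrightarrow> map q u \<in> lists (nodes t)"
  using p q by (auto simp: in_lists_conv_set)

lemma map_cancel: "u \<in> lists (nodes t) \<Longrightarrow> map q (map p u) = u"
  "u \<in> lists (nodes t) \<Longrightarrow> map p (map q u) = u"
  using p q by (auto simp: in_lists_conv_set intro!: map_idI)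

lemma beq_map:
  assumes f: "\<And>i. i \<in> nodes t \<Longrightarrow> f i \<in> nodes t" "inj_on f (nodes t)"
    "\<And>i j. i \<in> nodes t \<Longrightarrow> j \<in> nodes t \<Longrightarrow> coxeter_entry t (f i) (f j) = coxeter_entry t i j"
  shows "u \<approx> v \<Longrightarrow> map f u \<approx> map f v"
proof (induction rule: word_eq.induct)
  case (refl u)
  then show ?case using f(1) by (intro word_eq.refl) (auto simp: in_lists_conv_set)
next
  case (sym u v)
  show ?case using sym(2) by (rule word_eq.sym)
next
  case (trans u v w)
  show ?case using trans(3,4) by (rule word_eq.trans)
next
  case (rel u v a b)
  then obtain i j where ij: "i \<in> nodes t" "j \<in> nodes t" "i \<noteq> j"
    and uv: "u = alternating (coxeter_entry t i j) i j" "v = alternating (coxeter_entry t i j) j i"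
    unfolding artin_rels_def by auto
  have "f i \<noteq> f j" using f(2) ij by (auto simp: inj_on_def)
  then have "alternating (coxeter_entry t i j) (f i) (f j) \<approx> alternating (coxeter_entry t i j) (f j) (f i)"
    using alternating_beq[of "f i" "f j"] f(1,3) ij by simp
  then have "map f u \<approx> map f v" by (simp add: uv map_alternating)
  moreover have "map f a \<in> lists (nodes t)" "map f b \<in> lists (nodes t)"
    using rel f(1) by (auto simp: in_lists_conv_set)
  ultimately have "map f a @ map f u @ map f b \<approx> map f a @ map f v @ map f b"
    by (intro word_eq_context)
  then show ?case by simp
qed

lemma beq_map_p: "u \<approx> v \<Longrightarrow> map p u \<approx> map p v"
proof (rule beq_map)
  show "inj_on p (nodes t)" by (rule inj_on_inverseI[of _ q]) (use p in auto)
qed (use p entry in auto)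

lemma beq_map_q: "u \<approx> v \<Longrightarrow> map q u \<approx> map q v"
proof (rule beq_map)
  show "inj_on q (nodes t)" by (rule inj_on_inverseI[of _ p]) (use q in auto)
  show "coxeter_entry t (q i) (q j) = coxeter_entry t i j" if "i \<in> nodes t" "j \<in> nodes t" for i j
    using entry[of "q i" "q j"] q that by simp
qed (use q in auto)

text \<open>Relabelling by \<open>p\<close> respects the braid relations and is inverted by
  relabelling with \<open>q\<close>. To compare with \<sigma>, the label \<open>p i\<close> is
  recovered from the simple reflection, distinct nodes having distinct reflections; uniqueness then
  follows letter by letter.\<close>

lemma braid_aut_class:
  assumes "u \<in> lists (nodes t)"
  shows "braid_aut t \<sigma> (cB u) = cB (map p u)"
proof -
  let ?P = "\<lambda>\<tau>. \<tau> \<in> iso (braid_monoid t) (braid_monoid t) \<and>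
       \<tau> \<in> extensional (carrier (braid_monoid t)) \<and>
       (\<forall>i \<in> nodes t. \<forall>j \<in> nodes t.
          \<sigma> (simple_refl t i) = simple_refl t j \<longrightarrow> \<tau> (braid_gen t i) = braid_gen t j)"
  define T where "T = restrict (\<lambda>x. cB (map p (SOME u. u \<in> lists (nodes t) \<and> x = cB u))) (carrier B)"
  have T: "T (cB v) = cB (map p v)" if v: "v \<in> lists (nodes t)" for v
  proof -
    define v' where "v' = (SOME u. u \<in> lists (nodes t) \<and> cB v = cB u)"
    have "\<exists>u. u \<in> lists (nodes t) \<and> cB v = cB u" using v by auto
    then have v': "v' \<in> lists (nodes t) \<and> cB v = cB v'" unfolding v'_def by (rule someI_ex)
    then have "v \<approx> v'" using v by (simp add: word_class_eq_iff)
    then have "map p v \<approx> map p v'" by (rule beq_map_p)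
    then have "cB (map p v) = cB (map p v')" using v map_lists by (simp add: word_class_eq_iff)
    then show ?thesis using v by (simp add: T_def v'_def)
  qed
  have "?P T"
    unfolding braid_monoid_eq
  proof (intro conjI ballI impI)
    show "T \<in> extensional (carrier B)" by (simp add: T_def)
    have closed: "T x \<in> carrier B" if "x \<in> carrier B" for x
      using that by (rule presented_carrierE) (simp add: T map_lists)
    have hom: "T (x \<otimes>\<^bsub>B\<^esub> y) = T x \<otimes>\<^bsub>B\<^esub> T y" if x: "x \<in> carrier B" and y: "y \<in> carrier B" for x y
    proof -
      obtain u where u: "u \<in> lists (nodes t)" "x = cB u" using x by (rule presented_carrierE)
      obtain v where v: "v \<in> lists (nodes t)" "y = cB v" using y by (rule presented_carrierE)
      have "cB u \<otimes>\<^bsub>B\<^esub> cB v = cB (u @ v)" using u v by simp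
      moreover have "T (cB (u @ v)) = cB (map p u @ map p v)" using T[of "u @ v"] u v by simp
      ultimately show ?thesis using u v T map_lists by simp
    qed
    have inj: "inj_on T (carrier B)"
    proof (rule inj_onI)
      fix x y assume x: "x \<in> carrier B" and y: "y \<in> carrier B" and e: "T x = T y"
      obtain u where u: "u \<in> lists (nodes t)" "x = cB u" using x by (rule presented_carrierE)
      obtain v where v: "v \<in> lists (nodes t)" "y = cB v" using y by (rule presented_carrierE)
      have "map p u \<approx> map p v" using e u v T map_lists by (simp add: word_class_eq_iff)
      then have "map q (map p u) \<approx> map q (map p v)" by (rule beq_map_q)
      then have "u \<approx> v" using map_cancel(1) u(1) v(1) by metis
      then show "x = y" using u v by (simp add: word_class_eq_iff)
    qed
    have surj: "T ` carrier B = carrier B"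
    proof
      show "T ` carrier B \<subseteq> carrier B" using closed by auto
      show "carrier B \<subseteq> T ` carrier B"
      proof
        fix x assume "x \<in> carrier B"
        then obtain u where u: "u \<in> lists (nodes t)" "x = cB u" by (rule presented_carrierE)
        have "T (cB (map q u)) = x" using T[of "map q u"] map_lists(2) map_cancel(2) u by metis
        moreover have "cB (map q u) \<in> carrier B" using map_lists(2) u by simp
        ultimately show "x \<in> T ` carrier B" by (intro image_eqI[of _ _ "cB (map q u)"]) auto
      qed
    qed
    show "T \<in> iso B B" using closed hom inj surj by (auto simp: iso_def hom_def bij_betw_def)
    fix i j assume ij: "i \<in> nodes t" "j \<in> nodes t" "\<sigma> (simple_refl t i) = simple_refl t j"
    then have "p i = j" using simple_refl_inj[of "p i" j] sigma[of i] p[of i] entry_gt[of "p i" j] by auto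
    then show "T (braid_gen t i) = braid_gen t j" using T[of "[i]"] ij by (simp add: braid_gen_eq)
  qed
  moreover have "M = T" if M: "?P M" for M
  proof (rule extensionalityI)
    note M' = M[unfolded braid_monoid_eq]
    show "M \<in> extensional (carrier B)" using M' by auto
    show "T \<in> extensional (carrier B)" by (simp add: T_def)
    have hom: "M (x \<otimes>\<^bsub>B\<^esub> y) = M x \<otimes>\<^bsub>B\<^esub> M y" "M x \<in> carrier B"
      if "x \<in> carrier B" "y \<in> carrier B" for x y
      using M' that by (auto simp: iso_def hom_def Pi_iff)
    have "M (cB u) = cB (map p u)" if "u \<in> lists (nodes t)" for u
      using that
    proof (induction u)
      case Nil
      have 1: "M (cB []) \<otimes>\<^bsub>B\<^esub> M (cB []) = M (cB [])" using hom(1)[of "cB []" "cB []"] by simp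
      have 2: "M (cB []) \<in> carrier B" using hom(2)[of "cB []" "cB []"] by simp
      show ?case using idempotent_B[OF 2 1] by simp
    next
      case (Cons i u)
      have "M (cB [i] \<otimes>\<^bsub>B\<^esub> cB u) = M (cB [i]) \<otimes>\<^bsub>B\<^esub> M (cB u)"
        using Cons.hyps by (intro hom(1)) auto
      moreover have "M (cB [i]) = cB [p i]"
        using M' sigma[OF Cons.hyps(1)] p[OF Cons.hyps(1)] Cons.hyps(1) by (simp add: braid_gen_eq)
      ultimately show ?case using Cons p[OF Cons.hyps(1)] map_lists[of u] by simp
    qed
    note M_class = this
    show "M x = T x" if "x \<in> carrier B" for x
      using that by (rule presented_carrierE) (simp add: T M_class)
  qed
  ultimately have "braid_aut t \<sigma> = T" unfolding braid_aut_def by (rule the_equality)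
  then show ?thesis using T[OF assms] by simp
qed

definition S :: "nat list set endo" where
  "S = Endo (\<lambda>x. if x \<in> carrier B then braid_aut t \<sigma> x else x)"

lemma app_S: "u \<in> lists (nodes t) \<Longrightarrow> app S (cB u) = cB (map p u)"
  by (simp add: S_def braid_aut_class)

lemma S_beta: "i \<in> nodes t \<Longrightarrow> S * \<beta> i = \<beta> (p i) * S"
proof (rule endo_eqI)
  fix x assume i: "i \<in> nodes t"
  show "app (S * \<beta> i) x = app (\<beta> (p i) * S) x"
  proof (cases "x \<in> carrier B")
    case True
    then obtain u where u: "u \<in> lists (nodes t)" "x = cB u" by (rule presented_carrierE)
    have "app (ev \<beta> [i]) (cB u) = cB (i # u)" "app (ev \<beta> [p i]) (cB (map p u)) = cB (p i # map p u)"
      using app_beta[of "[i]" u] app_beta[of "[p i]" "map p u"] u i p[OF i] map_lists by auto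
    then show ?thesis using u i app_S[of u] app_S[of "i # u"] by simp
  next
    case False
    then show ?thesis by (simp add: S_def lmul_def)
  qed
qed

text \<open>In a power of \<open>ev \<beta> u * S\<close> every \<open>S\<close> moves to the right
  and applies the automorphism to all copies of u that it passes; the class of the empty word
  absorbs what arrives at the end.\<close>

lemma app_twisted_power:
  assumes u: "u \<in> lists (nodes t)"
  shows "app ((ev \<beta> u * S) ^ k) (cB []) = twisted_power t \<sigma> (cB u) k"
proof -
  have l: "map (p ^^ j) u \<in> lists (nodes t)" for j
    by (induction j) (use u p in \<open>auto simp: in_lists_conv_set\<close>)
  have iter: "(braid_aut t \<sigma> ^^ j) (cB u) = cB (map (p ^^ j) u)" for j
  proof (induction j)
    case (Suc j)
    then show ?case using braid_aut_class[OF l[of j]] by (simp add: comp_def)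
  qed simp
  let ?c = "\<lambda>k. concat (map (\<lambda>j. map (p ^^ j) u) [0..<k])"
  have cl: "?c k \<in> lists (nodes t)" for k using l by (auto simp: in_lists_conv_set)
  have "twisted_power t \<sigma> (cB u) k = cB (?c k)"
    unfolding twisted_power_def iter braid_monoid_eq using l by (rule list_prod_map_word_class)
  moreover have "app ((ev \<beta> u * S) ^ k) (cB []) = cB (?c k)"
  proof (induction k)
    case (Suc k)
    have "app ((ev \<beta> u * S) ^ Suc k) (cB []) = app (ev \<beta> u) (app S (cB (?c k)))" using Suc by simp
    also have "\<dots> = cB (u @ map p (?c k))" using app_S[OF cl[of k]] app_beta u map_lists(1)[OF cl[of k]] by simp
    also have "u @ map p (?c k) = ?c (Suc k)"
      by (simp add: map_concat upt_rec[of 0] map_Suc_upt[symmetric] comp_def del: upt_Suc)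
    finally show ?case .
  qed simp
  ultimately show ?thesis by simp
qed

end

section \<open>The reflection representation and reduced words\<close>

definition swap_at :: "nat \<Rightarrow> (nat \<Rightarrow> int) \<Rightarrow> nat \<Rightarrow> int" where
  "swap_at i x = x(i := x (Suc i), Suc i := x i)"

text \<open>Signed permutations of coordinates, acting on integer points instead of roots; a root is
  a linear form whose sign at a point is tested.\<close>

fun act :: "dynkin \<Rightarrow> nat \<Rightarrow> (nat \<Rightarrow> int) \<Rightarrow> nat \<Rightarrow> int" where
  "act (TypeA n) i x = swap_at i x"
| "act (TypeB n) i x = (if i = n then x(n := - x n) else swap_at i x)"
| "act (TypeD n) i x = (if i = n then x(n - 1 := - x n, n := - x (n - 1)) else swap_at i x)"

text \<open>A triple \<open>(a, b, e)\<close> encodes the root \<open>\<epsilon>\<^sub>a + e \<epsilon>\<^sub>b\<close>; the short roots \<open>\<epsilon>\<^sub>a\<close> of type B are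
  replaced by their multiples \<open>2 \<epsilon>\<^sub>a\<close>.\<close>

fun root_value :: "nat \<times> nat \<times> int \<Rightarrow> (nat \<Rightarrow> int) \<Rightarrow> int" where
  "root_value (a, b, e) x = x a + e * x b"

text \<open>In type A the forms \<open>x a + x b\<close> are counted along with the roots. Every
  swap of coordinates permutes them, so the change in the number of negative forms still comes from
  the simple root alone.\<close>

fun pos_roots :: "dynkin \<Rightarrow> (nat \<times> nat \<times> int) set" where
  "pos_roots (TypeA n) = {(a, b, e). 1 \<le> a \<and> a < b \<and> b \<le> n + 1 \<and> e \<in> {1, -1}}"
| "pos_roots (TypeB n) = {(a, b, e). 1 \<le> a \<and> b \<le> n \<and> (a < b \<and> e \<in> {1, -1} \<or> a = b \<and> e = 1)}"
| "pos_roots (TypeD n) = {(a, b, e). 1 \<le> a \<and> a < b \<and> b \<le> n \<and> e \<in> {1, -1}}"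

fun simple_root :: "dynkin \<Rightarrow> nat \<Rightarrow> nat \<times> nat \<times> int" where
  "simple_root (TypeA n) i = (i, Suc i, -1)"
| "simple_root (TypeB n) i = (if i = n then (n, n, 1) else (i, Suc i, -1))"
| "simple_root (TypeD n) i = (if i = n then (n - 1, n, 1) else (i, Suc i, -1))"

definition swap_index :: "nat \<Rightarrow> nat \<Rightarrow> nat" where
  "swap_index i j = (if j = i then Suc i else if j = Suc i then i else j)"

text \<open>Apart from the simple root itself, a root with index pair i, \<open>Suc i\<close> is a
  sum, which the swap fixes; leaving it alone keeps the indices in increasing order.\<close>

definition swap_root :: "nat \<Rightarrow> nat \<times> nat \<times> int \<Rightarrow> nat \<times> nat \<times> int" where
  "swap_root i = (\<lambda>(a, b, e). if a = i \<and> b = Suc i then (a, b, e)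
      else (swap_index i a, swap_index i b, e))"

fun act_root :: "dynkin \<Rightarrow> nat \<Rightarrow> nat \<times> nat \<times> int \<Rightarrow> nat \<times> nat \<times> int" where
  "act_root (TypeA n) i \<gamma> = swap_root i \<gamma>"
| "act_root (TypeB n) i (a, b, e) = (if i = n then (if a < n \<and> b = n then (a, b, - e) else (a, b, e))
    else swap_root i (a, b, e))"
| "act_root (TypeD n) i (a, b, e) = (if i = n then
      (if a < n - 1 \<and> b = n - 1 then (a, n, - e)
       else if a < n - 1 \<and> b = n then (a, n - 1, - e) else (a, b, e))
    else swap_root i (a, b, e))"

text \<open>In type D both nodes n - 1 and n of the fork must exist.\<close>

fun valid :: "dynkin \<Rightarrow> bool" where
  "valid (TypeD n) = (2 \<le> n)"
| "valid t = True"

lemma finite_pos_roots: "finite (pos_roots t)"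
proof -
  have "finite ({..Suc (rank t)} \<times> {..Suc (rank t)} \<times> {1, -1 :: int})" by simp
  moreover have "pos_roots t \<subseteq> {..Suc (rank t)} \<times> {..Suc (rank t)} \<times> {1, -1}"
    by (cases t) auto
  ultimately show ?thesis by (rule finite_subset[rotated])
qed

lemma swap_root_mem:
  assumes "1 \<le> i" "Suc i \<le> N"
    "1 \<le> a \<and> b \<le> N \<and> (a < b \<and> e \<in> {1, -1} \<or> a = b \<and> e = 1) \<and> (a, b, e) \<noteq> (i, Suc i, -1)"
  shows "swap_root i (swap_root i (a, b, e)) = (a, b, e)"
    "root_value (a, b, e) (swap_at i x) = root_value (swap_root i (a, b, e)) x"
    "swap_root i (a, b, e) \<noteq> (i, Suc i, -1)"
    "case swap_root i (a, b, e) of (a', b', e') \<Rightarrow>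
      1 \<le> a' \<and> b' \<le> N \<and> (a < b \<longrightarrow> a' < b') \<and> (a = b \<longrightarrow> a' = b') \<and> e' = e"
  using assms by (auto simp: swap_root_def swap_at_def swap_index_def split: if_splits)

lemma act_root_props:
  assumes "valid t" "i \<in> nodes t" "\<gamma> \<in> pos_roots t - {simple_root t i}"
  shows "act_root t i \<gamma> \<in> pos_roots t - {simple_root t i} \<and> act_root t i (act_root t i \<gamma>) = \<gamma>
    \<and> root_value \<gamma> (act t i x) = root_value (act_root t i \<gamma>) x"
proof -
  obtain a b e where g: "\<gamma> = (a, b, e)" by (cases \<gamma>)
  show ?thesis
  proof (cases t)
    case (TypeA n)
    then show ?thesis using assms swap_root_mem[of i "Suc n" a b e]
      by (auto simp: g nodes_def)
  next
    case (TypeB n)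
    show ?thesis
    proof (cases "i = n")
      case True
      then show ?thesis using assms by (auto simp: g TypeB)
    next
      case False
      then show ?thesis using assms swap_root_mem[of i n a b e]
        by (cases "swap_root i (a, b, e)") (auto simp: g nodes_def TypeB)
    qed
  next
    case (TypeD n)
    show ?thesis
    proof (cases "i = n")
      case True
      then show ?thesis using assms by (auto simp: g TypeD)
    next
      case False
      then show ?thesis using assms swap_root_mem[of i n a b e]
        by (cases "swap_root i (a, b, e)") (auto simp: g nodes_def TypeD)
    qed
  qed
qed

lemma simple_root_props:
  assumes "valid t" "i \<in> nodes t"
  shows "simple_root t i \<in> pos_roots t"
    "root_value (simple_root t i) (act t i x) = - root_value (simple_root t i) x"
  using assms by (cases t; auto simp: nodes_def swap_at_def)+

section \<open>Inversions at a point as a lower bound for the length\<close>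

definition inversions :: "dynkin \<Rightarrow> (nat \<Rightarrow> int) \<Rightarrow> nat" where
  "inversions t x = card {\<gamma> \<in> pos_roots t. root_value \<gamma> x < 0}"

text \<open>The other positive roots are permuted, so only the sign of the simple root counts. With
  a correction on both sides the equation also covers the value 0, where nothing changes.\<close>

lemma inversions_act:
  assumes "valid t" "i \<in> nodes t"
  shows "inversions t (act t i x) + (if root_value (simple_root t i) x < 0 then 1 else 0)
    = inversions t x + (if root_value (simple_root t i) x > 0 then 1 else 0)"
proof -
  let ?s = "simple_root t i"
  define A where "A y = {\<gamma> \<in> pos_roots t - {?s}. root_value \<gamma> y < 0}" for y
  have fin: "finite (A y)" for y using finite_pos_roots by (simp add: A_def)
  have inv: "inversions t y = card (A y) + (if root_value ?s y < 0 then 1 else 0)" for y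
  proof -
    have "{\<gamma> \<in> pos_roots t. root_value \<gamma> y < 0} = A y \<union> (if root_value ?s y < 0 then {?s} else {})"
      using simple_root_props(1)[OF assms] by (auto simp: A_def)
    moreover have "?s \<notin> A y" by (simp add: A_def)
    ultimately show ?thesis using fin by (simp add: inversions_def)
  qed
  have "bij_betw (act_root t i) (A (act t i x)) (A x)"
  proof (rule bij_betw_byWitness[where f' = "act_root t i"])
    note P = act_root_props[OF assms]
    show "\<forall>a\<in>A (act t i x). act_root t i (act_root t i a) = a" using P by (simp add: A_def)
    show "\<forall>a\<in>A x. act_root t i (act_root t i a) = a" using P by (simp add: A_def)
    show "act_root t i ` A (act t i x) \<subseteq> A x"
    proof
      fix \<gamma> assume "\<gamma> \<in> act_root t i ` A (act t i x)"
      then obtain \<delta> where "\<delta> \<in> pos_roots t - {?s}" "root_value \<delta> (act t i x) < 0" "\<gamma> = act_root t i \<delta>"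
        by (auto simp: A_def)
      then show "\<gamma> \<in> A x" using P[of \<delta> x] by (simp add: A_def)
    qed
    show "act_root t i ` A x \<subseteq> A (act t i x)"
    proof
      fix \<gamma> assume "\<gamma> \<in> act_root t i ` A x"
      then obtain \<delta> where d: "\<delta> \<in> pos_roots t - {?s}" "root_value \<delta> x < 0" "\<gamma> = act_root t i \<delta>"
        by (auto simp: A_def)
      then have "\<gamma> \<in> pos_roots t - {?s}" "act_root t i \<gamma> = \<delta>" using P[of \<delta> x] by simp_all
      then show "\<gamma> \<in> A (act t i x)" using P[of \<gamma> x] d by (simp add: A_def)
    qed
  qed
  then have "card (A (act t i x)) = card (A x)" by (rule bij_betw_same_card)
  then show ?thesis using inv[of x] inv[of "act t i x"] simple_root_props(2)[OF assms] by auto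
qed

lemma swap_at_relations:
  "swap_at i (swap_at i x) = x"
  "j = Suc i \<or> i = Suc j \<Longrightarrow>
    swap_at i (swap_at j (swap_at i (swap_at j (swap_at i (swap_at j x))))) = x"
  "Suc i < j \<or> Suc j < i \<Longrightarrow> swap_at i (swap_at j (swap_at i (swap_at j x))) = x"
  by (auto simp: swap_at_def)

lemma act_relation:
  assumes "valid t" "i \<in> nodes t" "j \<in> nodes t"
  shows "foldr (act t) (concat (replicate (coxeter_entry t i j) [i, j])) x = x"
proof (cases t)
  case (TypeA n)
  consider "i = j" | "j = Suc i \<or> i = Suc j" | "Suc i < j \<or> Suc j < i" by linarith
  then show ?thesis
  proof cases
    case 1
    then show ?thesis by (simp add: TypeA swap_at_relations)
  next
    case 2
    then have "coxeter_entry t i j = 3" by (auto simp: TypeA)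
    then show ?thesis using swap_at_relations(2)[OF 2] by (simp add: TypeA numeral_eq_Suc)
  next
    case 3
    then have "coxeter_entry t i j = 2" by (auto simp: TypeA)
    then show ?thesis using swap_at_relations(3)[OF 3] by (simp add: TypeA numeral_eq_Suc)
  qed
next
  case (TypeB n)
  have le: "i \<le> n" "j \<le> n" using assms by (auto simp: nodes_def TypeB)
  consider "i = j" | "j = Suc i \<or> i = Suc j" | "Suc i < j \<or> Suc j < i" by linarith
  then show ?thesis
  proof cases
    case 1
    then show ?thesis by (simp add: TypeB swap_at_relations)
  next
    case 2
    show ?thesis
    proof (cases "i = n \<or> j = n")
      case True
      then have m: "coxeter_entry t i j = 4" using 2 by (auto simp: TypeB)
      consider "i = n" "n = Suc j" | "j = n" "n = Suc i" using True 2 le by linarith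
      then show ?thesis
      proof cases
        case 1
        show ?thesis unfolding m using 1 by (simp add: TypeB numeral_eq_Suc swap_at_def fun_upd_twist)
      next
        case 2
        show ?thesis unfolding m using 2 by (simp add: TypeB numeral_eq_Suc swap_at_def fun_upd_twist)
      qed
    next
      case False
      then have "coxeter_entry t i j = 3" using 2 by (auto simp: TypeB)
      then show ?thesis using False swap_at_relations(2)[OF 2] by (simp add: TypeB numeral_eq_Suc)
    qed
  next
    case 3
    then have m: "coxeter_entry t i j = 2" by (auto simp: TypeB)
    show ?thesis
    proof (cases "i = n \<or> j = n")
      case True
      then show ?thesis using 3 m le by (auto simp: TypeB numeral_eq_Suc swap_at_def fun_upd_twist)
    next
      case False
      then show ?thesis using m swap_at_relations(3)[OF 3] by (simp add: TypeB numeral_eq_Suc)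
    qed
  qed
next
  case (TypeD n)
  have le: "1 \<le> i" "1 \<le> j" "i \<le> n" "j \<le> n" "2 \<le> n" using assms by (auto simp: nodes_def TypeD)
  then obtain k where n: "n = Suc (Suc k)" by (metis add_2_eq_Suc le_Suc_ex)
  show ?thesis
  proof (cases "i \<noteq> n \<and> j \<noteq> n")
    case True
    then have ij: "i \<le> Suc k" "j \<le> Suc k" using le n by auto
    consider "i = j" | "j = Suc i \<or> i = Suc j" | "Suc i < j \<or> Suc j < i" by linarith
    then show ?thesis
    proof cases
      case 1
      then show ?thesis using True by (simp add: TypeD swap_at_relations)
    next
      case 2
      then have "coxeter_entry t i j = 3" using ij by (auto simp: TypeD n doubleton_eq_iff)
      then show ?thesis using True swap_at_relations(2)[OF 2] by (simp add: TypeD numeral_eq_Suc)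
    next
      case 3
      then have "coxeter_entry t i j = 2" using ij by (auto simp: TypeD n doubleton_eq_iff)
      then show ?thesis using True swap_at_relations(3)[OF 3] by (simp add: TypeD numeral_eq_Suc)
    qed
  next
    case False
    then consider "i = n" "j = n" | "i = n" "j = Suc k" | "i = Suc k" "j = n" | "i = n" "j = k" | "i = k" "j = n"
      | "i = n" "j < k" | "j = n" "i < k" using le n by linarith
    then show ?thesis
    proof cases
      case 1
      then show ?thesis by (simp add: TypeD n fun_upd_twist)
    next
      case 2
      then have "coxeter_entry t i j = 2" by (auto simp: TypeD n)
      then show ?thesis using 2 by (auto simp: TypeD n numeral_eq_Suc swap_at_def)
    next
      case 3
      then have "coxeter_entry t i j = 2" by (auto simp: TypeD n)
      then show ?thesis using 3 by (auto simp: TypeD n numeral_eq_Suc swap_at_def)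
    next
      case 4
      then have "coxeter_entry t i j = 3" by (auto simp: TypeD n doubleton_eq_iff)
      then show ?thesis using 4 by (auto simp: TypeD n numeral_eq_Suc swap_at_def)
    next
      case 5
      then have "coxeter_entry t i j = 3" by (auto simp: TypeD n doubleton_eq_iff)
      then show ?thesis using 5 by (auto simp: TypeD n numeral_eq_Suc swap_at_def)
    next
      case 6
      then have "coxeter_entry t i j = 2" by (auto simp: TypeD n doubleton_eq_iff)
      then show ?thesis using 6 by (auto simp: TypeD n numeral_eq_Suc swap_at_def fun_upd_twist)
    next
      case 7
      then have "coxeter_entry t i j = 2" by (auto simp: TypeD n doubleton_eq_iff)
      then show ?thesis using 7 by (auto simp: TypeD n numeral_eq_Suc swap_at_def fun_upd_twist)
    qed
  qed
qed

lemma act_word_eq: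
  assumes "valid t" "word_eq (nodes t) (coxeter_relations t) u v"
  shows "foldr (act t) u x = foldr (act t) v x"
  using assms(2)
proof (induction arbitrary: x rule: word_eq.induct)
  case (rel u v a b)
  then obtain i j where "i \<in> nodes t" "j \<in> nodes t"
    "u = concat (replicate (coxeter_entry t i j) [i, j])" "v = []"
    unfolding coxeter_relations_def by auto
  then show ?case using act_relation[OF assms(1)] by simp
qed auto

text \<open>Letters act from right to left, and each has to find its simple root positive, so that
  it creates an inversion. A single point x with this property certifies that the word is
  reduced.\<close>

fun ascending :: "dynkin \<Rightarrow> nat list \<Rightarrow> (nat \<Rightarrow> int) \<Rightarrow> bool" where
  "ascending t [] x = True"
| "ascending t (i # u) x = (ascending t u x \<and> 0 < root_value (simple_root t i) (foldr (act t) u x))"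

lemma ascending_append:
  "ascending t (u @ v) x \<longleftrightarrow> ascending t v x \<and> ascending t u (foldr (act t) v x)"
  by (induction u) auto

lemma inversions_le:
  assumes "valid t" "u \<in> lists (nodes t)"
  shows "inversions t (foldr (act t) u x) \<le> inversions t x + length u"
  using assms(2)
proof (induction u)
  case (Cons i u)
  then show ?case using inversions_act[OF assms(1), of i "foldr (act t) u x"] by (auto split: if_splits)
qed simp

lemma inversions_ascending:
  assumes "valid t" "u \<in> lists (nodes t)" "ascending t u x"
  shows "inversions t (foldr (act t) u x) = inversions t x + length u"
  using assms(2,3)
proof (induction u)
  case (Cons i u)
  then show ?case using inversions_act[OF assms(1), of i "foldr (act t) u x"] by (auto split: if_splits)
qed simp

text \<open>An equivalent word leads to the same point, and each of its letters adds at most one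
  inversion.\<close>

lemma ascending_shortest:
  assumes "valid t" "u \<in> lists (nodes t)" "ascending t u x"
    "word_eq (nodes t) (coxeter_relations t) u v"
  shows "length u \<le> length v"
  using inversions_ascending[OF assms(1-3)] inversions_le[OF assms(1) word_eq_lists(2)[OF assms(4)], of x]
    act_word_eq[OF assms(1,4), of x] by simp

text \<open>Strictly decreasing and positive up to the index \<open>rank t + 1\<close>, the last
  coordinate of type A: a point in the open fundamental chamber of each type.\<close>

definition generic :: "dynkin \<Rightarrow> nat \<Rightarrow> int" where
  "generic t j = int (rank t) + 2 - int j"

text \<open>Only the two or three coordinates at i and j, or the four of two disjoint swaps, are
  involved. This is the exactness of the orders on which Matsumoto's theorem was built.\<close>

lemma ascending_alternating:
  assumes "valid t" "i \<in> nodes t" "j \<in> nodes t" "i \<noteq> j"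
  shows "ascending t (alternating (coxeter_entry t i j) i j) (generic t)"
proof (cases t)
  case (TypeA n)
  consider "j = Suc i" | "i = Suc j" | "Suc i < j \<or> Suc j < i" using assms(4) by linarith
  then show ?thesis
  proof cases
    case 3
    then have "coxeter_entry t i j = 2" by (auto simp: TypeA)
    then show ?thesis using 3 by (auto simp: TypeA numeral_eq_Suc swap_at_def generic_def)
  qed (auto simp: TypeA numeral_eq_Suc swap_at_def generic_def)
next
  case (TypeB n)
  have le: "i \<le> n" "j \<le> n" using assms by (auto simp: nodes_def TypeB)
  consider "j = Suc i" "j = n" | "i = Suc j" "i = n" | "j = Suc i" "i \<noteq> n" "j \<noteq> n" | "i = Suc j" "i \<noteq> n" "j \<noteq> n"
    | "Suc i < j \<or> Suc j < i" using assms(4) le by linarith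
  then show ?thesis
  proof cases
    case 1
    then show ?thesis by (auto simp: TypeB numeral_eq_Suc swap_at_def generic_def)
  next
    case 2
    then show ?thesis by (auto simp: TypeB numeral_eq_Suc swap_at_def generic_def)
  next
    case 3
    then show ?thesis by (auto simp: TypeB numeral_eq_Suc swap_at_def generic_def)
  next
    case 4
    then show ?thesis by (auto simp: TypeB numeral_eq_Suc swap_at_def generic_def)
  next
    case 5
    then have "coxeter_entry t i j = 2" by (auto simp: TypeB)
    then show ?thesis using 5 le by (auto simp: TypeB numeral_eq_Suc swap_at_def generic_def)
  qed
next
  case (TypeD n)
  have le: "1 \<le> i" "1 \<le> j" "i \<le> n" "j \<le> n" "2 \<le> n" using assms by (auto simp: nodes_def TypeD)
  then obtain k where n: "n = Suc (Suc k)" by (metis add_2_eq_Suc le_Suc_ex)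
  show ?thesis
  proof (cases "i \<noteq> n \<and> j \<noteq> n")
    case True
    then have ij: "i \<le> Suc k" "j \<le> Suc k" using le n by auto
    consider "j = Suc i" | "i = Suc j" | "Suc i < j \<or> Suc j < i" using assms(4) by linarith
    then show ?thesis
    proof cases
      case 1
      then have "coxeter_entry t i j = 3" using ij by (auto simp: TypeD n doubleton_eq_iff)
      then show ?thesis using 1 ij by (auto simp: TypeD n numeral_eq_Suc swap_at_def generic_def)
    next
      case 2
      then have "coxeter_entry t i j = 3" using ij by (auto simp: TypeD n doubleton_eq_iff)
      then show ?thesis using 2 ij by (auto simp: TypeD n numeral_eq_Suc swap_at_def generic_def)
    next
      case 3
      then have "coxeter_entry t i j = 2" using ij by (auto simp: TypeD n doubleton_eq_iff)
      then show ?thesis using 3 ij by (auto simp: TypeD n numeral_eq_Suc swap_at_def generic_def)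
    qed
  next
    case False
    then consider "i = n" "j = Suc k" | "i = Suc k" "j = n" | "i = n" "j = k" | "i = k" "j = n"
      | "i = n" "j < k" | "j = n" "i < k" using le n assms(4) by linarith
    then show ?thesis
    proof cases
      case 1
      then have "coxeter_entry t i j = 2" by (auto simp: TypeD n)
      then show ?thesis using 1 by (auto simp: TypeD n numeral_eq_Suc swap_at_def generic_def)
    next
      case 2
      then have "coxeter_entry t i j = 2" by (auto simp: TypeD n)
      then show ?thesis using 2 by (auto simp: TypeD n numeral_eq_Suc swap_at_def generic_def)
    next
      case 3
      then have "coxeter_entry t i j = 3" by (auto simp: TypeD n doubleton_eq_iff)
      then show ?thesis using 3 by (auto simp: TypeD n numeral_eq_Suc swap_at_def generic_def)
    next
      case 4
      then have "coxeter_entry t i j = 3" by (auto simp: TypeD n doubleton_eq_iff)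
      then show ?thesis using 4 by (auto simp: TypeD n numeral_eq_Suc swap_at_def generic_def)
    next
      case 5
      then have "coxeter_entry t i j = 2" by (auto simp: TypeD n doubleton_eq_iff)
      then show ?thesis using 5 by (auto simp: TypeD n numeral_eq_Suc swap_at_def generic_def)
    next
      case 6
      then have "coxeter_entry t i j = 2" by (auto simp: TypeD n doubleton_eq_iff)
      then show ?thesis using 6 by (auto simp: TypeD n numeral_eq_Suc swap_at_def generic_def)
    qed
  qed
qed

lemma dynkin_type_valid:
  assumes "valid t"
  shows "dynkin_type t"
proof -
  have sym: "coxeter_entry t i j = coxeter_entry t j i" for i j by (cases t) (auto simp: insert_commute)
  interpret coxeter "nodes t" "coxeter_entry t"
    by unfold_locales (use sym in \<open>cases t; auto\<close>)+
  show ?thesis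
  proof (unfold_locales)
    fix i j assume ij: "i \<in> nodes t" "j \<in> nodes t" "i \<noteq> j"
    have cox_rels: "cox_rels = coxeter_relations t" by (simp add: cox_rels_def coxeter_relations_def)
    show "reduced (alternating (coxeter_entry t i j) i j)"
      unfolding reduced_def cox_rels
      using ascending_shortest[OF assms _ ascending_alternating[OF assms ij]] alternating_lists[OF ij(1,2)] by auto
  qed
qed

lemma (in dynkin_type) ascending_reduced:
  assumes "valid t" "u \<in> lists (nodes t)" "ascending t u x"
  shows "reduced u"
  unfolding reduced_def relations[symmetric] using ascending_shortest[OF assms] assms(2) by auto

section \<open>Reducedness of half twists and loops\<close>

definition swaps :: "dynkin \<Rightarrow> nat set \<Rightarrow> bool" where
  "swaps t K \<longleftrightarrow> (\<forall>i\<in>K. act t i = swap_at i \<and> simple_root t i = (i, Suc i, -1))"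

lemma swaps_A: "swaps (TypeA n) K"
  by (auto simp: swaps_def)

lemma swaps_B: "n \<notin> K \<Longrightarrow> swaps (TypeB n) K" and swaps_D: "n \<notin> K \<Longrightarrow> swaps (TypeD n) K"
  by (auto simp: swaps_def)

text \<open>The word carries the value at a to position c and moves the values in between back by
  one. Each letter tests the carried value against the next one, so it must be larger than all of
  them.\<close>

lemma act_desc:
  assumes "a \<le> c" "swaps t {a..<c}"
  shows "foldr (act t) (rev [a..<c]) x = (\<lambda>j. if a \<le> j \<and> j < c then x (Suc j) else if j = c then x a else x j)"
    "(\<And>j. a < j \<Longrightarrow> j \<le> c \<Longrightarrow> x j < x a) \<Longrightarrow> ascending t (rev [a..<c]) x"
proof -
  have "foldr (act t) (rev [a..<c]) x = (\<lambda>j. if a \<le> j \<and> j < c then x (Suc j) else if j = c then x a else x j)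
    \<and> ((\<forall>j. a < j \<and> j \<le> c \<longrightarrow> x j < x a) \<longrightarrow> ascending t (rev [a..<c]) x)"
    using assms
  proof (induction c rule: dec_induct)
    case (step c)
    then have "swaps t {a..<c}" "act t c = swap_at c" "simple_root t c = (c, Suc c, -1)" by (auto simp: swaps_def)
    then show ?case using step by (auto simp: swap_at_def fun_eq_iff)
  qed (auto simp: fun_eq_iff)
  then show "foldr (act t) (rev [a..<c]) x = (\<lambda>j. if a \<le> j \<and> j < c then x (Suc j) else if j = c then x a else x j)"
    "(\<And>j. a < j \<Longrightarrow> j \<le> c \<Longrightarrow> x j < x a) \<Longrightarrow> ascending t (rev [a..<c]) x" by auto
qed

lemma act_asc:
  assumes "a \<le> c" "swaps t {a..<c}"
  shows "foldr (act t) [a..<c] x = (\<lambda>j. if a < j \<and> j \<le> c then x (j - 1) else if j = a then x c else x j)"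
    "(\<And>j. a \<le> j \<Longrightarrow> j < c \<Longrightarrow> x c < x j) \<Longrightarrow> ascending t [a..<c] x"
proof -
  have "foldr (act t) [a..<c] x = (\<lambda>j. if a < j \<and> j \<le> c then x (j - 1) else if j = a then x c else x j)
    \<and> ((\<forall>j. a \<le> j \<and> j < c \<longrightarrow> x c < x j) \<longrightarrow> ascending t [a..<c] x)"
    using assms
  proof (induction a rule: inc_induct)
    case (step a)
    then have a: "swaps t {Suc a..<c}" "act t a = swap_at a" "simple_root t a = (a, Suc a, -1)" by (auto simp: swaps_def)
    have "[a..<c] = a # [Suc a..<c]" using step by (simp add: upt_conv_Cons)
    then show ?case using step a by (auto simp: swap_at_def fun_eq_iff)
  qed (auto simp: fun_eq_iff)
  then show "foldr (act t) [a..<c] x = (\<lambda>j. if a < j \<and> j \<le> c then x (j - 1) else if j = a then x c else x j)"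
    "(\<And>j. a \<le> j \<Longrightarrow> j < c \<Longrightarrow> x c < x j) \<Longrightarrow> ascending t [a..<c] x" by auto
qed

text \<open>The row acting first takes the largest value to the far end, out of reach of the other
  rows, which see the remaining values in decreasing order.\<close>

lemma ascending_half_twist:
  assumes "1 \<le> a" "\<And>j k. a \<le> j \<Longrightarrow> j < k \<Longrightarrow> k \<le> Suc b \<Longrightarrow> x k < x j"
  shows "ascending (TypeA n) (half_twist a b) x"
  using assms
proof (induction b arbitrary: x)
  case (Suc b)
  show ?case
  proof (cases "a \<le> Suc b")
    case True
    then have le: "a \<le> Suc (Suc b)" by simp
    note d = act_desc[OF le swaps_A[of n]]
    have "ascending (TypeA n) (rev [a..<Suc (Suc b)]) x" using Suc.prems by (intro d(2)) auto
    moreover have "ascending (TypeA n) (half_twist a b) (foldr (act (TypeA n)) (rev [a..<Suc (Suc b)]) x)"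
      unfolding d(1) using Suc.prems(1) by (intro Suc.IH) (auto intro: Suc.prems(2))
    ultimately show ?thesis using True by (simp add: ascending_append del: upt_Suc act.simps)
  qed simp
qed simp

text \<open>The value at b is carried to the last place, negated there and carried back. The bound
  on absolute values makes it exceed everything on the way out and lie below everything on the way
  back.\<close>

lemma ascending_loop_B:
  assumes "1 \<le> b" "b \<le> n" "\<And>j. b < j \<Longrightarrow> j \<le> n \<Longrightarrow> \<bar>x j\<bar> < x b" "0 < x b"
  shows "ascending (TypeB n) (loop n b) x" "foldr (act (TypeB n)) (loop n b) x = x(b := - x b)"
proof -
  have sw: "swaps (TypeB n) {b..<n}" by (rule swaps_B) simp
  note d = act_desc[OF assms(2) sw] and u = act_asc[OF assms(2) sw]
  define y where "y = foldr (act (TypeB n)) (rev [b..<n]) x"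
  define z where "z = y(n := - y n)"
  have y: "y = (\<lambda>j. if b \<le> j \<and> j < n then x (Suc j) else if j = n then x b else x j)"
    unfolding y_def by (rule d(1))
  have 1: "ascending (TypeB n) (rev [b..<n]) x"
  proof (rule d(2))
    show "x j < x b" if "b < j" "j \<le> n" for j using assms(3)[OF that] by simp
  qed
  have 2: "ascending (TypeB n) [b..<n] z"
  proof (rule u(2))
    show "z n < z j" if "b \<le> j" "j < n" for j using assms(3)[of "Suc j"] that by (auto simp: z_def y)
  qed
  have 3: "foldr (act (TypeB n)) [n] y = z" "ascending (TypeB n) [n] y"
    using assms(4) by (auto simp: z_def y)
  show "ascending (TypeB n) (loop n b) x"
    using 1 2 3 unfolding loop_def ascending_append foldr_append y_def[symmetric] o_apply by simp
  have "foldr (act (TypeB n)) (loop n b) x = foldr (act (TypeB n)) [b..<n] z"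
    using 3(1) unfolding loop_def foldr_append y_def[symmetric] o_apply by simp
  then show "foldr (act (TypeB n)) (loop n b) x = x(b := - x b)"
    unfolding u(1) using assms(1,2) by (auto simp: fun_eq_iff z_def y)
qed

text \<open>The loops act from the last one backwards and leave negated values behind, so the
  induction controls later coordinates only up to sign and those up to p exactly.\<close>

lemma ascending_loops_B:
  assumes "p \<le> n" "\<And>j k. p < j \<Longrightarrow> j < k \<Longrightarrow> k \<le> n \<Longrightarrow> \<bar>x k\<bar> < x j" "\<And>j. p < j \<Longrightarrow> j \<le> n \<Longrightarrow> 0 < x j"
  shows "ascending (TypeB n) (loops n p) x"
    and "\<bar>foldr (act (TypeB n)) (loops n p) x j\<bar> = \<bar>x j\<bar>"
    and "j \<le> p \<Longrightarrow> foldr (act (TypeB n)) (loops n p) x j = x j"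
proof -
  have "ascending (TypeB n) (loops n p) x \<and> (\<forall>j. \<bar>foldr (act (TypeB n)) (loops n p) x j\<bar> = \<bar>x j\<bar>) \<and>
    (\<forall>j\<le>p. foldr (act (TypeB n)) (loops n p) x j = x j)"
    using assms
  proof (induction p rule: inc_induct)
    case (step p)
    define y where "y = foldr (act (TypeB n)) (loops n (Suc p)) x"
    have IH: "ascending (TypeB n) (loops n (Suc p)) x" "\<bar>y j\<bar> = \<bar>x j\<bar>" "j \<le> Suc p \<Longrightarrow> y j = x j" for j
      using step unfolding y_def by (simp_all del: act.simps)
    have l: "ascending (TypeB n) (loop n (Suc p)) y" "foldr (act (TypeB n)) (loop n (Suc p)) y = y(Suc p := - y (Suc p))"
      using step.hyps step.prems IH(2,3) by (intro ascending_loop_B; simp)+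
    have r: "loops n p = loop n (Suc p) @ loops n (Suc p)" using step.hyps by (intro loops_rec) simp
    show ?case using IH l unfolding r by (simp add: ascending_append y_def[symmetric] del: act.simps)
  qed simp
  then show "ascending (TypeB n) (loops n p) x"
    and "\<bar>foldr (act (TypeB n)) (loops n p) x j\<bar> = \<bar>x j\<bar>"
    and "j \<le> p \<Longrightarrow> foldr (act (TypeB n)) (loops n p) x j = x j" by auto
qed

text \<open>The braid left of a type B loop when the automorphism S stands for the letter n: the
  middle \<open>s (n - 1) * S * s (n - 1)\<close> equals \<open>s (n - 1) * s n * S\<close>.\<close>

definition loop_D :: "nat \<Rightarrow> nat \<Rightarrow> nat list" where
  "loop_D n b = [b..<n - 1] @ [n - 1, n] @ rev [b..<n - 1]"

text \<open>The range ends at n - 1 because the type B loop at n consists of the automorphism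
  alone.\<close>

definition loops_D :: "nat \<Rightarrow> nat \<Rightarrow> nat list" where
  "loops_D n p = concat (map (loop_D n) [Suc p..<n])"

lemma loops_D_rec: "Suc p < n \<Longrightarrow> loops_D n p = loop_D n (Suc p) @ loops_D n (Suc p)"
  unfolding loops_D_def by (simp add: upt_conv_Cons)

lemma ascending_loop_D:
  assumes "1 \<le> b" "b < n" "\<And>j. b < j \<Longrightarrow> j \<le> n \<Longrightarrow> \<bar>x j\<bar> < x b"
  shows "ascending (TypeD n) (loop_D n b) x" "foldr (act (TypeD n)) (loop_D n b) x = x(b := - x b, n := - x n)"
proof -
  have sw: "swaps (TypeD n) {b..<n - 1}" by (rule swaps_D) auto
  have le: "b \<le> n - 1" and n1: "Suc (n - 1) = n" "n - 1 \<noteq> n" using assms by auto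
  note d = act_desc[OF le sw] and u = act_asc[OF le sw]
  define y where "y = foldr (act (TypeD n)) (rev [b..<n - 1]) x"
  define z where "z = y(n - 1 := - y (n - 1), n := - y n)"
  have y: "y = (\<lambda>j. if b \<le> j \<and> j < n - 1 then x (Suc j) else if j = n - 1 then x b else x j)"
    unfolding y_def by (rule d(1))
  have 1: "ascending (TypeD n) (rev [b..<n - 1]) x"
  proof (rule d(2))
    fix j assume j: "b < j" "j \<le> n - 1"
    then have "j \<le> n" by simp
    from assms(3)[OF j(1) this] show "x j < x b" by simp
  qed
  have 2: "ascending (TypeD n) [b..<n - 1] z"
  proof (rule u(2))
    fix j assume j: "b \<le> j" "j < n - 1"
    then have "b < Suc j" "Suc j \<le> n" by auto
    from assms(3)[OF this] show "z (n - 1) < z j" using j n1 by (auto simp: z_def y)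
  qed
  have xn: "\<bar>x n\<bar> < x b" using assms by simp
  have 3: "foldr (act (TypeD n)) [n - 1, n] y = z" "ascending (TypeD n) [n - 1, n] y"
    using n1 xn assms(2) by (auto simp: z_def swap_at_def fun_eq_iff y)
  show "ascending (TypeD n) (loop_D n b) x"
    using 1 2 3 unfolding loop_D_def ascending_append foldr_append y_def[symmetric] o_apply by simp
  have "foldr (act (TypeD n)) (loop_D n b) x = foldr (act (TypeD n)) [b..<n - 1] z"
    using 3(1) unfolding loop_D_def foldr_append y_def[symmetric] o_apply by simp
  then show "foldr (act (TypeD n)) (loop_D n b) x = x(b := - x b, n := - x n)"
  proof (simp only:, intro ext)
    have z: "z (n - 1) = - x b" "z n = - x n" using n1 assms(2) by (auto simp: z_def y)
    have z': "z j = x (Suc j)" if "b \<le> j" "j < n - 1" for j using that by (auto simp: z_def y)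
    have z'': "z j = x j" if "j < b \<or> n < j" for j using that le by (auto simp: z_def y)
    fix j
    consider "j = b" | "j = n" | "b < j" "j < n" | "j < b \<or> n < j" using assms(2) by linarith
    then show "foldr (act (TypeD n)) [b..<n - 1] z j = (x(b := - x b, n := - x n)) j"
    proof cases
      case 1
      then show ?thesis unfolding u(1) using z assms(2) n1 by auto
    next
      case 2
      then show ?thesis unfolding u(1) using z assms(2) n1 by auto
    next
      case 3
      then show ?thesis unfolding u(1) using z'[of "j - 1"] by auto
    next
      case 4
      then show ?thesis unfolding u(1) using z''[OF 4] assms(2) le by auto
    qed
  qed
qed

text \<open>Every loop also changes the sign of the last coordinate, for which only the absolute
  value is assumed to be small.\<close>

lemma ascending_loops_D:
  assumes "p < n" "\<And>j k. p < j \<Longrightarrow> j < k \<Longrightarrow> k \<le> n \<Longrightarrow> \<bar>x k\<bar> < x j"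
  shows "ascending (TypeD n) (loops_D n p) x"
proof -
  have "p \<le> n - 1" using assms by simp
  then have "ascending (TypeD n) (loops_D n p) x \<and> (\<forall>j. \<bar>foldr (act (TypeD n)) (loops_D n p) x j\<bar> = \<bar>x j\<bar>) \<and>
    (\<forall>j\<le>p. foldr (act (TypeD n)) (loops_D n p) x j = x j)"
    using assms(2)
  proof (induction p rule: inc_induct)
    case base
    then show ?case using assms(1) by (simp add: loops_D_def)
  next
    case (step p)
    then have pn: "Suc p < n" by simp
    define y where "y = foldr (act (TypeD n)) (loops_D n (Suc p)) x"
    have IH: "ascending (TypeD n) (loops_D n (Suc p)) x" "\<bar>y j\<bar> = \<bar>x j\<bar>" "j \<le> Suc p \<Longrightarrow> y j = x j" for j
      using step unfolding y_def by (simp_all del: act.simps)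
    have l: "ascending (TypeD n) (loop_D n (Suc p)) y"
      "foldr (act (TypeD n)) (loop_D n (Suc p)) y = y(Suc p := - y (Suc p), n := - y n)"
      using pn step.prems IH(2,3) by (intro ascending_loop_D; simp)+
    show ?case using IH l pn unfolding loops_D_rec[OF pn] by (simp add: ascending_append y_def[symmetric] del: act.simps)
  qed
  then show ?thesis by simp
qed

section \<open>Powers of the elements attached to a sequence\<close>

declare coxeter_entry.simps [simp del]

section \<open>From the recursive words to the indexed products\<close>

lemma map_upt_Cons:
  "map f [1..<Suc (length (a # as))] = f 1 # map (\<lambda>i. f (Suc i)) [1..<Suc (length as)]"
proof -
  have "[1..<Suc (length (a # as))] = 1 # map Suc [1..<Suc (length as)]"
    by (subst map_Suc_upt) (simp add: upt_conv_Cons del: upt_Suc)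
  then show ?thesis by (simp add: comp_def del: upt_Suc)
qed

lemma psum_0 [simp]: "psum as 0 = 0"
  by (simp add: psum_def)

lemma psum_Cons [simp]: "psum (a # as) (Suc i) = a + psum as i"
  by (simp add: psum_def)

lemma psum_Suc: "i < length as \<Longrightarrow> psum as (Suc i) = psum as i + as ! i"
  by (simp add: psum_def take_Suc_conv_app_nth)

lemma psum_le: "psum as i \<le> sum_list as"
proof -
  have "sum_list as = psum as i + sum_list (drop i as)"
    unfolding psum_def by (metis append_take_drop_id sum_list_append)
  then show ?thesis by simp
qed

lemma psum_less:
  assumes "i < length as" "\<forall>a\<in>set as. 1 \<le> a"
  shows "psum as i < sum_list as"
proof -
  have "psum as (Suc i) = psum as i + as ! i" using assms(1) by (rule psum_Suc)
  moreover have "1 \<le> as ! i" using assms by simp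
  ultimately show ?thesis using psum_le[of as "Suc i"] by simp
qed

lemma entry_gt_1: "i \<noteq> j \<Longrightarrow> 1 < coxeter_entry t i j"
  by (cases t) (auto simp: coxeter_entry.simps)

lemma concat_map_Cons:
  "concat (map f [1..<Suc (length (a # as))]) = f 1 @ concat (map (\<lambda>i. f (Suc i)) [1..<Suc (length as)])"
  by (simp only: map_upt_Cons concat.simps)

lemma concat_map_cong:
  "(\<And>i. 1 \<le> i \<Longrightarrow> i \<le> l \<Longrightarrow> f i = g i) \<Longrightarrow> concat (map f [1..<Suc l]) = concat (map g [1..<Suc l])"
  by (rule arg_cong[of _ _ concat], rule map_cong) auto

text \<open>The exponent \<open>e\<^sub>i - e\<^sub>i\<^sub>-\<^sub>1\<close>, with \<open>e\<close> in place of \<open>e\<^sub>0\<close>.\<close>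

definition exponent :: "(nat \<Rightarrow> nat) \<Rightarrow> nat \<Rightarrow> nat list \<Rightarrow> nat \<Rightarrow> nat" where
  "exponent h e as i = h (as ! (i - 1)) - (if i = 1 then e else h (as ! (i - 2)))"

lemma exponent_1: "exponent h e (a # as) 1 = h a - e"
  by (simp add: exponent_def)

lemma exponent_Suc: "1 \<le> i \<Longrightarrow> exponent h e (a # as) (Suc i) = exponent h (h a) as i"
  by (cases i; cases "i - 1") (auto simp: exponent_def nth_Cons')

lemma word_A_concat:
  assumes "(\<Sum>x\<leftarrow>as. 2 * x - 1) + lo = hi + 2" "1 \<le> lo" "\<forall>x\<in>set as. 1 \<le> x"
  shows "word_A lo hi as
    = concat (map (\<lambda>i. rev [psum as (i - 1) + lo..<Suc (hi + i - psum as i)]) [1..<Suc (length as)])"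
  using assms
proof (induction as arbitrary: lo hi)
  case (Cons a as)
  have a: "1 \<le> a" using Cons.prems by simp
  note b = parts_A_bound[OF Cons.prems(1,2) a]
  have "map Suc (word_A (lo + a - 1) (hi - a) as)
    = concat (map (\<lambda>i. rev [psum (a # as) i + lo..<Suc (hi + Suc i - psum (a # as) (Suc i))]) [1..<Suc (length as)])"
  proof (cases "as = []")
    case False
    have ah: "a \<le> hi" and sum: "(\<Sum>x\<leftarrow>as. 2 * x - 1) + (lo + a - 1) = (hi - a) + 2"
      using b(3)[OF False] Cons.prems by auto
    have IH: "word_A (lo + a - 1) (hi - a) as
      = concat (map (\<lambda>i. rev [psum as (i - 1) + (lo + a - 1)..<Suc (hi - a + i - psum as i)]) [1..<Suc (length as)])"
      using sum Cons.prems a by (intro Cons.IH) auto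
    have "(\<Sum>x\<leftarrow>as. x) \<le> (\<Sum>x\<leftarrow>as. 2 * x - 1)"
      using Cons.prems(3) by (intro sum_list_mono) auto
    then have "sum_list as \<le> (\<Sum>x\<leftarrow>as. 2 * x - 1)" by simp
    \<comment> \<open>A part x is at most \<open>2 * x - 1\<close>, so no partial sum exceeds this
      bound and the subtractions in the segment ends are exact.\<close>
    then have bound: "psum as i \<le> hi - a + 1" for i using psum_le[of as i] sum Cons.prems a by linarith
    have "map Suc (rev [psum as (i - 1) + (lo + a - 1)..<Suc (hi - a + i - psum as i)])
      = rev [psum (a # as) i + lo..<Suc (hi + Suc i - psum (a # as) (Suc i))]" if "1 \<le> i" for i
    proof -
      obtain k where k: "i = Suc k" using \<open>1 \<le> i\<close> by (cases i) auto
      have "Suc (psum as k + (lo + a - 1)) = psum (a # as) (Suc k) + lo" using a by simp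
      moreover have "Suc (hi - a + Suc k - psum as (Suc k)) = hi + Suc (Suc k) - psum (a # as) (Suc (Suc k))"
        using bound[of "Suc k"] ah by simp
      ultimately show ?thesis by (simp only: rev_map[symmetric] map_Suc_upt k diff_Suc_1)
    qed
    then show ?thesis unfolding IH map_concat map_map comp_def by (intro concat_map_cong) simp
  qed simp
  then show ?case using b(1) unfolding concat_map_Cons word_A.simps by (simp del: upt_Suc)
qed simp

lemma twists_A_concat:
  assumes "\<forall>x\<in>set as. 1 \<le> x"
  shows "twists_A D lo hi e as = concat (map (\<lambda>i. concat (replicate (exponent (\<lambda>a. D div (2 * a - 1)) e as i)
      (half_twist (lo + psum as (i - 1) + 1 - i) (hi - psum as (i - 1))))) [1..<Suc (length as)])"
  using assms
proof (induction as arbitrary: lo hi e)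
  case (Cons a as)
  have "twists_A D (lo + a - 1) (hi - a) (D div (2 * a - 1)) as = concat (map (\<lambda>i.
      concat (replicate (exponent (\<lambda>a. D div (2 * a - 1)) (D div (2 * a - 1)) as i)
      (half_twist (lo + a - 1 + psum as (i - 1) + 1 - i) (hi - a - psum as (i - 1))))) [1..<Suc (length as)])"
    using Cons by simp
  also have "\<dots> = concat (map (\<lambda>i. concat (replicate (exponent (\<lambda>a. D div (2 * a - 1)) e (a # as) (Suc i))
      (half_twist (lo + psum (a # as) i + 1 - Suc i) (hi - psum (a # as) i)))) [1..<Suc (length as)])"
  proof (rule concat_map_cong)
    fix i :: nat assume i: "1 \<le> i"
    then obtain k where k: "i = Suc k" by (cases i) auto
    have "lo + a - 1 + psum as k + 1 - Suc k = lo + psum (a # as) (Suc k) + 1 - Suc (Suc k)"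
      using Cons.prems by simp
    then show "concat (replicate (exponent (\<lambda>a. D div (2 * a - 1)) (D div (2 * a - 1)) as i)
        (half_twist (lo + a - 1 + psum as (i - 1) + 1 - i) (hi - a - psum as (i - 1))))
      = concat (replicate (exponent (\<lambda>a. D div (2 * a - 1)) e (a # as) (Suc i))
        (half_twist (lo + psum (a # as) i + 1 - Suc i) (hi - psum (a # as) i)))"
      unfolding exponent_Suc[OF i] by (simp add: k)
  qed
  finally show ?case unfolding concat_map_Cons exponent_1 by simp
qed simp

lemma factors_concat:
  "factors g p as = concat (map (\<lambda>i. g (p + psum as (i - 1)) (p + psum as i)) [1..<Suc (length as)])"
proof (induction as arbitrary: p)
  case (Cons a as)
  have "concat (map (\<lambda>i. g (p + a + psum as (i - 1)) (p + a + psum as i)) [1..<Suc (length as)])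
    = concat (map (\<lambda>i. g (p + psum (a # as) i) (p + psum (a # as) (Suc i))) [1..<Suc (length as)])"
  proof (rule concat_map_cong)
    fix i :: nat assume "1 \<le> i"
    then obtain k where "i = Suc k" by (cases i) auto
    then show "g (p + a + psum as (i - 1)) (p + a + psum as i)
      = g (p + psum (a # as) i) (p + psum (a # as) (Suc i))" by (simp add: add.assoc)
  qed
  then show ?case unfolding concat_map_Cons factors.simps Cons by simp
qed simp

lemma twists_concat:
  "twists f D p e as = concat (map (\<lambda>i. concat (replicate (exponent (\<lambda>a. D div a) e as i)
      (f (p + psum as (i - 1))))) [1..<Suc (length as)])"
proof (induction as arbitrary: p e)
  case (Cons a as)
  have "concat (map (\<lambda>i. concat (replicate (exponent (\<lambda>a. D div a) (D div a) as i)
      (f (p + a + psum as (i - 1))))) [1..<Suc (length as)])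
    = concat (map (\<lambda>i. concat (replicate (exponent (\<lambda>a. D div a) e (a # as) (Suc i))
      (f (p + psum (a # as) i)))) [1..<Suc (length as)])"
  proof (rule concat_map_cong)
    fix i :: nat assume i: "1 \<le> i"
    then obtain k where "i = Suc k" by (cases i) auto
    then show "concat (replicate (exponent (\<lambda>a. D div a) (D div a) as i) (f (p + a + psum as (i - 1))))
      = concat (replicate (exponent (\<lambda>a. D div a) e (a # as) (Suc i)) (f (p + psum (a # as) i)))"
      unfolding exponent_Suc[OF i] by (simp add: add.assoc)
  qed
  then show ?case unfolding concat_map_Cons exponent_1 twists.simps Cons by simp
qed simp

lemma exponent_if:
  "(if i = 1 then h (as ! (1 - 1)) else h (as ! (i - 1)) - h (as ! (i - 1 - 1))) = exponent h 0 as i"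
  by (simp add: exponent_def numeral_2_eq_2)

lemma (in dynkin_type) longest_product_exponent:
  assumes "\<And>i. i \<in> {1..length as} \<Longrightarrow> canonical_lift t (longest_element t (K i)) = cB (f i)"
    "\<And>i. i \<in> {1..length as} \<Longrightarrow> f i \<in> lists (nodes t)"
  shows "longest_product t (length as) K (\<lambda>i. h (as ! (i - 1)))
    = cB (concat (map (\<lambda>i. concat (replicate (exponent h 0 as i) (f i))) [1..<Suc (length as)]))"
  by (subst longest_product_class[OF assms]) (simp_all only: exponent_if)

subsection \<open>Type A\<close>

lemma braid_seq_A: "braid_seq (lmul (nodes (TypeA n)) (braid_relations (TypeA n))) {1..n}"
proof -
  interpret dynkin_type "TypeA n" by (rule dynkin_type_valid) simp
  have X: "{1..n} = nodes (TypeA n)" by (simp add: nodes_def)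
  show ?thesis
    unfolding relations X
  proof unfold_locales
    show "\<beta> i * \<beta> j = \<beta> j * \<beta> i"
      if "i \<in> nodes (TypeA n)" "j \<in> nodes (TypeA n)" "Suc i < j" for i j
      using that by (intro beta_relations(1)) (auto simp: coxeter_entry.simps)
    show "\<beta> i * \<beta> (Suc i) * \<beta> i = \<beta> (Suc i) * \<beta> i * \<beta> (Suc i)"
      if "i \<in> nodes (TypeA n)" "Suc i \<in> nodes (TypeA n)" for i
      using that by (intro beta_relations(2)) (auto simp: coxeter_entry.simps)
  qed
qed

text \<open>The image of the first edge fixes a direction, injectivity forbids turning back, and
  remaining inside the path determines the image of its first node.\<close>

lemma path_automorphism:
  fixes p :: "nat \<Rightarrow> nat"
  assumes inj: "inj_on p {1..n}" and closed: "\<And>i. i \<in> {1..n} \<Longrightarrow> p i \<in> {1..n}"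
    and adj: "\<And>i. 1 \<le> i \<Longrightarrow> Suc i \<le> n \<Longrightarrow> p (Suc i) = Suc (p i) \<or> p i = Suc (p (Suc i))"
  shows "(\<forall>i\<in>{1..n}. p i = i) \<or> (\<forall>i\<in>{1..n}. p i = n + 1 - i)"
proof (cases "2 \<le> n")
  case False
  then have "p i = i" if "i \<in> {1..n}" for i using that closed[OF that] by auto
  then show ?thesis by simp
next
  case True
  have ne: "p (Suc (Suc i)) \<noteq> p i" if "1 \<le> i" "Suc (Suc i) \<le> n" for i
    using inj_onD[OF inj, of "Suc (Suc i)" i] that by auto
  show ?thesis
  proof (cases "p 2 = Suc (p 1)")
    case up: True
    have "p (Suc i) = p 1 + i \<and> (0 < i \<longrightarrow> p (Suc i) = Suc (p i))" if "Suc i \<le> n" for i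
      using that
    proof (induction i)
      case (Suc i)
      show ?case
      proof (cases i)
        case 0
        then show ?thesis using up by (simp add: numeral_2_eq_2)
      next
        case (Suc k)
        then show ?thesis using Suc.IH Suc.prems adj[of "Suc i"] ne[of i] by auto
      qed
    qed simp
    note F = this
    have f: "p (Suc i) = p 1 + i" if "Suc i \<le> n" for i by (rule F[OF that, THEN conjunct1])
    have "p n = p 1 + (n - 1)" using f[of "n - 1"] True by simp
    moreover have "p n \<le> n" "1 \<le> p 1" using closed[of n] closed[of 1] True by auto
    ultimately have p1: "p 1 = 1" using True by linarith
    have "p i = i" if "i \<in> {1..n}" for i using f[of "i - 1"] that p1 by auto
    then show ?thesis by simp
  next
    case False
    then have down: "p 1 = Suc (p 2)" using adj[of 1] True by (simp add: numeral_2_eq_2)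
    have "p (Suc i) + i = p 1 \<and> (0 < i \<longrightarrow> p i = Suc (p (Suc i)))" if "Suc i \<le> n" for i
      using that
    proof (induction i)
      case (Suc i)
      show ?case
      proof (cases i)
        case 0
        then show ?thesis using down by (simp add: numeral_2_eq_2)
      next
        case (Suc k)
        then show ?thesis using Suc.IH Suc.prems adj[of "Suc i"] ne[of i] by auto
      qed
    qed simp
    note F = this
    have f: "p (Suc i) + i = p 1" if "Suc i \<le> n" for i by (rule F[OF that, THEN conjunct1])
    have "p n + (n - 1) = p 1" using f[of "n - 1"] True by simp
    moreover have "p 1 \<le> n" "1 \<le> p n" using closed[of n] closed[of 1] True by auto
    ultimately have p1: "p 1 = n" using True by linarith
    have "p i = n + 1 - i" if "i \<in> {1..n}" for i using f[of "i - 1"] that p1 by auto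
    then show ?thesis by simp
  qed
qed

text \<open>If the entry is at least 3, the word \<open>[j, i, j]\<close> is reduced, yet commuting
  would shorten it to \<open>[i]\<close>. Edges of the diagram thus become visible in the
  group.\<close>

lemma (in dynkin_type) simple_refls_commute_iff:
  assumes "i \<in> nodes t" "j \<in> nodes t" "i \<noteq> j"
  shows "simple_refl t i \<otimes>\<^bsub>W\<^esub> simple_refl t j = simple_refl t j \<otimes>\<^bsub>W\<^esub> simple_refl t i
    \<longleftrightarrow> coxeter_entry t i j = 2"
proof -
  have "simple_refl t i \<otimes>\<^bsub>W\<^esub> simple_refl t j = simple_refl t j \<otimes>\<^bsub>W\<^esub> simple_refl t i \<longleftrightarrow> [i, j] \<sim> [j, i]"
    using assms by (simp add: simple_refl_eq word_class_eq_iff)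
  also have "\<dots> \<longleftrightarrow> coxeter_entry t i j = 2"
  proof
    assume "coxeter_entry t i j = 2"
    then show "[i, j] \<sim> [j, i]"
      using alternating_weq[OF assms(1,2)] by (simp add: numeral_2_eq_2)
  next
    assume c: "[i, j] \<sim> [j, i]"
    show "coxeter_entry t i j = 2"
    proof (rule ccontr)
      assume "coxeter_entry t i j \<noteq> 2"
      then have "3 \<le> coxeter_entry t i j" using entry_gt_1[OF assms(3), of t] by simp
      then have "reduced [j, i, j]"
        using alternating_reduced_le[of j i 3] assms m_sym[of i j] by (simp add: numeral_3_eq_3)
      moreover have "[j, i, j] \<sim> [i]"
        using word_eq.trans[OF weq_Cons[OF assms(2) c]] weq_Cons_cancel[of j "[i]"] assms by simp
      ultimately show False using reduced_le[of "[j, i, j]" "[i]"] by simp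
    qed
  qed
  finally show ?thesis .
qed

text \<open>Given is only a group automorphism permuting the simple reflections. It preserves
  commuting pairs and hence the edges of the chain. The identity permutation is excluded because the
  simple reflections generate the group and some element is moved.\<close>

lemma diagram_aut_A:
  assumes "diagram_aut_order2 (TypeA n) \<sigma>" "i \<in> {1..n}"
  shows "\<sigma> (simple_refl (TypeA n) i) = simple_refl (TypeA n) (n + 1 - i)"
proof -
  interpret dynkin_type "TypeA n" by (rule dynkin_type_valid) simp
  let ?s = "simple_refl (TypeA n)"
  have X: "nodes (TypeA n) = {1..n}" by (simp add: nodes_def)
  have iso: "\<sigma> \<in> iso W W" and img: "\<sigma> ` (?s ` {1..n}) = ?s ` {1..n}"
    and nontriv: "\<exists>w\<in>carrier W. \<sigma> w \<noteq> w"
    using assms(1) by (auto simp: diagram_aut_order2_def diagram_aut_def weyl_group_eq X)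
  have hom: "\<sigma> (x \<otimes>\<^bsub>W\<^esub> y) = \<sigma> x \<otimes>\<^bsub>W\<^esub> \<sigma> y" if "x \<in> carrier W" "y \<in> carrier W" for x y
    using iso that by (auto simp: iso_def hom_def)
  have inj: "inj_on \<sigma> (carrier W)" using iso by (auto simp: iso_def bij_betw_def)
  have sc: "?s i \<in> carrier W" if "i \<in> {1..n}" for i using that by (simp add: simple_refl_eq X)
  have sinj: "i = j" if "i \<in> {1..n}" "j \<in> {1..n}" "?s i = ?s j" for i j
  proof (rule ccontr)
    assume ne: "i \<noteq> j"
    from simple_refl_inj[OF that(1)[folded X] that(2)[folded X] that(3) entry_gt_1[OF ne]] ne
    show False by contradiction
  qed
  have "\<exists>j\<in>{1..n}. \<sigma> (?s i) = ?s j" if "i \<in> {1..n}" for i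
  proof -
    have "\<sigma> (?s i) \<in> ?s ` {1..n}" using that img by blast
    then show ?thesis by auto
  qed
  then obtain p where p: "\<And>i. i \<in> {1..n} \<Longrightarrow> p i \<in> {1..n} \<and> \<sigma> (?s i) = ?s (p i)"
    by metis
  have pinj: "inj_on p {1..n}"
  proof (rule inj_onI)
    fix i j assume ij: "i \<in> {1..n}" "j \<in> {1..n}" "p i = p j"
    then have "\<sigma> (?s i) = \<sigma> (?s j)" using p by simp
    then have "?s i = ?s j" using inj sc ij by (auto simp: inj_on_def)
    then show "i = j" using sinj ij by simp
  qed
  have comm: "coxeter_entry (TypeA n) (p i) (p j) = 2 \<Longrightarrow> coxeter_entry (TypeA n) i j = 2"
    if ij: "i \<in> {1..n}" "j \<in> {1..n}" "i \<noteq> j" for i j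
  proof -
    assume e: "coxeter_entry (TypeA n) (p i) (p j) = 2"
    have pij: "p i \<noteq> p j" using inj_on_eq_iff[OF pinj ij(1,2)] ij(3) by simp
    have "?s (p i) \<otimes>\<^bsub>W\<^esub> ?s (p j) = ?s (p j) \<otimes>\<^bsub>W\<^esub> ?s (p i)"
      using simple_refls_commute_iff[of "p i" "p j"] p ij pij e by (simp add: X)
    then have "\<sigma> (?s i \<otimes>\<^bsub>W\<^esub> ?s j) = \<sigma> (?s j \<otimes>\<^bsub>W\<^esub> ?s i)"
      using hom sc p ij by simp
    moreover have "?s i \<otimes>\<^bsub>W\<^esub> ?s j \<in> carrier W" "?s j \<otimes>\<^bsub>W\<^esub> ?s i \<in> carrier W"
      by (intro monoid.m_closed[OF monoid_presented] sc ij)+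
    ultimately have "?s i \<otimes>\<^bsub>W\<^esub> ?s j = ?s j \<otimes>\<^bsub>W\<^esub> ?s i" by (rule inj_onD[OF inj])
    then show "coxeter_entry (TypeA n) i j = 2"
      using simple_refls_commute_iff[of i j] ij by (simp add: X)
  qed
  have adj: "p (Suc i) = Suc (p i) \<or> p i = Suc (p (Suc i))" if "1 \<le> i" "Suc i \<le> n" for i
  proof -
    have ne: "p i \<noteq> p (Suc i)" using inj_on_eq_iff[OF pinj, of i "Suc i"] that by simp
    show ?thesis
    proof (rule ccontr)
      assume "\<not> ?thesis"
      then have "coxeter_entry (TypeA n) (p i) (p (Suc i)) = 2" using ne by (auto simp: coxeter_entry.simps)
      then show False using comm[of i "Suc i"] that by (simp add: coxeter_entry.simps)
    qed
  qed
  have "(\<forall>i\<in>{1..n}. p i = i) \<or> (\<forall>i\<in>{1..n}. p i = n + 1 - i)"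
    using pinj p adj by (intro path_automorphism) auto
  moreover have "\<not> (\<forall>i\<in>{1..n}. p i = i)"
  proof
    assume pid: "\<forall>i\<in>{1..n}. p i = i"
    have one: "\<sigma> (cW []) = cW []"
    proof -
      interpret group_hom W W \<sigma>
        using group_W iso by (auto intro!: group_hom.intro simp: group_hom_axioms_def iso_def)
      show ?thesis using hom_one by simp
    qed
    have "\<sigma> (cW u) = cW u" if "u \<in> lists {1..n}" for u
      using that
    proof (induction u)
      case (Cons i u)
      then have iu: "i \<in> nodes (TypeA n)" "u \<in> lists (nodes (TypeA n))" by (auto simp: X)
      have "\<sigma> (cW [i] \<otimes>\<^bsub>W\<^esub> cW u) = \<sigma> (cW [i]) \<otimes>\<^bsub>W\<^esub> \<sigma> (cW u)" using iu by (intro hom) auto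
      moreover have "\<sigma> (cW [i]) = cW [i]" using p[of i] pid iu by (simp add: simple_refl_eq X)
      ultimately show ?case using Cons.IH iu by simp
    qed (simp add: one)
    moreover obtain w where w: "w \<in> carrier W" "\<sigma> w \<noteq> w" using nontriv by auto
    obtain u where "u \<in> lists (nodes (TypeA n))" "w = cW u" using w(1) by (rule presented_carrierE)
    ultimately show False using w(2) by (simp add: X)
  qed
  ultimately have "p i = n + 1 - i" using assms(2) by blast
  then show ?thesis using p[OF assms(2)] by simp
qed

lemma twisted_power_w_A:
  assumes "n \<ge> 1" "diagram_aut_order2 (TypeA n) \<sigma>" "weakly_decreasing_pos \<alpha>"
    "(\<Sum>a\<leftarrow>\<alpha>. 2 * a - 1) = n + 1" "d = Lcm ((\<lambda>a. 2 * a - 1) ` set \<alpha>)"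
  shows "twisted_power (TypeA n) \<sigma> (canonical_lift (TypeA n) (w_A n \<alpha>)) (2 * d)
    = longest_product (TypeA n) (length \<alpha>) (\<lambda>i. {psum \<alpha> (i - 1) + 2 - i .. n - psum \<alpha> (i - 1)})
        (\<lambda>i. 2 * d div (2 * \<alpha> ! (i - 1) - 1))"
proof -
  let ?t = "TypeA n"
  have X: "nodes ?t = {1..n}" by (simp add: nodes_def)
  have val: "valid ?t" by simp
  interpret dynkin_type ?t by (rule dynkin_type_valid[OF val])
  interpret dynkin_aut ?t "\<lambda>i. n + 1 - i" "\<lambda>i. n + 1 - i" \<sigma>
    using diagram_aut_A[OF assms(2)] entry_gt_1[of _ _ ?t] by unfold_locales (auto simp: X coxeter_entry.simps)
  have pos: "\<forall>a\<in>set \<alpha>. 1 \<le> a" using assms(3) by (simp add: weakly_decreasing_pos_def)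
  have sum: "(\<Sum>a\<leftarrow>\<alpha>. 2 * a - 1) + 1 = n + 2" using assms(4) by simp
  interpret braid_seq \<beta> "{1..n}" using braid_seq_A[of n] unfolding relations .
  interpret flip: braid_flip \<beta> "{1..n}" S 1 n
    using S_beta by unfold_locales (auto simp: X)
  define w where "w = word_A 1 n \<alpha>"
  have wl: "w \<in> lists (nodes ?t)"
    using set_word_A[OF sum _ pos] by (auto simp: w_def X in_lists_conv_set)
  have red_twist: "reduced (half_twist a b)" if "1 \<le> a" "b \<le> n" for a b
  proof (rule ascending_reduced[OF val])
    show "half_twist a b \<in> lists (nodes ?t)" using set_half_twist[OF that(1), of b] that by (auto simp: X in_lists_conv_set)
    show "ascending ?t (half_twist a b) (generic ?t)"
      using that by (intro ascending_half_twist) (auto simp: generic_def)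
  qed
  have w_eq: "w_A n \<alpha> = cW w"
  proof -
    have "map (\<lambda>i. seg ?t (n + i - psum \<alpha> i) (psum \<alpha> (i - 1) + 1)) [1..<Suc (length \<alpha>)]
      = map (\<lambda>i. cW (rev [psum \<alpha> (i - 1) + 1..<Suc (n + i - psum \<alpha> i)])) [1..<Suc (length \<alpha>)]"
    proof (rule map_cong[OF HOL.refl])
      fix i assume "i \<in> set [1..<Suc (length \<alpha>)]"
      then have i: "1 \<le> i" "i \<le> length \<alpha>" by auto
      \<comment> \<open>All parts are at least 1, so the upper end
        \<open>n + i - psum \<alpha> i\<close> of the segment is at most n.\<close>
      have "i \<le> psum \<alpha> i"
      proof -
        have "(\<Sum>x\<leftarrow>take i \<alpha>. 1) \<le> (\<Sum>x\<leftarrow>take i \<alpha>. x)"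
          using pos by (intro sum_list_mono) (auto dest: in_set_takeD)
        then show ?thesis using i by (simp add: psum_def sum_list_triv)
      qed
      then show "seg ?t (n + i - psum \<alpha> i) (psum \<alpha> (i - 1) + 1)
        = cW (rev [psum \<alpha> (i - 1) + 1..<Suc (n + i - psum \<alpha> i)])"
        by (intro seg_class) auto
    qed
    moreover have "rev [psum \<alpha> (i - 1) + 1..<Suc (n + i - psum \<alpha> i)] \<in> lists (nodes ?t)"
      if "i \<in> set [1..<Suc (length \<alpha>)]" for i
      using wl that unfolding w_def word_A_concat[OF sum _ pos, OF order.refl]
      by (auto simp: in_lists_conv_set simp del: upt_Suc)
    ultimately show ?thesis
      unfolding w_A_def weyl_group_eq w_def word_A_concat[OF sum _ pos, OF order.refl]
      by (simp only: list_prod_map_word_class)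
  qed
  have red_w: "reduced w"
  proof -
    obtain v where v: "v \<in> lists {1..n}" "ev \<beta> (w @ v) = ev \<beta> (half_twist 1 n)"
      using word_A_prefix[OF sum _ pos] unfolding w_def by auto
    have red: "reduced (half_twist 1 n)" by (rule red_twist) simp_all
    then have l: "half_twist 1 n \<in> lists (nodes ?t)" by (simp add: reduced_def)
    have l': "w @ v \<in> lists (nodes ?t)" using wl v(1) by (simp add: X)
    have "half_twist 1 n \<approx> w @ v" using v(2) beta_eq_iff[OF l l'] by simp
    from beq_reduced[OF this red] have "reduced (w @ v)" .
    then show ?thesis by (rule reduced_append)
  qed
  have dvd: "\<forall>a\<in>set \<alpha>. (2 * a - 1) dvd 2 * d" using assms(5) by (auto intro: dvd_mult)
  have main: "(ev \<beta> w * S) ^ (2 * d) = ev \<beta> (twists_A (2 * d) 1 n 0 \<alpha>) * S ^ (2 * d)"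
    unfolding w_def using twisted_power_A[OF flip.braid_flip_axioms assms(3) _ dvd sum] by simp
  \<comment> \<open>The automorphism fixes the identity, so the trailing \<open>S ^ (2 * d)\<close>
    vanishes on evaluation.\<close>
  have S1: "app (S ^ k) (cB []) = cB []" for k
    using app_S[of "[]"] by (induction k) auto
  have tl: "twists_A (2 * d) 1 n 0 \<alpha> \<in> lists (nodes ?t)"
    using set_twists_A[OF order.refl pos, of "2 * d" n 0] by (auto simp: X in_lists_conv_set)
  have "twisted_power ?t \<sigma> (canonical_lift ?t (w_A n \<alpha>)) (2 * d) = cB (twists_A (2 * d) 1 n 0 \<alpha>)"
    unfolding w_eq canonical_lift_class[OF red_w] app_twisted_power[OF wl, symmetric] main
    using S1 app_beta[OF tl, of "[]"] by simp
  also have "\<dots> = longest_product ?t (length \<alpha>) (\<lambda>i. {psum \<alpha> (i - 1) + 2 - i .. n - psum \<alpha> (i - 1)})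
        (\<lambda>i. 2 * d div (2 * \<alpha> ! (i - 1) - 1))"
  proof -
    let ?f = "\<lambda>i. half_twist (1 + psum \<alpha> (i - 1) + 1 - i) (n - psum \<alpha> (i - 1))"
    \<comment> \<open>The first i - 1 parts sum to at least i - 1, which keeps the lower end of the
      interval at 1 or above.\<close>
    have lo: "1 \<le> 1 + psum \<alpha> (i - 1) + 1 - i" if "i \<in> {1..length \<alpha>}" for i
    proof -
      have "(\<Sum>x\<leftarrow>take (i - 1) \<alpha>. 1) \<le> (\<Sum>x\<leftarrow>take (i - 1) \<alpha>. x)"
        using pos by (intro sum_list_mono) (auto dest: in_set_takeD)
      then show ?thesis using that by (auto simp: psum_def sum_list_triv min_def split: if_splits)
    qed
    have long: "canonical_lift ?t (longest_element ?t {psum \<alpha> (i - 1) + 2 - i .. n - psum \<alpha> (i - 1)}) = cB (?f i)"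
      if i: "i \<in> {1..length \<alpha>}" for i
    proof -
      let ?a = "1 + psum \<alpha> (i - 1) + 1 - i" and ?b = "n - psum \<alpha> (i - 1)"
      have e: "psum \<alpha> (i - 1) + 2 - i = ?a" by simp
      have sub: "{?a..?b} \<subseteq> {1..n}" using lo[OF i] by auto
      have red: "reduced (half_twist ?a ?b)" using lo[OF i] by (intro red_twist) auto
      show ?thesis
        unfolding e
      proof (rule lift_longest_element[OF _ red])
        show "{?a..?b} \<subseteq> nodes ?t" using sub by (simp add: X)
        show "half_twist ?a ?b \<in> lists {?a..?b}"
          using set_half_twist[OF lo[OF i], of ?b] by (auto simp: in_lists_conv_set)
        fix j assume j: "j \<in> {?a..?b}"
        obtain v where v: "v \<in> lists {?a..?b}" "ev \<beta> (half_twist ?a ?b) = \<beta> j * ev \<beta> v"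
          using half_twist_left_divisor[OF lo[OF i] sub j] by auto
        have l: "half_twist ?a ?b \<in> lists (nodes ?t)" using red by (simp add: reduced_def)
        have "set (j # v) \<subseteq> {?a..?b}" using v(1) j by (auto simp: in_lists_conv_set)
        from subset_trans[OF this sub] have l': "j # v \<in> lists (nodes ?t)"
          by (auto simp: X in_lists_conv_set)
        have "ev \<beta> (half_twist ?a ?b) = ev \<beta> (j # v)" using v(2) by simp
        then have "half_twist ?a ?b \<approx> j # v" using beta_eq_iff[OF l l'] by simp
        then show "\<exists>v. half_twist ?a ?b \<approx> j # v" by auto
      qed
    qed
    have fl: "?f i \<in> lists (nodes ?t)" if "i \<in> {1..length \<alpha>}" for i
      using set_half_twist[OF lo[OF that], of "n - psum \<alpha> (i - 1)"] lo[OF that]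
      by (force simp: X in_lists_conv_set)
    show ?thesis
      unfolding twists_A_concat[OF pos]
      by (rule longest_product_exponent[OF long fl, where h = "\<lambda>a. 2 * d div (2 * a - 1)", symmetric])
  qed
  finally show ?thesis .
qed

subsection \<open>Type B\<close>

lemma parts_of_partition:
  assumes "is_partition \<alpha> n"
  shows "weakly_decreasing_pos \<alpha>" "sum_list \<alpha> + 0 = n" "\<forall>a\<in>set \<alpha>. 1 \<le> a"
  using assms by (auto simp: is_partition_def weakly_decreasing_pos_def)

lemma block_split:
  assumes "a < b" "b \<le> n"
  shows "block n a b = [b..<n] @ rev [Suc a..<Suc n]"
proof -
  have "rev [Suc a..<n] = rev [b..<n] @ rev [Suc a..<b]" using assms by (intro rev_upt_split) auto
  moreover have "rev [Suc a..<Suc n] = n # rev [Suc a..<n]" using assms by simp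
  ultimately show ?thesis by (simp add: block_def loop_def)
qed

lemma braid_seq_B_monoid: "braid_seq_B (lmul (nodes (TypeB n)) (braid_relations (TypeB n))) n"
proof -
  interpret dynkin_type "TypeB n" by (rule dynkin_type_valid) simp
  have X: "nodes (TypeB n) = {1..n}" by (simp add: nodes_def)
  show ?thesis
    unfolding relations
  proof unfold_locales
    show "\<beta> i * \<beta> j = \<beta> j * \<beta> i" if "i \<in> {1..<n}" "j \<in> {1..<n}" "Suc i < j" for i j
      using that by (intro beta_relations(1)) (auto simp: X coxeter_entry.simps)
    show "\<beta> i * \<beta> (Suc i) * \<beta> i = \<beta> (Suc i) * \<beta> i * \<beta> (Suc i)"
      if "i \<in> {1..<n}" "Suc i \<in> {1..<n}" for i
      using that by (intro beta_relations(2)) (auto simp: X coxeter_entry.simps)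
    show "\<beta> i * \<beta> n = \<beta> n * \<beta> i" if "1 \<le> i" "Suc i < n" for i
      using that by (intro beta_relations(1)) (auto simp: X coxeter_entry.simps)
    show "\<beta> i * \<beta> n * \<beta> i * \<beta> n = \<beta> n * \<beta> i * \<beta> n * \<beta> i" if "1 \<le> i" "Suc i = n" for i
      using that by (intro beta_relations(3)) (auto simp: X coxeter_entry.simps)
  qed
qed

lemma power_w_B:
  assumes "is_partition \<alpha> n" "d = Lcm (set \<alpha>)"
  shows "canonical_lift (TypeB n) (w_B n \<alpha>) [^]\<^bsub>braid_monoid (TypeB n)\<^esub> d
    = longest_product (TypeB n) (length \<alpha>) (\<lambda>i. {psum \<alpha> (i - 1) + 1 .. n}) (\<lambda>i. d div (\<alpha> ! (i - 1)))"
proof -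
  let ?t = "TypeB n"
  have X: "nodes ?t = {1..n}" by (simp add: nodes_def)
  have val: "valid ?t" by simp
  interpret dynkin_type ?t by (rule dynkin_type_valid[OF val])
  interpret braid_seq_B \<beta> n using braid_seq_B_monoid[of n] unfolding relations .
  note part = parts_of_partition[OF assms(1)]
  have psum_n: "psum \<alpha> i \<le> n" for i using psum_le[of \<alpha> i] part(2) by simp
  define w where "w = factors (block n) 0 \<alpha>"
  have w_concat: "w = concat (map (\<lambda>i. block n (psum \<alpha> (i - 1)) (psum \<alpha> i)) [1..<Suc (length \<alpha>)])"
    unfolding w_def factors_concat by simp
  have wl: "w \<in> lists (nodes ?t)"
    using set_word_B[OF part(2,3)] by (auto simp: w_def X in_lists_conv_set)
  have psum_step: "psum \<alpha> (i - 1) < psum \<alpha> i" if "i \<in> set [1..<Suc (length \<alpha>)]" for i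
  proof -
    have i: "i - 1 < length \<alpha>" "i = Suc (i - 1)" using that by auto
    then have "1 \<le> \<alpha> ! (i - 1)" using part(3) by auto
    then show ?thesis using psum_Suc[OF i(1)] i(2) by simp
  qed
  have red_loops: "reduced (loops n p)" if "p \<le> n" for p
  proof (rule ascending_reduced[OF val])
    show "loops n p \<in> lists (nodes ?t)" using set_loops[of n p] by (auto simp: X in_lists_conv_set)
    show "ascending ?t (loops n p) (generic ?t)"
      using that by (intro ascending_loops_B(1)) (auto simp: generic_def)
  qed
  have w_eq: "w_B n \<alpha> = cW w"
  proof -
    have "map (\<lambda>i. inv\<^bsub>W\<^esub> (seg ?t (n - 1) (psum \<alpha> i)) \<otimes>\<^bsub>W\<^esub> seg ?t n (psum \<alpha> (i - 1) + 1)) [1..<Suc (length \<alpha>)]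
      = map (\<lambda>i. cW (block n (psum \<alpha> (i - 1)) (psum \<alpha> i))) [1..<Suc (length \<alpha>)]"
    proof (rule map_cong[OF HOL.refl])
      fix i assume i: "i \<in> set [1..<Suc (length \<alpha>)]"
      let ?a = "psum \<alpha> (i - 1)" and ?b = "psum \<alpha> i"
      have ab: "?a < ?b" "?b \<le> n" using psum_step[OF i] psum_n by auto
      have e: "Suc (n - 1) = n" using ab by simp
      have l: "rev [?b..<n] \<in> lists (nodes ?t)" "[?b..<n] \<in> lists (nodes ?t)"
        "rev [Suc ?a..<Suc n] \<in> lists (nodes ?t)"
        using ab by (auto simp: X in_lists_conv_set simp del: upt_Suc)
      have "seg ?t (n - 1) ?b = cW (rev [?b..<n])"
        using seg_class[of ?b "n - 1"] ab unfolding e by simp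
      moreover have "seg ?t n (?a + 1) = cW (rev [Suc ?a..<Suc n])"
        using seg_class[of "?a + 1" n] by simp
      ultimately show "inv\<^bsub>W\<^esub> (seg ?t (n - 1) ?b) \<otimes>\<^bsub>W\<^esub> seg ?t n (?a + 1) = cW (block n ?a ?b)"
        using l inv_class[OF l(1)] block_split[OF ab] by (simp del: upt_Suc)
    qed
    moreover have "block n (psum \<alpha> (i - 1)) (psum \<alpha> i) \<in> lists (nodes ?t)"
      if "i \<in> set [1..<Suc (length \<alpha>)]" for i
      using set_block[OF psum_step[OF that] psum_n] by (auto simp: X in_lists_conv_set)
    ultimately show ?thesis
      unfolding w_B_def weyl_group_eq w_concat by (simp only: list_prod_map_word_class)
  qed
  have red_w: "reduced w"
  proof -
    obtain v where v: "v \<in> lists {Suc 0..n}" "ev \<beta> (w @ v) = ev \<beta> (loops n 0)"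
      using word_B_prefix[OF part(2,3)] unfolding w_def by auto
    have red: "reduced (loops n 0)" by (rule red_loops) simp
    then have l: "loops n 0 \<in> lists (nodes ?t)" by (simp add: reduced_def)
    have l': "w @ v \<in> lists (nodes ?t)" using wl v(1) by (simp add: X)
    have "loops n 0 \<approx> w @ v" using v(2) beta_eq_iff[OF l l'] by simp
    from beq_reduced[OF this red] have "reduced (w @ v)" .
    then show ?thesis by (rule reduced_append)
  qed
  have tl: "twists (loops n) d 0 0 \<alpha> \<in> lists (nodes ?t)"
    using set_twists_B[of n d 0 0 \<alpha>] by (auto simp: X in_lists_conv_set)
  have rl: "concat (replicate d w) \<in> lists (nodes ?t)"
    using wl by (auto simp: in_lists_conv_set)
  have dvd: "\<forall>a\<in>set \<alpha>. a dvd d" using assms(2) by auto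
  have "ev \<beta> (concat (replicate d w)) = ev \<beta> (twists (loops n) d 0 0 \<alpha>)"
    unfolding ev_concat_replicate w_def using power_B[OF part(1) dvd part(2)] .
  then have "concat (replicate d w) \<approx> twists (loops n) d 0 0 \<alpha>" using beta_eq_iff[OF rl tl] by simp
  then have "cB (concat (replicate d w)) = cB (twists (loops n) d 0 0 \<alpha>)"
    using rl by (simp add: word_class_eq_iff)
  then have "canonical_lift ?t (w_B n \<alpha>) [^]\<^bsub>B\<^esub> d = cB (twists (loops n) d 0 0 \<alpha>)"
    unfolding w_eq canonical_lift_class[OF red_w] presented_pow[OF wl] .
  also have "\<dots> = longest_product ?t (length \<alpha>) (\<lambda>i. {psum \<alpha> (i - 1) + 1 .. n}) (\<lambda>i. d div (\<alpha> ! (i - 1)))"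
  proof -
    let ?f = "\<lambda>i. loops n (0 + psum \<alpha> (i - 1))"
    have long: "canonical_lift ?t (longest_element ?t {psum \<alpha> (i - 1) + 1 .. n}) = cB (?f i)" for i
    proof -
      let ?p = "psum \<alpha> (i - 1)"
      have red: "reduced (loops n ?p)" using psum_n by (rule red_loops)
      have "canonical_lift ?t (longest_element ?t {Suc ?p .. n}) = cB (loops n ?p)"
      proof (rule lift_longest_element[OF _ red])
        show "{Suc ?p..n} \<subseteq> nodes ?t" by (simp add: X)
        show "loops n ?p \<in> lists {Suc ?p..n}" using set_loops[of n ?p] by (auto simp: in_lists_conv_set)
        fix j assume j: "j \<in> {Suc ?p..n}"
        obtain v where v: "v \<in> lists {Suc ?p..n}" "ev \<beta> (loops n ?p) = ev \<beta> (loop n j @ v)"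
          using loops_left_divisor[OF j] by auto
        have "set (loop n j @ v) \<subseteq> {Suc ?p..n}"
          using v(1) set_loop[of n j] j by (auto simp: in_lists_conv_set)
        then have l': "loop n j @ v \<in> lists (nodes ?t)" by (auto simp: X in_lists_conv_set)
        have l: "loops n ?p \<in> lists (nodes ?t)" using red by (simp add: reduced_def)
        have "loops n ?p \<approx> loop n j @ v" using v(2) beta_eq_iff[OF l l'] by simp
        moreover have "\<exists>u. loop n j = j # u"
          using j by (cases "j = n") (auto simp: loop_def upt_conv_Cons)
        ultimately show "\<exists>v. loops n ?p \<approx> j # v" by auto
      qed
      then show ?thesis by simp
    qed
    have fl: "?f i \<in> lists (nodes ?t)" for i
      using set_loops[of n "psum \<alpha> (i - 1)"] by (auto simp: X in_lists_conv_set)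
    show ?thesis
      unfolding twists_concat
      by (rule longest_product_exponent[OF long fl, where h = "\<lambda>a. d div a", symmetric])
  qed
  finally show ?thesis unfolding braid_monoid_eq .
qed

subsection \<open>Type D\<close>

text \<open>Together with the braids \<open>s\<^sub>1, \<dots>, s\<^sub>n\<^sub>-\<^sub>1\<close>, the diagram automorphism of type D satisfies
  the braid relations of type B, because it commutes with \<open>s\<^sub>i\<close> for \<open>i < n - 1\<close> and exchanges the
  commuting \<open>s\<^sub>n\<^sub>-\<^sub>1\<close> and \<open>s\<^sub>n\<close>. This remains true if \<open>s\<^sub>n\<^sub>-\<^sub>1\<close> is replaced by \<open>s\<^sub>n\<close>, which is
  the choice required for partitions with an odd number of parts.\<close>

definition fork_swap :: "nat \<Rightarrow> nat \<Rightarrow> nat" where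
  "fork_swap n i = (if i = n then n - 1 else if i = n - 1 then n else i)"

definition factor_D :: "nat \<Rightarrow> nat \<Rightarrow> nat \<Rightarrow> nat list" where
  "factor_D n a b = (if b \<le> n - 1 then [b..<n - 1] @ rev [Suc a..<Suc n] else rev [Suc a..<n])"

lemma set_factor_D: "1 \<le> b \<Longrightarrow> set (factor_D n a b) \<subseteq> {1..n}"
  by (auto simp: factor_D_def simp del: upt_Suc)

lemma set_word_D: "\<forall>x\<in>set as. 1 \<le> x \<Longrightarrow> set (factors (factor_D n) p as) \<subseteq> {1..n}"
proof (induction as arbitrary: p)
  case (Cons a as)
  then show ?case using set_factor_D[of "p + a" n p] by auto
qed simp

lemma set_loops_D: "set (loops_D n p) \<subseteq> {Suc p..n}"
proof -
  have "set (loop_D n b) \<subseteq> {b..n}" if "b < n" for b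
    using that by (auto simp: loop_D_def)
  then show ?thesis by (fastforce simp: loops_D_def)
qed

lemma loops_D_empty [simp]: "n \<le> Suc p \<Longrightarrow> loops_D n p = []"
  by (simp add: loops_D_def)

locale type_D_aut =
  fixes n :: nat and \<sigma> :: "nat list set \<Rightarrow> nat list set"
  assumes n: "2 \<le> n"
    and sigma_D: "i \<in> {1..n} \<Longrightarrow> \<sigma> (simple_refl (TypeD n) i) = simple_refl (TypeD n) (fork_swap n i)"
begin

lemma nodes_D: "nodes (TypeD n) = {1..n}"
  by (simp add: nodes_def)

sublocale dynkin_type "TypeD n"
  by (rule dynkin_type_valid) (simp add: n)

sublocale dynkin_aut "TypeD n" "fork_swap n" "fork_swap n" \<sigma>
proof unfold_locales
  show "fork_swap n i \<in> nodes (TypeD n) \<and> fork_swap n (fork_swap n i) = i" if "i \<in> nodes (TypeD n)" for i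
    using that n by (auto simp: nodes_D fork_swap_def)
  show "coxeter_entry (TypeD n) (fork_swap n i) (fork_swap n j) = coxeter_entry (TypeD n) i j"
    if ij: "i \<in> nodes (TypeD n)" "j \<in> nodes (TypeD n)" for i j
  proof -
    obtain k where k: "n = Suc (Suc k)" using n by (metis add_2_eq_Suc le_Suc_ex)
    have "i = Suc (Suc k) \<or> i = Suc k \<or> i \<le> k" "j = Suc (Suc k) \<or> j = Suc k \<or> j \<le> k"
      using ij k unfolding nodes_D by auto
    then show ?thesis
      by (elim disjE) (simp_all add: k fork_swap_def coxeter_entry.simps doubleton_eq_iff)
  qed
qed (use sigma_D entry_gt_1 in \<open>auto simp: nodes_D\<close>)

lemma S_square: "S * S = 1"
proof (rule endo_eqI)
  fix x show "app (S * S) x = app 1 x"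
  proof (cases "x \<in> carrier B")
    case True
    then obtain u where u: "u \<in> lists (nodes (TypeD n))" "x = cB u" by (rule presented_carrierE)
    then show ?thesis using app_S[OF u(1)] app_S[OF map_lists(1)[OF u(1)]] map_cancel(1)[OF u(1)]
      by simp
  next
    case False
    then show ?thesis by (simp add: S_def)
  qed
qed

lemma S_square': "S * (S * x) = x"
  using S_square by (simp add: mult.assoc[symmetric])

lemma S_power_even: "even k \<Longrightarrow> S ^ k = 1"
  by (elim evenE) (simp add: power_mult power2_eq_square S_square)

lemma S_power: "S ^ k = (if even k then 1 else S)"
  using S_power_even[of k] S_power_even[of "k - 1"] by (cases k) auto

lemma S_commute: "i \<in> {1..<n - 1} \<Longrightarrow> S * \<beta> i = \<beta> i * S"
  using S_beta[of i] n by (auto simp: nodes_D fork_swap_def)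

lemma S_commute_word: "set u \<subseteq> {1..<n - 1} \<Longrightarrow> S * ev \<beta> u = ev \<beta> u * S"
  by (rule ev_commute, rule S_commute, erule subsetD)

lemma S_fork: "S * \<beta> (n - 1) = \<beta> n * S" "S * \<beta> n = \<beta> (n - 1) * S"
  using S_beta[of "n - 1"] S_beta[of n] n by (auto simp: nodes_D fork_swap_def)

lemma fork_commute: "\<beta> (n - 1) * \<beta> n = \<beta> n * \<beta> (n - 1)"
  using n by (intro beta_relations(1)) (auto simp: nodes_D coxeter_entry.simps)

definition gen_B :: "nat \<Rightarrow> nat \<Rightarrow> nat list set endo" where
  "gen_B k i = (if i = n then S else if i = n - 1 then \<beta> k else \<beta> i)"

lemma ev_gen_B: "set u \<subseteq> {1..<n - 1} \<Longrightarrow> ev (gen_B k) u = ev \<beta> u"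
  by (induction u) (auto simp: gen_B_def)

text \<open>Moving \<open>S\<close> across one branch of the fork gives the other branch. As the
  branches commute, the result is the same for both choices of k.\<close>

lemma fork_S:
  assumes "k = n - 1 \<or> k = n"
  shows "\<beta> k * (S * (\<beta> k * x)) = \<beta> (n - 1) * (\<beta> n * (S * x))"
    "S * (\<beta> k * x) = \<beta> (fork_swap n k) * (S * x)"
proof -
  have s: "S * \<beta> k = \<beta> (fork_swap n k) * S" using assms S_fork n by (auto simp: fork_swap_def)
  then show 2: "S * (\<beta> k * x) = \<beta> (fork_swap n k) * (S * x)" by (simp add: mult.assoc[symmetric])
  have "\<beta> k * \<beta> (fork_swap n k) = \<beta> (n - 1) * \<beta> n" using assms fork_commute n by (auto simp: fork_swap_def)
  then show "\<beta> k * (S * (\<beta> k * x)) = \<beta> (n - 1) * (\<beta> n * (S * x))"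
    unfolding 2 by (simp add: mult.assoc[symmetric])
qed

lemma braid_seq_gen_B:
  assumes k: "k = n - 1 \<or> k = n"
  shows "braid_seq_B (gen_B k) n"
proof unfold_locales
  \<comment> \<open>The nodes n - 2 and n differ by two in number but are joined in the diagram, so
    this pair is excluded.\<close>
  have far: "\<beta> i * \<beta> j = \<beta> j * \<beta> i" if "i \<in> {1..<n - 1}" "j \<in> {1..n}" "Suc i < j" "i = n - 2 \<longrightarrow> j \<noteq> n" for i j
    using that n by (intro beta_relations(1)) (auto simp: nodes_D coxeter_entry.simps doubleton_eq_iff)
  show "gen_B k i * gen_B k j = gen_B k j * gen_B k i" if "i \<in> {1..<n}" "j \<in> {1..<n}" "Suc i < j" for i j
  proof -
    have i: "i \<in> {1..<n - 1}" "i \<noteq> n - 2" using that by auto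
    show ?thesis using that i k n far[OF i(1), of j] far[OF i(1), of k] by (auto simp: gen_B_def)
  qed
  show "gen_B k i * gen_B k (Suc i) * gen_B k i = gen_B k (Suc i) * gen_B k i * gen_B k (Suc i)"
    if "i \<in> {1..<n}" "Suc i \<in> {1..<n}" for i
  proof (cases "Suc i = n - 1")
    case False
    then have "i \<in> {1..<n - 1}" "Suc i \<in> {1..<n - 1}" using that by auto
    moreover from this have "\<beta> i * \<beta> (Suc i) * \<beta> i = \<beta> (Suc i) * \<beta> i * \<beta> (Suc i)"
      by (intro beta_relations(2)) (auto simp: nodes_D coxeter_entry.simps doubleton_eq_iff)
    ultimately show ?thesis by (auto simp: gen_B_def)
  next
    case True
    then have "\<beta> i * \<beta> k * \<beta> i = \<beta> k * \<beta> i * \<beta> k"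
      using that k by (intro beta_relations(2)) (auto simp: nodes_D coxeter_entry.simps doubleton_eq_iff)
    then show ?thesis using True that by (auto simp: gen_B_def)
  qed
  show "gen_B k i * gen_B k n = gen_B k n * gen_B k i" if "1 \<le> i" "Suc i < n" for i
    using S_commute[of i] that by (auto simp: gen_B_def)
  show "gen_B k i * gen_B k n * gen_B k i * gen_B k n = gen_B k n * gen_B k i * gen_B k n * gen_B k i"
    if "1 \<le> i" "Suc i = n" for i
  proof -
    have i: "i = n - 1" "i \<noteq> n" using that by auto
    have "\<beta> k * (S * (\<beta> k * S)) = S * (\<beta> k * (S * \<beta> k))"
    proof -
      have a: "\<beta> k * (S * (\<beta> k * S)) = \<beta> (n - 1) * \<beta> n"
        unfolding fork_S(1)[OF k] using S_square by simp
      have "\<beta> k * (S * \<beta> k) = \<beta> (n - 1) * (\<beta> n * S)" using fork_S(1)[OF k, of 1] by simp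
      then have "S * (\<beta> k * (S * \<beta> k)) = (S * \<beta> (n - 1)) * (\<beta> n * S)" by (simp add: mult.assoc)
      also have "\<dots> = \<beta> n * (S * \<beta> n) * S" unfolding S_fork(1) by (simp add: mult.assoc)
      also have "\<dots> = \<beta> n * \<beta> (n - 1)" unfolding S_fork(2) using S_square by (simp add: mult.assoc)
      finally show ?thesis using a fork_commute by simp
    qed
    then show ?thesis using i by (simp add: gen_B_def mult.assoc)
  qed
qed

lemma loop_gen_B:
  assumes "k = n - 1 \<or> k = n" "1 \<le> b" "b < n"
  shows "ev (gen_B k) (loop n b) = ev \<beta> (loop_D n b) * S"
proof -
  have u: "[b..<n] = [b..<n - 1] @ [n - 1]" using assms upt_Suc_append[of b "n - 1"] by simp
  have g: "gen_B k (n - 1) = \<beta> k" "gen_B k n = S" using n by (auto simp: gen_B_def)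
  have 1: "ev (gen_B k) [b..<n - 1] = ev \<beta> [b..<n - 1]"
    "ev (gen_B k) (rev [b..<n - 1]) = ev \<beta> (rev [b..<n - 1])"
    using assms by (auto intro!: ev_gen_B)
  have 2: "S * ev \<beta> (rev [b..<n - 1]) = ev \<beta> (rev [b..<n - 1]) * S"
    using assms by (intro S_commute_word) auto
  show ?thesis
    unfolding loop_def u loop_D_def
    by (simp add: g 1 mult.assoc fork_S(1)[OF assms(1)] 2 del: One_nat_def)
qed

lemma S_loop_D:
  assumes "1 \<le> b"
  shows "S * ev \<beta> (loop_D n b) = ev \<beta> (loop_D n b) * S"
proof -
  have 1: "S * ev \<beta> [b..<n - 1] = ev \<beta> [b..<n - 1] * S"
    "S * ev \<beta> (rev [b..<n - 1]) = ev \<beta> (rev [b..<n - 1]) * S"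
    using assms by (intro S_commute_word; auto)+
  have 2: "S * (\<beta> (n - 1) * \<beta> n) = \<beta> (n - 1) * \<beta> n * S"
  proof -
    have "S * (\<beta> (n - 1) * \<beta> n) = \<beta> n * (S * \<beta> n)" using S_fork(1) by (simp add: mult.assoc[symmetric])
    also have "\<dots> = \<beta> n * \<beta> (n - 1) * S" unfolding S_fork(2) by (simp only: mult.assoc)
    also have "\<beta> n * \<beta> (n - 1) = \<beta> (n - 1) * \<beta> n" by (rule fork_commute[symmetric])
    finally show ?thesis .
  qed
  have "S * ev \<beta> (loop_D n b) = (S * ev \<beta> [b..<n - 1]) * (\<beta> (n - 1) * \<beta> n) * ev \<beta> (rev [b..<n - 1])"
    by (simp add: loop_D_def mult.assoc)
  also have "\<dots> = ev \<beta> [b..<n - 1] * (S * (\<beta> (n - 1) * \<beta> n)) * ev \<beta> (rev [b..<n - 1])"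
    unfolding 1 by (simp add: mult.assoc)
  also have "\<dots> = ev \<beta> [b..<n - 1] * (\<beta> (n - 1) * \<beta> n) * (S * ev \<beta> (rev [b..<n - 1]))"
    unfolding 2 by (simp add: mult.assoc)
  finally show ?thesis unfolding 1 by (simp add: loop_D_def mult.assoc)
qed

lemma loops_gen_B:
  assumes k: "k = n - 1 \<or> k = n" and "p < n"
  shows "ev (gen_B k) (loops n p) = ev \<beta> (loops_D n p) * S ^ (n - p)"
    "S * ev \<beta> (loops_D n p) = ev \<beta> (loops_D n p) * S"
proof -
  have "p \<le> n - 1" using assms by simp
  then have "ev (gen_B k) (loops n p) = ev \<beta> (loops_D n p) * S ^ (n - p)
    \<and> S * ev \<beta> (loops_D n p) = ev \<beta> (loops_D n p) * S"
  proof (induction p rule: inc_induct)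
    \<comment> \<open>The innermost loop is \<open>S\<close> alone, in agreement with an empty
      \<open>loops_D\<close> and the exponent \<open>n - (n - 1) = 1\<close>.\<close>
    case base
    have "loops n (n - 1) = [n]" using loops_rec[of "n - 1" n] n by (simp add: loop_def)
    moreover have "n - (n - 1) = 1" using n by simp
    ultimately show ?case using n by (simp add: gen_B_def)
  next
    case (step p)
    then have p: "p < n" "Suc p < n" "n - p = Suc (n - Suc p)" by auto
    let ?L = "ev \<beta> (loop_D n (Suc p))" and ?R = "ev \<beta> (loops_D n (Suc p))"
    have IH: "ev (gen_B k) (loops n (Suc p)) = ?R * S ^ (n - Suc p)" "S * ?R = ?R * S" using step by auto
    have "ev (gen_B k) (loops n p) = ?L * S * (?R * S ^ (n - Suc p))"
      unfolding loops_rec[OF p(1)] using loop_gen_B[OF k, of "Suc p"] p IH(1) by simp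
    also have "\<dots> = ?L * (S * ?R) * S ^ (n - Suc p)" by (simp add: mult.assoc)
    also have "\<dots> = ev \<beta> (loops_D n p) * S ^ (n - p)"
      unfolding IH(2) p(3) loops_D_rec[OF p(2)] by (simp add: mult.assoc)
    finally have "ev (gen_B k) (loops n p) = ev \<beta> (loops_D n p) * S ^ (n - p)" .
    moreover have "S * ev \<beta> (loops_D n p) = ev \<beta> (loops_D n p) * S"
      unfolding loops_D_rec[OF p(2)] using S_loop_D[of "Suc p"] IH(2)
      by simp (metis mult.assoc)
    ultimately show ?case ..
  qed
  then show "ev (gen_B k) (loops n p) = ev \<beta> (loops_D n p) * S ^ (n - p)"
    "S * ev \<beta> (loops_D n p) = ev \<beta> (loops_D n p) * S" by auto
qed

text \<open>The factor of \<open>w_D\<close> passes the fork as n, n - 1 and the loop as n - 1, n,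
  which agree because the two commute. The middle letter leaves one \<open>S\<close>, and everything
  here commutes with it.\<close>

lemma block_gen_B:
  assumes k: "k = n - 1 \<or> k = n" and "a < b" "b < n"
  shows "ev (gen_B k) (block n a b) = ev \<beta> (factor_D n a b) * S"
    "S * ev \<beta> (factor_D n a b) = ev \<beta> (factor_D n a b) * S"
proof -
  let ?r = "rev [Suc a..<b]"
  have r: "ev (gen_B k) ?r = ev \<beta> ?r" using assms by (intro ev_gen_B) auto
  have Sr: "S * ev \<beta> ?r = ev \<beta> ?r * S" using assms by (intro S_commute_word) auto
  have f: "ev \<beta> (factor_D n a b) = ev \<beta> (loop_D n b) * ev \<beta> ?r"
  proof -
    have "rev [Suc a..<Suc n] = [n, n - 1] @ rev [Suc a..<n - 1]"
      using assms upt_Suc_append[of "Suc a" "n - 1"] by simp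
    also have "rev [Suc a..<n - 1] = rev [b..<n - 1] @ rev [Suc a..<b]" using assms by (intro rev_upt_split) auto
    finally have "factor_D n a b = [b..<n - 1] @ [n, n - 1] @ rev [b..<n - 1] @ ?r"
      using assms by (simp add: factor_D_def)
    then show ?thesis
      using mult_eq_left[OF fork_commute] by (simp add: loop_D_def mult.assoc)
  qed
  have "ev (gen_B k) (block n a b) = ev \<beta> (loop_D n b) * (S * ev \<beta> ?r)"
    using loop_gen_B[OF k, of b] r assms by (simp add: block_def mult.assoc)
  then show "ev (gen_B k) (block n a b) = ev \<beta> (factor_D n a b) * S" unfolding Sr f by (simp add: mult.assoc)
  have "S * ev \<beta> (factor_D n a b) = (S * ev \<beta> (loop_D n b)) * ev \<beta> ?r" unfolding f by (simp add: mult.assoc)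
  also have "\<dots> = ev \<beta> (loop_D n b) * (S * ev \<beta> ?r)" using S_loop_D[of b] assms by (simp add: mult.assoc)
  finally show "S * ev \<beta> (factor_D n a b) = ev \<beta> (factor_D n a b) * S" unfolding Sr f by (simp add: mult.assoc)
qed

text \<open>\<open>l\<close> counts the \<open>S\<close> left behind by earlier blocks. All blocks
  but the last commute with \<open>S\<close>; the last one starts with \<open>S\<close> followed by
  the generator k, which the accumulated power must turn into \<open>s (n - 1)\<close>. The parity
  of the total number of \<open>S\<close> therefore decides between k = n - 1 and k = n.\<close>

lemma word_gen_B:
  assumes "sum_list as + p = n" "\<forall>x\<in>set as. 1 \<le> x" "as \<noteq> []"
    "k = (if even (l + length as) then n - 1 else n)"
  shows "S ^ l * ev (gen_B k) (factors (block n) p as) = ev \<beta> (factors (factor_D n) p as) * S ^ (l + length as)"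
  using assms
proof (induction as arbitrary: p l)
  case (Cons a as)
  have k: "k = n - 1 \<or> k = n" using Cons.prems by auto
  show ?case
  proof (cases "as = []")
    case True
    then have pa: "p + a = n" "p < n" using Cons.prems by auto
    have fD: "factor_D n p n = rev [Suc p..<n]" using n by (auto simp: factor_D_def)
    have bl: "block n p n = n # rev [Suc p..<n]" by (simp add: block_def loop_def)
    have gn: "gen_B k n = S" by (simp add: gen_B_def)
    have "S ^ l * (S * ev (gen_B k) (rev [Suc p..<n])) = ev \<beta> (rev [Suc p..<n]) * S ^ Suc l"
    proof (cases "Suc p < n")
      case False
      then show ?thesis by (simp add: power_commutes)
    next
      case True
      have r: "rev [Suc p..<n] = (n - 1) # rev [Suc p..<n - 1]"
        using True upt_Suc_append[of "Suc p" "n - 1"] by simp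
      let ?R = "ev \<beta> (rev [Suc p..<n - 1])"
      have e: "ev (gen_B k) (rev [Suc p..<n - 1]) = ?R" by (intro ev_gen_B) auto
      have SR: "S * ?R = ?R * S" by (intro S_commute_word) auto
      have g: "gen_B k (n - 1) = \<beta> k" using n by (auto simp: gen_B_def)
      show ?thesis
      proof (cases "even (Suc l)")
        case True
        then have "k = n - 1" "S ^ l = S" "S ^ Suc l = 1"
          using Cons.prems(4) \<open>as = []\<close> S_power[of l] S_power[of "Suc l"] by auto
        then show ?thesis unfolding r using e g by (simp add: S_square' del: power_Suc One_nat_def)
      next
        case False
        then have k: "k = n" and p: "S ^ l = 1" "S ^ Suc l = S"
          using Cons.prems(4) \<open>as = []\<close> S_power[of l] S_power[of "Suc l"] by auto
        have "S * (\<beta> n * ?R) = \<beta> (n - 1) * (S * ?R)" using S_fork(2) by (simp add: mult.assoc[symmetric])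
        then show ?thesis unfolding r p using e g k SR by (simp add: mult.assoc del: One_nat_def)
      qed
    qed
    then show ?thesis using True pa(1) fD bl gn by simp
  next
    case False
    then have "1 \<le> sum_list as" using Cons.prems(2) by (cases as) auto
    then have pa: "p < p + a" "p + a < n" using Cons.prems by auto
    note b = block_gen_B[OF k pa]
    let ?F = "ev \<beta> (factor_D n p (p + a))" and ?G = "ev (gen_B k) (factors (block n) (p + a) as)"
    have SF: "S ^ l * ?F = ?F * S ^ l" using power_commuting_commutes[OF b(2)] .
    have "S ^ l * ev (gen_B k) (factors (block n) p (a # as)) = (S ^ l * ?F) * (S * ?G)"
      using b(1) by (simp add: mult.assoc)
    also have "\<dots> = ?F * (S ^ Suc l * ?G)" unfolding SF power_Suc2 by (simp only: mult.assoc)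
    also have "S ^ Suc l * ?G = ev \<beta> (factors (factor_D n) (p + a) as) * S ^ (Suc l + length as)"
      using Cons.prems False by (intro Cons.IH) auto
    finally show ?thesis by (simp add: mult.assoc del: power_Suc)
  qed
qed simp

lemma even_power_loops:
  assumes k: "k = n - 1 \<or> k = n" and "p < n" "even j"
  shows "ev (gen_B k) (loops n p) ^ j = ev \<beta> (loops_D n p) ^ j"
proof -
  let ?L = "ev \<beta> (loops_D n p)"
  have c: "?L * S ^ (n - p) = S ^ (n - p) * ?L"
    using power_commuting_commutes[OF loops_gen_B(2)[OF assms(1,2)]] by simp
  have "(?L * S ^ (n - p)) ^ j = ?L ^ j * (S ^ (n - p)) ^ j"
    by (rule power_mult_distrib_commuting[OF c])
  also have "(S ^ (n - p)) ^ j = S ^ ((n - p) * j)" by (simp add: power_mult)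
  also have "\<dots> = 1" using assms(3) by (intro S_power_even) simp
  finally show ?thesis using loops_gen_B(1)[OF assms(1,2)] by simp
qed

text \<open>All exponent differences are even, so every \<open>S\<close> inside the loops cancels.
  This is why type D needs 2d factors even for the trivial automorphism.\<close>

lemma twists_gen_B:
  assumes k: "k = n - 1 \<or> k = n" and "sum_list as + p = n" "\<forall>x\<in>set as. 1 \<le> x \<and> even (D div x)" "even e"
  shows "ev (gen_B k) (twists (loops n) D p e as) = ev \<beta> (twists (loops_D n) D p e as)"
  using assms(2-4)
proof (induction as arbitrary: p e)
  case (Cons a as)
  have "ev (gen_B k) (loops n p) ^ (D div a - e) = ev \<beta> (loops_D n p) ^ (D div a - e)"
    using Cons.prems by (intro even_power_loops[OF k]) auto
  moreover have "ev (gen_B k) (twists (loops n) D (p + a) (D div a) as)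
      = ev \<beta> (twists (loops_D n) D (p + a) (D div a) as)"
    using Cons.prems by (intro Cons.IH) auto
  ultimately show ?case by (simp add: ev_concat_replicate)
qed simp

text \<open>A word containing \<open>S\<close> is not a braid, but applied to the identity class it
  yields one. This is the way back from operator identities of type B to braids of type D.\<close>

lemma app_gen_B:
  assumes k: "k = n - 1 \<or> k = n" and "v \<in> lists {1..n}"
  shows "\<exists>y\<in>lists (nodes (TypeD n)). app (ev (gen_B k) v) (cB []) = cB y"
  using assms(2)
proof (induction v)
  case (Cons i v)
  then obtain y where y: "y \<in> lists (nodes (TypeD n))" "app (ev (gen_B k) v) (cB []) = cB y" by auto
  show ?case
  proof (cases "i = n")
    case True
    then have "gen_B k i = S" by (simp add: gen_B_def)
    then show ?thesis using y app_S[OF y(1)] map_lists(1)[OF y(1)]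
      by (intro bexI[of _ "map (fork_swap n) y"]) simp_all
  next
    case False
    define j where "j = (if i = n - 1 then k else i)"
    have j: "[j] \<in> lists (nodes (TypeD n))" using Cons.hyps k n by (auto simp: j_def nodes_D)
    have "app (ev \<beta> [j]) (cB y) = cB (j # y)" using app_beta[OF j y(1)] by simp
    moreover have "gen_B k i = \<beta> j" using False by (simp add: gen_B_def j_def)
    ultimately have "app (ev (gen_B k) (i # v)) (cB []) = cB (j # y)" using y(2) by simp
    moreover have "j # y \<in> lists (nodes (TypeD n))" using j y(1) by simp
    ultimately show ?thesis by (intro bexI[of _ "j # y"])
  qed
qed (auto intro!: bexI[of _ "[]"])

lemma app_S_power: "u \<in> lists (nodes (TypeD n)) \<Longrightarrow>
    \<exists>y\<in>lists (nodes (TypeD n)). app (S ^ k) (cB u) = cB y \<and> (u = [] \<longrightarrow> y = [])"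
  using app_S[of u] map_lists(1)[of u] S_power[of k] by auto

lemma red_loops_D:
  assumes "p < n"
  shows "reduced (loops_D n p)"
proof (rule ascending_reduced)
  show "valid (TypeD n)" using n by simp
  show "loops_D n p \<in> lists (nodes (TypeD n))" using set_loops_D[of n p] by (auto simp: nodes_D in_lists_conv_set)
  show "ascending (TypeD n) (loops_D n p) (generic (TypeD n))"
    using assms by (intro ascending_loops_D) (auto simp: generic_def)
qed

lemma app_loops:
  assumes k: "k = n - 1 \<or> k = n" and "p < n"
  shows "app (ev (gen_B k) (loops n p)) (cB []) = cB (loops_D n p)"
proof -
  have "loops_D n p \<in> lists (nodes (TypeD n))" using set_loops_D[of n p] by (auto simp: nodes_D in_lists_conv_set)
  then show ?thesis
    using loops_gen_B(1)[OF assms] app_S_power[of "[]" "n - p"] app_beta[of "loops_D n p" "[]"] by auto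
qed

text \<open>For j < n the loop at j comes to the front as in type B. For j = n the loop at n - 1 is
  used: it consists of the two commuting letters of the fork, so it can start with n as
  well.\<close>

lemma loops_D_left_divisor:
  assumes "Suc p < n" "j \<in> {Suc p..n}"
  shows "\<exists>v. loops_D n p \<approx> j # v"
proof -
  have nn: "n - 1 = n - 1 \<or> n - 1 = n" by simp
  interpret b: braid_seq_B "gen_B (n - 1)" n by (rule braid_seq_gen_B) simp
  define i where "i = (if j = n then n - 1 else j)"
  have i: "i \<in> {Suc p..n}" "i < n" "1 \<le> i" using assms by (auto simp: i_def)
  obtain v where v: "v \<in> lists {Suc p..n}"
    "ev (gen_B (n - 1)) (loops n p) = ev (gen_B (n - 1)) (loop n i @ v)"
    using b.loops_left_divisor[OF i(1)] by auto
  have "v \<in> lists {1..n}" using v(1) by (auto simp: in_lists_conv_set)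
  from app_gen_B[OF nn this] obtain y where y: "y \<in> lists (nodes (TypeD n))" "app (ev (gen_B (n - 1)) v) (cB []) = cB y"
    by auto
  have ll: "loop_D n i \<in> lists (nodes (TypeD n))" using i by (auto simp: loop_D_def nodes_D in_lists_conv_set)
  have "cB (loops_D n p) = app (ev (gen_B (n - 1)) (loop n i @ v)) (cB [])"
    using app_loops[OF nn, of p] assms(1) v(2) by simp
  also have "\<dots> = cB (loop_D n i @ map (fork_swap n) y)"
    using loop_gen_B[OF nn i(3,2)] y app_S[OF y(1)] app_beta[OF ll map_lists(1)[OF y(1)]] by simp
  finally have "cB (loops_D n p) = cB (loop_D n i @ map (fork_swap n) y)" .
  moreover have "loops_D n p \<in> lists (nodes (TypeD n))" using set_loops_D[of n p] by (auto simp: nodes_D in_lists_conv_set)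
  ultimately have 1: "loops_D n p \<approx> loop_D n i @ map (fork_swap n) y" by (simp add: word_class_eq_iff)
  show ?thesis
  proof (cases "j = n")
    case False
    then have "\<exists>u. loop_D n i = j # u"
      using assms by (cases "j = n - 1") (auto simp: i_def loop_D_def upt_conv_Cons)
    then show ?thesis using 1 by auto
  next
    case True
    then have "loop_D n i = [n - 1, n]" by (simp add: i_def loop_D_def)
    moreover have "[n - 1, n] \<approx> [n, n - 1]"
      using fork_commute beta_eq_iff[of "[n - 1, n]" "[n, n - 1]"] n by (simp add: nodes_D)
    from word_eq_append[OF this word_eq.refl[OF map_lists(1)[OF y(1)]]]
    have "[n - 1, n] @ map (fork_swap n) y \<approx> [n, n - 1] @ map (fork_swap n) y" .
    ultimately have "loops_D n p \<approx> n # ([n - 1] @ map (fork_swap n) y)"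
      using word_eq.trans[OF 1] by simp
    then show ?thesis using True by auto
  qed
qed

lemma w_D_class:
  assumes "is_partition \<alpha> n"
  shows "w_D n \<alpha> = cW (factors (factor_D n) 0 \<alpha>)"
proof -
  let ?t = "TypeD n"
  note part = parts_of_partition[OF assms]
  have psum_n: "psum \<alpha> i \<le> n" for i using psum_le[of \<alpha> i] part(2) by simp
  have "map (\<lambda>i. w_D_factor n (psum \<alpha> (i - 1)) (psum \<alpha> i)) [1..<Suc (length \<alpha>)]
    = map (\<lambda>i. cW (factor_D n (psum \<alpha> (i - 1)) (psum \<alpha> i))) [1..<Suc (length \<alpha>)]"
  proof (rule map_cong[OF HOL.refl])
    fix i assume "i \<in> set [1..<Suc (length \<alpha>)]"
    then have i: "i - 1 < length \<alpha>" "i = Suc (i - 1)" by auto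
    let ?a = "psum \<alpha> (i - 1)" and ?b = "psum \<alpha> i"
    have "1 \<le> \<alpha> ! (i - 1)" using part(3) i by auto
    then have ab: "?a < ?b" using psum_Suc[OF i(1)] i(2) by simp
    have bn: "?b \<le> n" by (rule psum_n)
    show "w_D_factor n ?a ?b = cW (factor_D n ?a ?b)"
    proof (cases "?b \<le> n - 1")
      case True
      have e: "Suc (n - 2) = n - 1" using n by simp
      have l: "rev [?b..<n - 1] \<in> lists (nodes ?t)" "[?b..<n - 1] \<in> lists (nodes ?t)"
        "rev [Suc ?a..<Suc n] \<in> lists (nodes ?t)"
        using ab bn by (auto simp: nodes_D in_lists_conv_set simp del: upt_Suc)
      have "seg ?t (n - 2) ?b = cW (rev [?b..<n - 1])"
        using seg_class[of ?b "n - 2"] ab unfolding e by simp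
      moreover have "seg ?t n (?a + 1) = cW (rev [Suc ?a..<Suc n])"
        using seg_class[of "?a + 1" n] by simp
      ultimately show ?thesis
        unfolding w_D_factor_def factor_D_def weyl_group_eq
        using l inv_class[OF l(1)] True by (simp del: upt_Suc)
    next
      case False
      have e: "Suc (n - 1) = n" using n by simp
      have "seg ?t (n - 1) (?a + 1) = cW (rev [Suc ?a..<n])"
        using seg_class[of "?a + 1" "n - 1"] unfolding e by simp
      then show ?thesis unfolding w_D_factor_def factor_D_def using False by simp
    qed
  qed
  moreover have "factor_D n (psum \<alpha> (i - 1)) (psum \<alpha> i) \<in> lists (nodes ?t)"
    if "i \<in> set [1..<Suc (length \<alpha>)]" for i
  proof -
    have "i - 1 < length \<alpha>" "i = Suc (i - 1)" using that by auto
    then have "1 \<le> psum \<alpha> i" using psum_Suc[of "i - 1" \<alpha>] part(3) by (metis add_increasing le0 nth_mem)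
    from set_factor_D[OF this, of n "psum \<alpha> (i - 1)"] show ?thesis by (auto simp: nodes_D in_lists_conv_set)
  qed
  ultimately show ?thesis
    unfolding w_D_def weyl_group_eq factors_concat by (simp only: list_prod_map_word_class add_0)
qed

lemma twists_lists: "twists (loops_D n) D p e as \<in> lists (nodes (TypeD n))"
proof (induction as arbitrary: p e)
  case (Cons a as)
  have "loops_D n p \<in> lists (nodes (TypeD n))" using set_loops_D[of n p] by (auto simp: nodes_D in_lists_conv_set)
  then show ?case using Cons by (auto simp: in_lists_conv_set)
qed simp

text \<open>Divisibility is taken over from type B. The power of \<open>S\<close> behind the word
  merely relabels the cofactor, so the word remains a prefix of a reduced one.\<close>

lemma reduced_word_D:
  assumes "is_partition \<alpha> n"
  shows "reduced (factors (factor_D n) 0 \<alpha>)"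
proof -
  note part = parts_of_partition[OF assms]
  have ne: "\<alpha> \<noteq> []" using part(2) n by auto
  define k where "k = (if even (0 + length \<alpha>) then n - 1 else n)"
  have k: "k = n - 1 \<or> k = n" by (simp add: k_def)
  interpret b: braid_seq_B "gen_B k" n by (rule braid_seq_gen_B[OF k])
  let ?w = "factors (factor_D n) 0 \<alpha>"
  have wl: "?w \<in> lists (nodes (TypeD n))" using set_word_D[OF part(3), of n 0] by (auto simp: nodes_D in_lists_conv_set)
  have w: "ev (gen_B k) (factors (block n) 0 \<alpha>) = ev \<beta> ?w * S ^ length \<alpha>"
    using word_gen_B[OF part(2,3) ne k_def] by simp
  obtain v where v: "v \<in> lists {Suc 0..n}" "ev (gen_B k) (factors (block n) 0 \<alpha> @ v) = ev (gen_B k) (loops n 0)"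
    using b.word_B_prefix[OF part(2,3)] by auto
  obtain y where y: "y \<in> lists (nodes (TypeD n))" "app (ev (gen_B k) v) (cB []) = cB y"
    using app_gen_B[OF k v(1)[folded One_nat_def]] by auto
  obtain z where z: "z \<in> lists (nodes (TypeD n))" "app (S ^ length \<alpha>) (cB y) = cB z"
    using app_S_power[OF y(1), of "length \<alpha>"] by auto
  have "cB (loops_D n 0) = app (ev (gen_B k) (factors (block n) 0 \<alpha> @ v)) (cB [])"
    using app_loops[OF k, of 0] n v(2) by simp
  also have "\<dots> = cB (?w @ z)" using w y z app_beta[OF wl z(1)] by simp
  finally have "cB (loops_D n 0) = cB (?w @ z)" .
  moreover have red: "reduced (loops_D n 0)" using n by (intro red_loops_D) simp
  ultimately have "loops_D n 0 \<approx> ?w @ z" by (simp add: word_class_eq_iff reduced_def)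
  from beq_reduced[OF this red] show ?thesis by (rule reduced_append)
qed

lemma power_D:
  assumes "is_partition \<alpha> n" "d = Lcm (set \<alpha>)"
  shows "app ((ev \<beta> (factors (factor_D n) 0 \<alpha>) * S ^ length \<alpha>) ^ (2 * d)) (cB []) = cB (twists (loops_D n) (2 * d) 0 0 \<alpha>)"
proof -
  note part = parts_of_partition[OF assms(1)]
  have ne: "\<alpha> \<noteq> []" using part(2) n by auto
  define k where "k = (if even (0 + length \<alpha>) then n - 1 else n)"
  have k: "k = n - 1 \<or> k = n" by (simp add: k_def)
  interpret b: braid_seq_B "gen_B k" n by (rule braid_seq_gen_B[OF k])
  have w: "ev (gen_B k) (factors (block n) 0 \<alpha>) = ev \<beta> (factors (factor_D n) 0 \<alpha>) * S ^ length \<alpha>"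
    using word_gen_B[OF part(2,3) ne k_def] by simp
  have dvd: "\<forall>a\<in>set \<alpha>. a dvd 2 * d" using assms(2) by auto
  have ev: "\<forall>a\<in>set \<alpha>. 1 \<le> a \<and> even (2 * d div a)"
  proof
    fix a assume a: "a \<in> set \<alpha>"
    then have "a dvd d" using assms(2) by auto
    then have "2 * d div a = 2 * (d div a)" by (simp add: div_mult_swap)
    then show "1 \<le> a \<and> even (2 * d div a)" using a part(3) by simp
  qed
  have "(ev \<beta> (factors (factor_D n) 0 \<alpha>) * S ^ length \<alpha>) ^ (2 * d) = ev (gen_B k) (twists (loops n) (2 * d) 0 0 \<alpha>)"
    unfolding w[symmetric] using b.power_B[OF part(1) dvd part(2)] .
  also have "\<dots> = ev \<beta> (twists (loops_D n) (2 * d) 0 0 \<alpha>)"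
    using twists_gen_B[OF k part(2) ev, of 0] by simp
  finally show ?thesis using app_beta[OF twists_lists, of "[]"] by simp
qed

text \<open>If the preceding parts sum to n - 1, the set is empty, unlike in type B; correspondingly
  \<open>loops_D n (n - 1)\<close> is the empty word.\<close>

lemma longest_product_D:
  assumes "is_partition \<alpha> n"
  shows "longest_product (TypeD n) (length \<alpha>)
      (\<lambda>i. if psum \<alpha> (i - 1) \<le> n - 2 then {psum \<alpha> (i - 1) + 1 .. n} else {}) (\<lambda>i. D div (\<alpha> ! (i - 1)))
    = cB (twists (loops_D n) D 0 0 \<alpha>)"
proof -
  let ?t = "TypeD n" and ?f = "\<lambda>i. loops_D n (0 + psum \<alpha> (i - 1))"
  let ?K = "\<lambda>i. if psum \<alpha> (i - 1) \<le> n - 2 then {psum \<alpha> (i - 1) + 1 .. n} else {}"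
  note part = parts_of_partition[OF assms]
  have long: "canonical_lift ?t (longest_element ?t (?K i)) = cB (?f i)" if i: "i \<in> {1..length \<alpha>}" for i
  proof -
    let ?p = "psum \<alpha> (i - 1)"
    have p: "?p < n" using psum_less[of "i - 1" \<alpha>] part i by auto
    have red: "reduced (loops_D n ?p)" using p by (rule red_loops_D)
    have "canonical_lift ?t (longest_element ?t (?K i)) = cB (loops_D n ?p)"
    proof (rule lift_longest_element[OF _ red])
      show "?K i \<subseteq> nodes ?t" by (simp add: nodes_D)
      show "loops_D n ?p \<in> lists (?K i)"
        using set_loops_D[of n ?p] n by (cases "?p \<le> n - 2") (auto simp: in_lists_conv_set)
      fix j assume "j \<in> ?K i"
      then have "Suc ?p < n" "j \<in> {Suc ?p..n}" using n by (auto split: if_splits)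
      then show "\<exists>v. loops_D n ?p \<approx> j # v" by (rule loops_D_left_divisor)
    qed
    then show ?thesis by simp
  qed
  have fl: "?f i \<in> lists (nodes ?t)" for i
    using set_loops_D[of n "psum \<alpha> (i - 1)"] by (auto simp: nodes_D in_lists_conv_set)
  show ?thesis
    unfolding twists_concat
    by (rule longest_product_exponent[OF long fl, where h = "\<lambda>a. D div a"])
qed

end

lemma twisted_power_w_D:
  assumes "n \<ge> 2" "\<sigma> (0::nat) = id"
    "\<sigma> 1 (simple_refl (TypeD n) (n - 1)) = simple_refl (TypeD n) n"
    "\<sigma> 1 (simple_refl (TypeD n) n) = simple_refl (TypeD n) (n - 1)"
    "\<forall>i \<in> {1..n - 2}. \<sigma> 1 (simple_refl (TypeD n) i) = simple_refl (TypeD n) i"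
    "\<epsilon> \<in> {0, 1}" "is_partition \<alpha> n" "even (int (length \<alpha>) - int \<epsilon>)" "d = Lcm (set \<alpha>)"
  shows "twisted_power (TypeD n) (\<sigma> \<epsilon>) (canonical_lift (TypeD n) (w_D n \<alpha>)) (2 * d)
    = longest_product (TypeD n) (length \<alpha>)
        (\<lambda>i. if psum \<alpha> (i - 1) \<le> n - 2 then {psum \<alpha> (i - 1) + 1 .. n} else {})
        (\<lambda>i. 2 * d div (\<alpha> ! (i - 1)))"
proof -
  let ?t = "TypeD n"
  interpret type_D_aut n "\<sigma> 1"
  proof
    fix i assume "i \<in> {1..n}"
    then have "i = n \<or> i = n - 1 \<or> i \<in> {1..n - 2}" by auto
    then show "\<sigma> 1 (simple_refl ?t i) = simple_refl ?t (fork_swap n i)"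
      using assms(1,3-5) by (auto simp: fork_swap_def)
  qed (rule assms(1))
  let ?w = "factors (factor_D n) 0 \<alpha>"
  have wl: "?w \<in> lists (nodes ?t)" using reduced_word_D[OF assms(7)] by (simp add: reduced_def)
  have lift: "canonical_lift ?t (w_D n \<alpha>) = cB ?w"
    unfolding w_D_class[OF assms(7)] by (rule canonical_lift_class[OF reduced_word_D[OF assms(7)]])
  have "twisted_power ?t (\<sigma> \<epsilon>) (cB ?w) (2 * d) = app ((ev \<beta> ?w * S ^ length \<alpha>) ^ (2 * d)) (cB [])"
  proof (cases "\<epsilon> = 0")
    case True
    \<comment> \<open>The computation uses the operator of the nontrivial automorphism also for
      \<epsilon> = 0. An even number of parts cancels it, which matches the trivial twist.\<close>
    then have "S ^ length \<alpha> = 1" using assms(8) by (intro S_power_even) simp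
    moreover interpret triv: dynkin_aut ?t id id id
      using entry_gt_1 by unfold_locales auto
    have "triv.S = 1"
    proof (rule endo_eqI)
      fix x show "app triv.S x = app 1 x"
      proof (cases "x \<in> carrier B")
        case True
        then show ?thesis by (rule presented_carrierE) (simp add: triv.app_S)
      qed (simp add: triv.S_def)
    qed
    ultimately show ?thesis using triv.app_twisted_power[OF wl, of "2 * d"] True assms(2) by simp
  next
    case False
    then have e: "\<epsilon> = 1" using assms(6) by simp
    then have "odd (length \<alpha>)" using assms(8) by simp
    then have "S ^ length \<alpha> = S" using S_power by simp
    then show ?thesis using app_twisted_power[OF wl, of "2 * d"] e by simp
  qed
  also have "\<dots> = cB (twists (loops_D n) (2 * d) 0 0 \<alpha>)" by (rule power_D[OF assms(7,9)])
  finally show ?thesis unfolding lift longest_product_D[OF assms(7)] .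
qed

theorem corollary7p25:
  shows
   "(\<forall>(n::nat) (\<alpha>::nat list) \<sigma>.
       n \<ge> 1 \<longrightarrow>
       diagram_aut_order2 (TypeA n) \<sigma> \<longrightarrow>
       weakly_decreasing_pos \<alpha> \<longrightarrow>
       (\<Sum>a\<leftarrow>\<alpha>. 2 * a - 1) = n + 1 \<longrightarrow>
       (let d = Lcm ((\<lambda>a. 2 * a - 1) ` set \<alpha>);
            e = (\<lambda>i. 2 * d div (2 * \<alpha> ! (i - 1) - 1));
            K = (\<lambda>i. {psum \<alpha> (i - 1) + 2 - i .. n - psum \<alpha> (i - 1)})
        in twisted_power (TypeA n) \<sigma> (canonical_lift (TypeA n) (w_A n \<alpha>)) (2 * d)
           = longest_product (TypeA n) (length \<alpha>) K e))
    \<and>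
    (\<forall>(n::nat) (\<alpha>::nat list).
       n \<ge> 1 \<longrightarrow>
       is_partition \<alpha> n \<longrightarrow>
       (let d = Lcm (set \<alpha>);
            e = (\<lambda>i. d div (\<alpha> ! (i - 1)));
            K = (\<lambda>i. {psum \<alpha> (i - 1) + 1 .. n})
        in canonical_lift (TypeB n) (w_B n \<alpha>) [^]\<^bsub>braid_monoid (TypeB n)\<^esub> d
           = longest_product (TypeB n) (length \<alpha>) K e))
    \<and>
    (\<forall>(n::nat) (\<alpha>::nat list) \<sigma> (\<epsilon>::nat).
       n \<ge> 2 \<longrightarrow>
       \<sigma> (0::nat) = id \<longrightarrow>
       diagram_aut_order2 (TypeD n) (\<sigma> 1) \<longrightarrow>
       \<sigma> 1 (simple_refl (TypeD n) (n - 1)) = simple_refl (TypeD n) n \<longrightarrow>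
       \<sigma> 1 (simple_refl (TypeD n) n) = simple_refl (TypeD n) (n - 1) \<longrightarrow>
       (\<forall>i \<in> {1..n - 2}. \<sigma> 1 (simple_refl (TypeD n) i) = simple_refl (TypeD n) i) \<longrightarrow>
       \<epsilon> \<in> {0, 1} \<longrightarrow>
       is_partition \<alpha> n \<longrightarrow>
       even (int (length \<alpha>) - int \<epsilon>) \<longrightarrow>
       (let d = Lcm (set \<alpha>);
            e = (\<lambda>i. 2 * d div (\<alpha> ! (i - 1)));
            K = (\<lambda>i. if psum \<alpha> (i - 1) \<le> n - 2 then {psum \<alpha> (i - 1) + 1 .. n} else {})
        in twisted_power (TypeD n) (\<sigma> \<epsilon>) (canonical_lift (TypeD n) (w_D n \<alpha>)) (2 * d)
           = longest_product (TypeD n) (length \<alpha>) K e))"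
proof (intro conjI allI impI)
  fix n :: nat and \<alpha> :: "nat list" and \<sigma>
  assume "n \<ge> 1" "diagram_aut_order2 (TypeA n) \<sigma>" "weakly_decreasing_pos \<alpha>" "(\<Sum>a\<leftarrow>\<alpha>. 2 * a - 1) = n + 1"
  then show "let d = Lcm ((\<lambda>a. 2 * a - 1) ` set \<alpha>);
            e = (\<lambda>i. 2 * d div (2 * \<alpha> ! (i - 1) - 1));
            K = (\<lambda>i. {psum \<alpha> (i - 1) + 2 - i .. n - psum \<alpha> (i - 1)})
        in twisted_power (TypeA n) \<sigma> (canonical_lift (TypeA n) (w_A n \<alpha>)) (2 * d)
           = longest_product (TypeA n) (length \<alpha>) K e"
    unfolding Let_def by (rule twisted_power_w_A) simp
next
  fix n :: nat and \<alpha> :: "nat list"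
  assume "is_partition \<alpha> n"
  then show "let d = Lcm (set \<alpha>);
            e = (\<lambda>i. d div (\<alpha> ! (i - 1)));
            K = (\<lambda>i. {psum \<alpha> (i - 1) + 1 .. n})
        in canonical_lift (TypeB n) (w_B n \<alpha>) [^]\<^bsub>braid_monoid (TypeB n)\<^esub> d
           = longest_product (TypeB n) (length \<alpha>) K e"
    unfolding Let_def by (rule power_w_B) simp
next
  fix n :: nat and \<alpha> :: "nat list" and \<sigma> :: "nat \<Rightarrow> nat list set \<Rightarrow> nat list set" and \<epsilon> :: nat
  assume "n \<ge> 2" "\<sigma> 0 = id"
    "\<sigma> 1 (simple_refl (TypeD n) (n - 1)) = simple_refl (TypeD n) n"
    "\<sigma> 1 (simple_refl (TypeD n) n) = simple_refl (TypeD n) (n - 1)"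
    "\<forall>i \<in> {1..n - 2}. \<sigma> 1 (simple_refl (TypeD n) i) = simple_refl (TypeD n) i"
    "\<epsilon> \<in> {0, 1}" "is_partition \<alpha> n" "even (int (length \<alpha>) - int \<epsilon>)"
  then show "let d = Lcm (set \<alpha>);
            e = (\<lambda>i. 2 * d div (\<alpha> ! (i - 1)));
            K = (\<lambda>i. if psum \<alpha> (i - 1) \<le> n - 2 then {psum \<alpha> (i - 1) + 1 .. n} else {})
        in twisted_power (TypeD n) (\<sigma> \<epsilon>) (canonical_lift (TypeD n) (w_D n \<alpha>)) (2 * d)
           = longest_product (TypeD n) (length \<alpha>) K e"
    unfolding Let_def by (rule twisted_power_w_D) simp
qed

end
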